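(* Let $M_H=\{(z,w)\in\mathbb C^2\times\mathbb C:\operatorname{Im}w=P_C(z,\bar z)\}$ be a holomorphically nondegenerate model hypersurface, where $P_C$ is a real-valued weighted homogeneous polynomial of weighted degree $1$ with respect to the finite multitype weights $(\mu_1,\mu_2)$, without pluriharmonic terms. Then the component $\mathfrak g_1$ of weight $1$ of $\mathrm{aut}(M_H,0)$ satisfies $\dim\mathfrak g_1>0$ if and only if in suitable multitype coordinates $M_H$ is a balanced hypersurface.
   Context: Multitype. A weight is a pair of rationals $\Lambda=(\lambda_1,\lambda_2)$ with $\frac12\ge\lambda_1\ge\lambda_2\ge0$; $z_j,\bar z_j$ have weight $\lambda_j$ and $w,u=\operatorname{Re}w,v=\operatorname{Im}w$ have weight $1$. For a smooth real hypersurface $M\subset\mathbb C^3$ and $p\in M$ of finite type, $\Lambda$ is distinguished if there are local holomorphic coordinates $(z_1,z_2,w)$ centered at $p$ in which $M$ is given by $v=P(z,\bar z)+o_\Lambda(1)$, where $P$ is a nonzero $\Lambda$-homogeneous polynomial of weighted degree $1$ without pluriharmonic terms and $o_\Lambda(1)$ is a smooth function whose derivatives of weighted order $\le1$ vanish at $0$. The multitype weight $(\mu_1,\mu_2)$ is the infimum of all distinguished weights in lexicographic order; the multitype is finite if $\mu_1,\mu_2\ne0$. Writing $\Lambda_M=(\mu_1,\mu_2)$ for the multitype weight, local holomorphic coordinates $(z_1,z_2,w)$ centered at $p$ in which $M$ is given by $v=P(z,\bar z)+o_{\Lambda_M}(1)$, with $P$ a nonzero $\Lambda_M$-homogeneous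 polynomial of weighted degree $1$ without pluriharmonic terms, are called multitype coordinates. Here $(\mu_1,\mu_2)$ is the multitype weight of $M_H$ at $0$. $\mathrm{aut}(M_H,0)$ is the real Lie algebra of germs at $0$ of holomorphic vector fields $X$ on $\mathbb C^3$ with $\operatorname{Re}X$ tangent to $M_H$, graded by weight, with $z_j$ of weight $\mu_j$, $w$ of weight $1$, $\partial_{z_j}$ of weight $-\mu_j$, $\partial_w$ of weight $-1$; $\mathfrak g_1$ is its component of weight $1$. Balanced. $P_C$ (and $M_H$) is balanced if it can be written as $P_C(z,\bar z)=\sum_{|\alpha|_\Lambda=|\hat\alpha|_\Lambda=1}A_{\alpha,\hat\alpha}z^\alpha\bar z^{\hat\alpha}$ for some nonzero pair of real numbers $\Lambda=(\lambda_1,\lambda_2)$ (not necessarily related to the multitype weights), where $|\alpha|_\Lambda=\lambda_1\alpha_1+\lambda_2\alpha_2$ and $\alpha,\hat\alpha$ are independent multiindices. $M_H$ is holomorphically nondegenerate (at $0$) if no nonzero germ at $0$ of a holomorphic vector field on $\mathbb C^3$ is tangent to $M_H$ as a complex vector field. *)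

theory Defs
  imports "HOL-Analysis.Analysis" "HOL-Library.Poly_Mapping"
begin

text \<open>
  Points of \<open>\<complex>\<^sup>3\<close> are vectors \<open>q\<close> with \<open>z\<^sub>1 = q $ 1\<close>, \<open>z\<^sub>2 = q $ 2\<close>, \<open>w = q $ 3\<close>.
\<close>

section \<open>Polynomials in \<open>z\<close> and \<open>cnj z\<close>\<close>

text \<open>
  The coefficient at \<open>((\<alpha>\<^sub>1, \<alpha>\<^sub>2), (\<beta>\<^sub>1, \<beta>\<^sub>2))\<close> belongs to the monomial
  \<open>z\<^sub>1\<^bsup>\<alpha>\<^sub>1\<^esup> z\<^sub>2\<^bsup>\<alpha>\<^sub>2\<^esup> (cnj z\<^sub>1)\<^bsup>\<beta>\<^sub>1\<^esup> (cnj z\<^sub>2)\<^bsup>\<beta>\<^sub>2\<^esup>\<close>.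
\<close>

type_synonym zpoly = "((nat \<times> nat) \<times> (nat \<times> nat)) \<Rightarrow>\<^sub>0 complex"

definition zpoly_eval :: "zpoly \<Rightarrow> complex \<Rightarrow> complex \<Rightarrow> complex" where
  "zpoly_eval P z1 z2 =
     (\<Sum>((a1, a2), (b1, b2)) \<in> Poly_Mapping.keys P.
        Poly_Mapping.lookup P ((a1, a2), (b1, b2)) * z1 ^ a1 * z2 ^ a2 * cnj z1 ^ b1 * cnj z2 ^ b2)"

definition real_valued :: "zpoly \<Rightarrow> bool" where
  "real_valued P \<longleftrightarrow> (\<forall>z1 z2. zpoly_eval P z1 z2 \<in> \<real>)"

definition weighted_length :: "real \<times> real \<Rightarrow> nat \<times> nat \<Rightarrow> real" where
  "weighted_length \<Lambda> \<alpha> = fst \<Lambda> * real (fst \<alpha>) + snd \<Lambda> * real (snd \<alpha>)"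

definition weighted_homogeneous :: "real \<times> real \<Rightarrow> zpoly \<Rightarrow> bool" where
  "weighted_homogeneous \<Lambda> P \<longleftrightarrow>
     (\<forall>(\<alpha>, \<beta>) \<in> Poly_Mapping.keys P. weighted_length \<Lambda> \<alpha> + weighted_length \<Lambda> \<beta> = 1)"

definition no_pluriharmonic_terms :: "zpoly \<Rightarrow> bool" where
  "no_pluriharmonic_terms P \<longleftrightarrow>
     (\<forall>(\<alpha>, \<beta>) \<in> Poly_Mapping.keys P. \<alpha> \<noteq> (0, 0) \<and> \<beta> \<noteq> (0, 0))"

definition balanced :: "zpoly \<Rightarrow> bool" where
  "balanced P \<longleftrightarrow>
     (\<exists>\<Lambda>. \<Lambda> \<noteq> (0, 0) \<and>
        (\<forall>(\<alpha>, \<beta>) \<in> Poly_Mapping.keys P. weighted_length \<Lambda> \<alpha> = 1 \<and> weighted_length \<Lambda> \<beta> = 1))"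

definition is_weight :: "real \<times> real \<Rightarrow> bool" where
  "is_weight \<Lambda> \<longleftrightarrow> fst \<Lambda> \<in> \<rat> \<and> snd \<Lambda> \<in> \<rat> \<and> 1/2 \<ge> fst \<Lambda> \<and> fst \<Lambda> \<ge> snd \<Lambda> \<and> snd \<Lambda> \<ge> 0"

text \<open>The polynomials allowed as leading term \<open>P\<close> in \<open>v = P(z, cnj z) + o\<^sub>\<Lambda>(1)\<close>.\<close>

definition leading_polynomial :: "real \<times> real \<Rightarrow> zpoly \<Rightarrow> bool" where
  "leading_polynomial \<Lambda> P \<longleftrightarrow>
     P \<noteq> 0 \<and> real_valued P \<and> weighted_homogeneous \<Lambda> P \<and> no_pluriharmonic_terms P"


section \<open>Smooth remainders\<close>

fun iterated_deriv :: "'a::real_normed_vector list \<Rightarrow> ('a \<Rightarrow> real) \<Rightarrow> 'a \<Rightarrow> real" where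
  "iterated_deriv [] f = f"
| "iterated_deriv (d # ds) f = (\<lambda>x. frechet_derivative (iterated_deriv ds f) (at x) d)"

text \<open>On an open set, \<open>C\<^sup>\<infinity>\<close> means that all iterated directional derivatives are differentiable.\<close>

definition smooth_on :: "'a::real_normed_vector set \<Rightarrow> ('a \<Rightarrow> real) \<Rightarrow> bool" where
  "smooth_on S f \<longleftrightarrow> open S \<and> (\<forall>ds. \<forall>x\<in>S. iterated_deriv ds f differentiable (at x))"

text \<open>
  Remainders are functions of \<open>(z\<^sub>1, z\<^sub>2, u)\<close>. The standard basis of \<open>\<complex> \<times> \<complex> \<times> \<real>\<close> gives the real
  partial derivatives in \<open>x\<^sub>1, y\<^sub>1, x\<^sub>2, y\<^sub>2, u\<close>. Those in \<open>x\<^sub>j, y\<^sub>j\<close> are combinations of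
  \<open>\<partial>/\<partial>z\<^sub>j\<close> and \<open>\<partial>/\<partial>(cnj z\<^sub>j)\<close>, and conversely, so all of them carry the weight \<open>\<lambda>\<^sub>j\<close>; \<open>u\<close> has weight \<open>1\<close>.
\<close>

definition direction_weight :: "real \<times> real \<Rightarrow> complex \<times> complex \<times> real \<Rightarrow> real" where
  "direction_weight \<Lambda> d =
     (if fst d \<noteq> 0 then fst \<Lambda> else if fst (snd d) \<noteq> 0 then snd \<Lambda> else 1)"

definition o_weight :: "real \<times> real \<Rightarrow> (complex \<times> complex \<times> real \<Rightarrow> real) \<Rightarrow> bool" where
  "o_weight \<Lambda> R \<longleftrightarrow>
     (\<exists>S. 0 \<in> S \<and> smooth_on S R) \<and>
     (\<forall>ds. set ds \<subseteq> Basis \<and> sum_list (map (direction_weight \<Lambda>) ds) \<le> 1 \<longrightarrow>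
        iterated_deriv ds R 0 = 0)"


section \<open>Holomorphic coordinates and the multitype\<close>

definition complex_differentiable_at :: "(complex^3 \<Rightarrow> complex^3) \<Rightarrow> complex^3 \<Rightarrow> bool" where
  "complex_differentiable_at F q \<longleftrightarrow>
     (\<exists>D. (F has_derivative D) (at q) \<and> (\<forall>c x. D (c *s x) = c *s D x))"

definition holomorphic_map_on :: "(complex^3 \<Rightarrow> complex^3) \<Rightarrow> (complex^3) set \<Rightarrow> bool" where
  "holomorphic_map_on F U \<longleftrightarrow> open U \<and> (\<forall>q\<in>U. complex_differentiable_at F q)"

definition local_coordinates ::
    "(complex^3 \<Rightarrow> complex^3) \<Rightarrow> (complex^3) set \<Rightarrow> complex^3 \<Rightarrow> bool" where
  "local_coordinates \<Phi> U p \<longleftrightarrow>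
     p \<in> U \<and> \<Phi> p = 0 \<and> inj_on \<Phi> U \<and> holomorphic_map_on \<Phi> U \<and>
     holomorphic_map_on (inv_into U \<Phi>) (\<Phi> ` U)"

text \<open>
  In the coordinates \<open>(z\<^sub>1, z\<^sub>2, w) = \<Phi> q\<close>, \<open>q \<in> U\<close>, the set \<open>M\<close> is given by
  \<open>v = P(z, cnj z) + o\<^sub>\<Lambda>(1)\<close>. As \<open>P\<close> is real-valued, \<open>Re\<close> only adjusts the type.
\<close>

definition given_by ::
    "(complex^3) set \<Rightarrow> (complex^3 \<Rightarrow> complex^3) \<Rightarrow> (complex^3) set \<Rightarrow> real \<times> real \<Rightarrow> zpoly \<Rightarrow> bool" where
  "given_by M \<Phi> U \<Lambda> P \<longleftrightarrow>
     (\<exists>R. o_weight \<Lambda> R \<and>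
        (\<forall>q\<in>U. q \<in> M \<longleftrightarrow>
           Im (\<Phi> q $ 3) = Re (zpoly_eval P (\<Phi> q $ 1) (\<Phi> q $ 2)) + R (\<Phi> q $ 1, \<Phi> q $ 2, Re (\<Phi> q $ 3))))"

definition adapted_coordinates ::
    "real \<times> real \<Rightarrow> (complex^3) set \<Rightarrow> complex^3 \<Rightarrow> (complex^3 \<Rightarrow> complex^3) \<Rightarrow> (complex^3) set \<Rightarrow> bool" where
  "adapted_coordinates \<Lambda> M p \<Phi> U \<longleftrightarrow>
     local_coordinates \<Phi> U p \<and> (\<exists>P. leading_polynomial \<Lambda> P \<and> given_by M \<Phi> U \<Lambda> P)"

definition distinguished :: "(complex^3) set \<Rightarrow> complex^3 \<Rightarrow> real \<times> real \<Rightarrow> bool" where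
  "distinguished M p \<Lambda> \<longleftrightarrow> is_weight \<Lambda> \<and> (\<exists>\<Phi> U. adapted_coordinates \<Lambda> M p \<Phi> U)"

text \<open>
  The instance of \<open>\<le>\<close> for pairs provided by the analysis library is the componentwise order.
\<close>

definition lex_le :: "real \<times> real \<Rightarrow> real \<times> real \<Rightarrow> bool" where
  "lex_le \<Lambda> \<Lambda>' \<longleftrightarrow> fst \<Lambda> < fst \<Lambda>' \<or> (fst \<Lambda> = fst \<Lambda>' \<and> snd \<Lambda> \<le> snd \<Lambda>')"

definition multitype_weight :: "(complex^3) set \<Rightarrow> complex^3 \<Rightarrow> real \<times> real \<Rightarrow> bool" where
  "multitype_weight M p \<mu> \<longleftrightarrow>
     is_weight \<mu> \<and>
     (\<forall>\<Lambda>. distinguished M p \<Lambda> \<longrightarrow> lex_le \<mu> \<Lambda>) \<and>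
     (\<forall>\<nu>. is_weight \<nu> \<and> (\<forall>\<Lambda>. distinguished M p \<Lambda> \<longrightarrow> lex_le \<nu> \<Lambda>) \<longrightarrow> lex_le \<nu> \<mu>)"

definition finite_multitype :: "(complex^3) set \<Rightarrow> complex^3 \<Rightarrow> real \<times> real \<Rightarrow> bool" where
  "finite_multitype M p \<mu> \<longleftrightarrow> multitype_weight M p \<mu> \<and> fst \<mu> \<noteq> 0 \<and> snd \<mu> \<noteq> 0"

definition multitype_coordinates ::
    "(complex^3) set \<Rightarrow> complex^3 \<Rightarrow> (complex^3 \<Rightarrow> complex^3) \<Rightarrow> (complex^3) set \<Rightarrow> bool" where
  "multitype_coordinates M p \<Phi> U \<longleftrightarrow>
     (\<exists>\<mu>. multitype_weight M p \<mu> \<and> adapted_coordinates \<mu> M p \<Phi> U)"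


section \<open>Model hypersurfaces\<close>

definition model_function :: "zpoly \<Rightarrow> complex^3 \<Rightarrow> real" where
  "model_function P q = Im (q $ 3) - Re (zpoly_eval P (q $ 1) (q $ 2))"

definition model_hypersurface :: "zpoly \<Rightarrow> (complex^3) set" where
  "model_hypersurface P = {q. model_function P q = 0}"

text \<open>
  The germ at \<open>p\<close> of \<open>M\<close>, written in the coordinates \<open>\<Phi>\<close>, is a balanced model hypersurface
  \<open>v = Q(z, cnj z)\<close>; as for every model, \<open>Q\<close> is homogeneous for the multitype weight and has no
  pluriharmonic terms.
\<close>

definition balanced_in_coordinates ::
    "(complex^3) set \<Rightarrow> complex^3 \<Rightarrow> (complex^3 \<Rightarrow> complex^3) \<Rightarrow> (complex^3) set \<Rightarrow> bool" where
  "balanced_in_coordinates M p \<Phi> U \<longleftrightarrow>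
     (\<exists>\<mu> Q. multitype_weight M p \<mu> \<and> leading_polynomial \<mu> Q \<and> balanced Q \<and>
        \<Phi> ` (M \<inter> U) = model_hypersurface Q \<inter> \<Phi> ` U)"


section \<open>Germs of holomorphic vector fields\<close>

text \<open>A vector field \<open>\<Sum>\<^sub>j X\<^sub>j \<partial>/\<partial>z\<^sub>j\<close> (with \<open>z\<^sub>3 = w\<close>) is represented by \<open>(X\<^sub>1, X\<^sub>2, X\<^sub>3)\<close>.\<close>

definition holomorphic_near_0 :: "(complex^3 \<Rightarrow> complex^3) \<Rightarrow> bool" where
  "holomorphic_near_0 X \<longleftrightarrow> (\<forall>\<^sub>F q in nhds 0. complex_differentiable_at X q)"

definition germ_rel :: "(complex^3 \<Rightarrow> complex^3) \<Rightarrow> (complex^3 \<Rightarrow> complex^3) \<Rightarrow> bool" where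
  "germ_rel X Y \<longleftrightarrow>
     holomorphic_near_0 X \<and> holomorphic_near_0 Y \<and> (\<forall>\<^sub>F q in nhds 0. X q = Y q)"

lemma complex_differentiable_at_const: "complex_differentiable_at (\<lambda>_. 0) q"
  unfolding complex_differentiable_at_def by (intro exI[of _ "\<lambda>_. 0"]) auto

lemma complex_differentiable_at_add:
  assumes "complex_differentiable_at X q" "complex_differentiable_at Y q"
  shows "complex_differentiable_at (\<lambda>x. X x + Y x) q"
proof -
  obtain D E where "(X has_derivative D) (at q)" "\<forall>c x. D (c *s x) = c *s D x"
    "(Y has_derivative E) (at q)" "\<forall>c x. E (c *s x) = c *s E x"
    using assms unfolding complex_differentiable_at_def by blast
  then show ?thesis
    unfolding complex_differentiable_at_def
    by (intro exI[of _ "\<lambda>x. D x + E x"]) (auto intro!: has_derivative_add simp: vector_add_ldistrib)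
qed

lemma complex_differentiable_at_scaleR:
  assumes "complex_differentiable_at X q"
  shows "complex_differentiable_at (\<lambda>x. r *\<^sub>R X x) q"
proof -
  obtain D where "(X has_derivative D) (at q)" "\<forall>c x. D (c *s x) = c *s D x"
    using assms unfolding complex_differentiable_at_def by blast
  then show ?thesis
    unfolding complex_differentiable_at_def
    by (intro exI[of _ "\<lambda>x. r *\<^sub>R D x"])
       (auto intro!: has_derivative_scaleR_right simp: vec_eq_iff)
qed

lemma holomorphic_near_0_zero: "holomorphic_near_0 (\<lambda>_. 0)"
  by (simp add: holomorphic_near_0_def complex_differentiable_at_const)

lemma holomorphic_near_0_add:
  "holomorphic_near_0 X \<Longrightarrow> holomorphic_near_0 Y \<Longrightarrow> holomorphic_near_0 (\<lambda>q. X q + Y q)"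
  unfolding holomorphic_near_0_def
  by (erule (1) eventually_elim2) (rule complex_differentiable_at_add)

lemma holomorphic_near_0_scaleR:
  "holomorphic_near_0 X \<Longrightarrow> holomorphic_near_0 (\<lambda>q. r *\<^sub>R X q)"
  unfolding holomorphic_near_0_def
  by (erule eventually_mono) (rule complex_differentiable_at_scaleR)

lemma germ_rel_refl: "holomorphic_near_0 X \<Longrightarrow> germ_rel X X"
  by (simp add: germ_rel_def)

lemma germ_rel_add:
  assumes "germ_rel X X'" "germ_rel Y Y'"
  shows "germ_rel (\<lambda>q. X q + Y q) (\<lambda>q. X' q + Y' q)"
proof -
  have "\<forall>\<^sub>F q in nhds 0. X q = X' q" "\<forall>\<^sub>F q in nhds 0. Y q = Y' q"
    using assms by (auto simp: germ_rel_def)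
  then have "\<forall>\<^sub>F q in nhds 0. X q + Y q = X' q + Y' q"
    by eventually_elim simp
  then show ?thesis
    using assms by (auto simp: germ_rel_def intro: holomorphic_near_0_add)
qed

lemma germ_rel_scaleR:
  assumes "germ_rel X X'"
  shows "germ_rel (\<lambda>q. r *\<^sub>R X q) (\<lambda>q. r *\<^sub>R X' q)"
proof -
  have "\<forall>\<^sub>F q in nhds 0. X q = X' q"
    using assms by (auto simp: germ_rel_def)
  then have "\<forall>\<^sub>F q in nhds 0. r *\<^sub>R X q = r *\<^sub>R X' q"
    by eventually_elim simp
  then show ?thesis
    using assms by (auto simp: germ_rel_def intro: holomorphic_near_0_scaleR)
qed

quotient_type vf_germ = "complex^3 \<Rightarrow> complex^3" / partial: germ_rel
proof (rule part_equivpI)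
  show "\<exists>X. germ_rel X X"
    using germ_rel_refl holomorphic_near_0_zero by blast
  show "symp germ_rel"
    by (auto simp: symp_def germ_rel_def eq_commute)
  show "transp germ_rel"
  proof (rule transpI)
    fix X Y Z assume XYZ: "germ_rel X Y" "germ_rel Y Z"
    then have "\<forall>\<^sub>F q in nhds 0. X q = Y q" "\<forall>\<^sub>F q in nhds 0. Y q = Z q"
      by (auto simp: germ_rel_def)
    then have "\<forall>\<^sub>F q in nhds 0. X q = Z q"
      by eventually_elim simp
    with XYZ show "germ_rel X Z"
      by (simp add: germ_rel_def)
  qed
qed

instantiation vf_germ :: real_vector
begin

lift_definition zero_vf_germ :: vf_germ is "\<lambda>_. 0"
  by (rule germ_rel_refl[OF holomorphic_near_0_zero])

lift_definition plus_vf_germ :: "vf_germ \<Rightarrow> vf_germ \<Rightarrow> vf_germ" is "\<lambda>X Y q. X q + Y q"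
  by (rule germ_rel_add)

lift_definition scaleR_vf_germ :: "real \<Rightarrow> vf_germ \<Rightarrow> vf_germ" is "\<lambda>r X q. r *\<^sub>R X q"
  by (rule germ_rel_scaleR)

definition uminus_vf_germ :: "vf_germ \<Rightarrow> vf_germ" where
  "uminus_vf_germ X = (-1) *\<^sub>R X"

definition minus_vf_germ :: "vf_germ \<Rightarrow> vf_germ \<Rightarrow> vf_germ" where
  "minus_vf_germ X Y = X + (-1) *\<^sub>R Y"

instance
proof
  note hol = holomorphic_near_0_zero holomorphic_near_0_add holomorphic_near_0_scaleR
  fix X Y Z :: vf_germ and a b :: real
  show "X + Y + Z = X + (Y + Z)"
    by transfer (simp add: germ_rel_def hol add.assoc)
  show "X + Y = Y + X"
    by transfer (simp add: germ_rel_def hol add.commute)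
  show "0 + X = X"
    by transfer (simp add: germ_rel_def)
  show "- X + X = 0"
    unfolding uminus_vf_germ_def by transfer (simp add: germ_rel_def hol)
  show "X - Y = X + - Y"
    by (simp add: minus_vf_germ_def uminus_vf_germ_def)
  show "a *\<^sub>R (X + Y) = a *\<^sub>R X + a *\<^sub>R Y"
    by transfer (simp add: germ_rel_def hol scaleR_add_right)
  show "(a + b) *\<^sub>R X = a *\<^sub>R X + b *\<^sub>R X"
    by transfer (simp add: germ_rel_def hol scaleR_add_left)
  show "a *\<^sub>R b *\<^sub>R X = (a * b) *\<^sub>R X"
    by transfer (simp add: germ_rel_def hol)
  show "1 *\<^sub>R X = X"
    by transfer (simp add: germ_rel_def)
qed

end

text \<open>\<open>\<partial>f/\<partial>z\<^sub>j = (\<partial>f/\<partial>x\<^sub>j - \<i> \<partial>f/\<partial>y\<^sub>j) / 2\<close>, and \<open>X f = \<Sum>\<^sub>j X\<^sub>j \<partial>f/\<partial>z\<^sub>j\<close>, for real-valued \<open>f\<close>.\<close>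

definition wirtinger :: "3 \<Rightarrow> (complex^3 \<Rightarrow> real) \<Rightarrow> complex^3 \<Rightarrow> complex" where
  "wirtinger j f q =
     (complex_of_real (frechet_derivative f (at q) (axis j 1))
        - \<i> * complex_of_real (frechet_derivative f (at q) (axis j \<i>))) / 2"

definition vf_apply :: "(complex^3 \<Rightarrow> complex^3) \<Rightarrow> (complex^3 \<Rightarrow> real) \<Rightarrow> complex^3 \<Rightarrow> complex" where
  "vf_apply X f q = (\<Sum>j\<in>UNIV. X q $ j * wirtinger j f q)"

text \<open>As \<open>f\<close> is real-valued, \<open>(Re X) f = Re (X f)\<close>.\<close>

lift_definition real_tangent :: "zpoly \<Rightarrow> vf_germ \<Rightarrow> bool" is
  "\<lambda>P X. \<forall>\<^sub>F q in nhds 0. q \<in> model_hypersurface P \<longrightarrow> Re (vf_apply X (model_function P) q) = 0"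
  by (rule eventually_cong) (auto simp: germ_rel_def vf_apply_def elim: eventually_mono)

lift_definition complex_tangent :: "zpoly \<Rightarrow> vf_germ \<Rightarrow> bool" is
  "\<lambda>P X. \<forall>\<^sub>F q in nhds 0. q \<in> model_hypersurface P \<longrightarrow> vf_apply X (model_function P) q = 0"
  by (rule eventually_cong) (auto simp: germ_rel_def vf_apply_def elim: eventually_mono)

definition holomorphically_nondegenerate :: "zpoly \<Rightarrow> bool" where
  "holomorphically_nondegenerate P \<longleftrightarrow> \<not> (\<exists>X. X \<noteq> 0 \<and> complex_tangent P X)"

definition aut :: "zpoly \<Rightarrow> vf_germ set" where
  "aut P = {X. real_tangent P X}"

text \<open>
  Holomorphic polynomials on \<open>\<complex>\<^sup>3\<close>; the exponent \<open>m\<close> stands for \<open>z\<^sub>1\<^bsup>m 1\<^esup> z\<^sub>2\<^bsup>m 2\<^esup> w\<^bsup>m 3\<^esup>\<close>.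
\<close>

type_synonym hpoly = "(3 \<Rightarrow> nat) \<Rightarrow>\<^sub>0 complex"

definition hpoly_eval :: "hpoly \<Rightarrow> complex^3 \<Rightarrow> complex" where
  "hpoly_eval F q = (\<Sum>m\<in>Poly_Mapping.keys F. Poly_Mapping.lookup F m * (\<Prod>j\<in>UNIV. (q $ j) ^ m j))"

definition coordinate_weight :: "real \<times> real \<Rightarrow> 3 \<Rightarrow> real" where
  "coordinate_weight \<mu> j = (if j = 1 then fst \<mu> else if j = 2 then snd \<mu> else 1)"

text \<open>
  A vector field of weight \<open>\<nu>\<close> is a combination of fields \<open>z\<^sub>1\<^bsup>m 1\<^esup> z\<^sub>2\<^bsup>m 2\<^esup> w\<^bsup>m 3\<^esup> \<partial>/\<partial>z\<^sub>j\<close> of weight \<open>\<nu>\<close>.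
  If \<open>\<mu>\<^sub>1, \<mu>\<^sub>2 > 0\<close>, there are only finitely many of these, so its components are polynomials.
\<close>

lift_definition has_weight :: "real \<times> real \<Rightarrow> real \<Rightarrow> vf_germ \<Rightarrow> bool" is
  "\<lambda>\<mu> \<nu> X. \<exists>F :: 3 \<Rightarrow> hpoly.
     (\<forall>j. \<forall>m\<in>Poly_Mapping.keys (F j).
        (\<Sum>k\<in>UNIV. coordinate_weight \<mu> k * real (m k)) - coordinate_weight \<mu> j = \<nu>) \<and>
     (\<forall>\<^sub>F q in nhds 0. \<forall>j. X q $ j = hpoly_eval (F j) q)"
proof -
  fix \<mu> :: "real \<times> real" and \<nu> :: real and X Y assume "germ_rel X Y"
  then have "\<forall>\<^sub>F q in nhds 0. X q = Y q"
    by (simp add: germ_rel_def)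
  then have "(\<forall>\<^sub>F q in nhds 0. \<forall>j. X q $ j = hpoly_eval (F j) q) \<longleftrightarrow>
      (\<forall>\<^sub>F q in nhds 0. \<forall>j. Y q $ j = hpoly_eval (F j) q)" for F
    by (rule eventually_cong) simp
  then show "?thesis \<mu> \<nu> X Y"
    by simp
qed

definition graded_component :: "zpoly \<Rightarrow> real \<times> real \<Rightarrow> real \<Rightarrow> vf_germ set" where
  "graded_component P \<mu> \<nu> = {X \<in> aut P. has_weight \<mu> \<nu> X}"

end

theory Submission
  imports Defs "HOL-Complex_Analysis.Cauchy_Integral_Formula"
begin

text \<open>Polynomials in z and cnj z are treated as formal objects, and a vector field in z with
  holomorphic polynomial coefficients becomes a derivation of the polynomial ring that kills the
  conjugate variables.

  From a field to balanced coordinates: a field of weight 1 has the form w Y + Z + (c w^2 + C1(z) w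
  + C0(z)) d/dw, where Y and Z act in z with weights 0 and 1. Along w = u + i P the tangency
  condition is a quadratic polynomial in u, so its three coefficients vanish
  (\<open>eventually_tangent_quadratic\<close>). As P, Y P and Z P have no pluriharmonic terms, this
  forces C1 = C0 = 0, c = g real, Y P + cnj (Y P) = 2 g P and Z P + cnj (Z P) = -2 i P (Y P - g P)
  (\<open>tangency_of_graded_component\<close>). The locale \<open>tangency\<close> records these
  equations. The weights leave few terms in Y, and weighted homogeneous coordinate changes make it
  triangular, then diagonal or resonant (\<open>balanceable_P\<close>,
  \<open>balanceable_triangular\<close>). In the resonant case Y is a multiple of the Euler field
  plus a nonzero nilpotent N. Then N kills the sum of |P_l|^2 over the weight components P_l of P,
  and applying a suitable power of N to this sum gives a vanishing sum of squares, against
  nondegeneracy (\<open>no_nilpotent_part\<close>). In the diagonal case monomials are eigenvectors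
  of Y. At a vertex of the Newton polytope P^2 has a nonzero coefficient which, unless the
  eigenvalue is g, must occur in Z P or its conjugate; this makes the eigenvalues real and g nonzero
  (\<open>vertex_partner\<close>, \<open>Im_\<sigma>\<close>, \<open>g_nonzero\<close>). Dividing by
  g gives a grading s whose values on the two exponents of a monomial of P add up to 2. If the
  largest value exceeded 1, with top piece Q, iterating Z would turn cnj Q into a nonzero multiple
  of a power of Q, which the conjugate of Z annihilates; this is contradictory
  (\<open>s_le_1\<close>). So s is 1 on both exponents, which is balancedness.

  From balanced coordinates to a field: a balanced model carries the field \<lambda>1 z1 w d/dz1 +
  \<lambda>2 z2 w d/dz2 + w^2 d/dw (\<open>balanced_field_tangent\<close>). Its pull-back W by the
  coordinates is tangent to the original model but need not be homogeneous. Dilations show that each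
  weighted homogeneous part of its Taylor expansion is tangent (\<open>tangent_part\<close>). The
  part of weight 1 is nonzero because its d/dw component contains w^2 with a nonzero coefficient
  (\<open>W_third_limit\<close>, \<open>weight_1_component_nonzero\<close>). Finite dimensionality
  turns a nonzero element into positive dimension (\<open>dim_pos_graded_component\<close>).\<close>

subsection \<open>Formal polynomials\<close>

lemma poly_mapping_additive_induct [case_names single add]:
  fixes F :: "'a \<Rightarrow>\<^sub>0 'b::comm_monoid_add"
  assumes "\<And>m c. Q (Poly_Mapping.single m c)" "\<And>F G. Q F \<Longrightarrow> Q G \<Longrightarrow> Q (F + G)"
  shows "Q F"
proof (induction F rule: Poly_Mapping.update_induct)
  case const
  show ?case using assms(1)[of undefined 0] by simp
next
  case (update f a b)
  have "Poly_Mapping.update a b f = f + Poly_Mapping.single a b"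
    using update(1) by (intro poly_mapping_eqI) (auto simp: lookup_update lookup_add lookup_single when_def not_in_keys_iff_lookup_eq_zero)
  then show ?case using assms update by simp
qed

text \<open>The map on terms takes the coefficient as an argument and need only be additive in it.
  This covers conjugation, which is not complex linear.\<close>

definition lin_ext :: "('a \<Rightarrow> 'b::zero \<Rightarrow> 'c::comm_monoid_add) \<Rightarrow> ('a \<Rightarrow>\<^sub>0 'b) \<Rightarrow> 'c" where
  "lin_ext \<phi> F = (\<Sum>m\<in>Poly_Mapping.keys F. \<phi> m (Poly_Mapping.lookup F m))"

lemma lin_ext_superset:
  assumes "finite S" "Poly_Mapping.keys F \<subseteq> S" "\<And>m. \<phi> m 0 = 0"
  shows "lin_ext \<phi> F = (\<Sum>m\<in>S. \<phi> m (Poly_Mapping.lookup F m))"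
  unfolding lin_ext_def using assms
  by (intro sum.mono_neutral_left) (auto simp: in_keys_iff)

lemma lin_ext_single: "(\<And>m. \<phi> m 0 = 0) \<Longrightarrow> lin_ext \<phi> (Poly_Mapping.single m c) = \<phi> m c"
  by (subst lin_ext_superset[of "{m}"]) (auto simp: lookup_single)

lemma additive_lin_ext:
  fixes \<phi> :: "'a \<Rightarrow> 'b::ab_group_add \<Rightarrow> 'c::ab_group_add"
  assumes "\<And>m c d. \<phi> m (c + d) = \<phi> m c + \<phi> m d"
  shows "Modules.additive (lin_ext \<phi> :: ('a \<Rightarrow>\<^sub>0 'b) \<Rightarrow> 'c)"
proof
  fix F G :: "'a \<Rightarrow>\<^sub>0 'b"
  have zero: "\<phi> m 0 = 0" for m using assms[of m 0 0] by simp
  let ?S = "Poly_Mapping.keys F \<union> Poly_Mapping.keys G"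
  have "Poly_Mapping.keys (F + G) \<subseteq> ?S" by (rule Poly_Mapping.keys_add)
  then show "lin_ext \<phi> (F + G) = lin_ext \<phi> F + lin_ext \<phi> G"
    by (simp add: lin_ext_superset[of ?S] zero lookup_add assms sum.distrib)
qed

lemma additive_single_eqI:
  fixes f g :: "('a \<Rightarrow>\<^sub>0 'b::ab_group_add) \<Rightarrow> 'c::ab_group_add"
  assumes "Modules.additive f" "Modules.additive g"
    and "\<And>m c. f (Poly_Mapping.single m c) = g (Poly_Mapping.single m c)"
  shows "f F = g F"
  by (induction F rule: poly_mapping_additive_induct)
     (auto simp: assms additive.add[OF assms(1)] additive.add[OF assms(2)])

lemma lin_ext_mult:
  fixes \<phi> :: "'a::monoid_add \<Rightarrow> 'b::ring \<Rightarrow> 'c::ring"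
  assumes add: "\<And>m c d. \<phi> m (c + d) = \<phi> m c + \<phi> m d"
    and mult: "\<And>m n c d. \<phi> (m + n) (c * d) = \<phi> m c * \<phi> n d"
  shows "lin_ext \<phi> (F * G) = lin_ext \<phi> F * lin_ext \<phi> G"
proof (induction F arbitrary: G rule: poly_mapping_additive_induct)
  note lin_add = additive.add[OF additive_lin_ext, of \<phi>, OF add]
  case (single m c)
  have zero: "\<phi> m 0 = 0" for m using add[of m 0 0] by simp
  show ?case
    by (induction G rule: poly_mapping_additive_induct)
       (auto simp: mult_single lin_ext_single zero mult lin_add distrib_left)
next
  note lin_add = additive.add[OF additive_lin_ext, of \<phi>, OF add]
  case (add F1 F2)
  then show ?case by (auto simp: lin_add distrib_right)
qed

section \<open>Evaluation as a ring homomorphism; constants and variables as generators\<close>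

lemma zpoly_eval_lin_ext:
  "zpoly_eval F z1 z2 =
     lin_ext (\<lambda>m c. c * z1 ^ fst (fst m) * z2 ^ snd (fst m) * cnj z1 ^ fst (snd m) * cnj z2 ^ snd (snd m)) F"
  unfolding zpoly_eval_def lin_ext_def by (rule sum.cong) auto

lemma additive_zpoly_eval: "Modules.additive (\<lambda>F. zpoly_eval F z1 z2)"
  unfolding zpoly_eval_lin_ext by (rule additive_lin_ext) (simp add: algebra_simps)

lemmas zpoly_eval_add = additive.add[OF additive_zpoly_eval]
  and zpoly_eval_diff = additive.diff[OF additive_zpoly_eval]
  and zpoly_eval_minus = additive.minus[OF additive_zpoly_eval]
  and zpoly_eval_sum = additive.sum[OF additive_zpoly_eval]
  and zpoly_eval_zero = additive.zero[OF additive_zpoly_eval]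

lemma zpoly_eval_single:
  "zpoly_eval (Poly_Mapping.single ((a1, a2), (b1, b2)) c) z1 z2 = c * z1 ^ a1 * z2 ^ a2 * cnj z1 ^ b1 * cnj z2 ^ b2"
  unfolding zpoly_eval_lin_ext by (subst lin_ext_single) auto

lemma zpoly_eval_mult: "zpoly_eval (F * G) z1 z2 = zpoly_eval F z1 z2 * zpoly_eval G z1 z2"
  unfolding zpoly_eval_lin_ext by (rule lin_ext_mult) (auto simp: algebra_simps power_add)

text \<open>Scalars act by multiplication with constant polynomials, so that all computations stay
  inside one commutative ring.\<close>

definition const_zpoly :: "complex \<Rightarrow> zpoly" where
  "const_zpoly c = Poly_Mapping.single 0 c"

lemma zpoly_eval_const: "zpoly_eval (const_zpoly c) z1 z2 = c"
  using zpoly_eval_single[of 0 0 0 0 c] by (simp add: const_zpoly_def zero_prod_def)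

lemma const_zpoly_0 [simp]: "const_zpoly 0 = 0" and const_zpoly_1 [simp]: "const_zpoly 1 = 1"
  by (simp_all add: const_zpoly_def)

lemma const_zpoly_of_nat [simp]: "const_zpoly (of_nat n) = of_nat n"
  and const_zpoly_numeral [simp]: "const_zpoly (numeral k) = numeral k"
  by (simp_all add: const_zpoly_def)

lemma const_zpoly_add: "const_zpoly (c + d) = const_zpoly c + const_zpoly d"
  and const_zpoly_diff: "const_zpoly (c - d) = const_zpoly c - const_zpoly d"
  and const_zpoly_minus: "const_zpoly (- c) = - const_zpoly c"
  and const_zpoly_mult: "const_zpoly (c * d) = const_zpoly c * const_zpoly d"
  by (simp_all add: const_zpoly_def single_add single_diff single_uminus mult_single)

lemma const_zpoly_mult_single: "const_zpoly c * Poly_Mapping.single m d = Poly_Mapping.single m (c * d)"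
  by (simp add: const_zpoly_def mult_single)

lemma lookup_const_mult [simp]: "Poly_Mapping.lookup (const_zpoly c * F) m = c * Poly_Mapping.lookup F m"
proof -
  have "const_zpoly c * F = Poly_Mapping.map ((*) c) F"
    using mult_map_scale_conv_mult[of c F] by (simp add: const_zpoly_def)
  then show ?thesis by (simp add: Poly_Mapping.map.rep_eq when_def)
qed

lemma zpoly_eval_1: "zpoly_eval 1 z1 z2 = 1"
  using zpoly_eval_const[of 1] by simp

lemma zpoly_eval_power: "zpoly_eval (F ^ n) z1 z2 = zpoly_eval F z1 z2 ^ n"
  by (induction n) (auto simp: zpoly_eval_mult zpoly_eval_1)

lemmas zpoly_eval_simps = zpoly_eval_add zpoly_eval_diff zpoly_eval_minus zpoly_eval_sum zpoly_eval_zero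
  zpoly_eval_mult zpoly_eval_const zpoly_eval_1 zpoly_eval_power

definition var_z1 :: zpoly where "var_z1 = Poly_Mapping.single ((1, 0), (0, 0)) 1"
definition var_z2 :: zpoly where "var_z2 = Poly_Mapping.single ((0, 1), (0, 0)) 1"
definition var_zb1 :: zpoly where "var_zb1 = Poly_Mapping.single ((0, 0), (1, 0)) 1"
definition var_zb2 :: zpoly where "var_zb2 = Poly_Mapping.single ((0, 0), (0, 1)) 1"

lemmas var_defs = var_z1_def var_z2_def var_zb1_def var_zb2_def

lemma var_powers:
  "var_z1 ^ n = Poly_Mapping.single ((n, 0), (0, 0)) 1"
  "var_z2 ^ n = Poly_Mapping.single ((0, n), (0, 0)) 1"
  "var_zb1 ^ n = Poly_Mapping.single ((0, 0), (n, 0)) 1"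
  "var_zb2 ^ n = Poly_Mapping.single ((0, 0), (0, n)) 1"
  by (induction n; simp add: var_defs mult_single flip: zero_prod_def)+

lemma single_eq_monomial:
  "Poly_Mapping.single ((a1, a2), (b1, b2)) c = const_zpoly c * var_z1 ^ a1 * var_z2 ^ a2 * var_zb1 ^ b1 * var_zb2 ^ b2"
  by (simp add: var_powers const_zpoly_mult_single mult_single)

lemma zpoly_eval_vars:
  "zpoly_eval var_z1 z1 z2 = z1" "zpoly_eval var_z2 z1 z2 = z2"
  "zpoly_eval var_zb1 z1 z2 = cnj z1" "zpoly_eval var_zb2 z1 z2 = cnj z2"
  by (simp_all add: var_defs zpoly_eval_single)

text \<open>Constants and the four variables generate the ring, so identities between homomorphisms
  or derivations need only be checked on them.\<close>

lemma zpoly_induct [case_names const z1 z2 zb1 zb2 add mult]: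
  assumes "\<And>c. Q (const_zpoly c)" "Q var_z1" "Q var_z2" "Q var_zb1" "Q var_zb2"
    and "\<And>F G. Q F \<Longrightarrow> Q G \<Longrightarrow> Q (F + G)" "\<And>F G. Q F \<Longrightarrow> Q G \<Longrightarrow> Q (F * G)"
  shows "Q F"
proof (induction F rule: poly_mapping_additive_induct)
  case (single m c)
  have pow: "Q (G ^ n)" if "Q G" for G n
    using that assms(1)[of 1] assms(7) by (induction n) auto
  obtain a1 a2 b1 b2 where m: "m = ((a1, a2), (b1, b2))" by (metis surj_pair)
  show ?case unfolding m single_eq_monomial by (intro assms pow)
qed (rule assms(6))

subsection \<open>Conjugation\<close>

definition conj_zpoly :: "zpoly \<Rightarrow> zpoly" where
  "conj_zpoly = lin_ext (\<lambda>m c. Poly_Mapping.single (snd m, fst m) (cnj c))"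

lemma additive_conj: "Modules.additive conj_zpoly"
  unfolding conj_zpoly_def by (rule additive_lin_ext) (simp add: single_add)

lemmas conj_add = additive.add[OF additive_conj]
  and conj_diff = additive.diff[OF additive_conj]
  and conj_minus = additive.minus[OF additive_conj]
  and conj_sum = additive.sum[OF additive_conj]
  and conj_zero = additive.zero[OF additive_conj]

lemma conj_single: "conj_zpoly (Poly_Mapping.single m c) = Poly_Mapping.single (snd m, fst m) (cnj c)"
  unfolding conj_zpoly_def by (subst lin_ext_single) auto

lemma conj_mult: "conj_zpoly (F * G) = conj_zpoly F * conj_zpoly G"
  unfolding conj_zpoly_def by (rule lin_ext_mult) (auto simp: single_add mult_single)

lemma conj_conj [simp]: "conj_zpoly (conj_zpoly F) = F"
  by (induction F rule: poly_mapping_additive_induct) (auto simp: conj_single conj_add)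

lemma lookup_conj: "Poly_Mapping.lookup (conj_zpoly F) m = cnj (Poly_Mapping.lookup F (snd m, fst m))"
  by (induction F rule: poly_mapping_additive_induct)
     (auto simp: conj_single conj_add lookup_add lookup_single when_def)

lemma keys_conj: "Poly_Mapping.keys (conj_zpoly F) = prod.swap ` Poly_Mapping.keys F"
  by (force simp: in_keys_iff lookup_conj)

lemma conj_const: "conj_zpoly (const_zpoly c) = const_zpoly (cnj c)"
  by (simp add: const_zpoly_def conj_single zero_prod_def)

lemma conj_1 [simp]: "conj_zpoly 1 = 1"
  using conj_const[of 1] by simp

lemma conj_power: "conj_zpoly (F ^ n) = conj_zpoly F ^ n"
  by (induction n) (auto simp: conj_mult)

lemma conj_vars:
  "conj_zpoly var_z1 = var_zb1" "conj_zpoly var_z2 = var_zb2"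
  "conj_zpoly var_zb1 = var_z1" "conj_zpoly var_zb2 = var_z2"
  by (simp_all add: var_defs conj_single)

lemmas conj_simps = conj_add conj_diff conj_minus conj_sum conj_zero conj_mult conj_const conj_power conj_vars

lemma zpoly_eval_conj: "zpoly_eval (conj_zpoly F) z1 z2 = cnj (zpoly_eval F z1 z2)"
  by (induction F rule: zpoly_induct) (auto simp: conj_simps zpoly_eval_simps zpoly_eval_vars)

subsection \<open>Derivations\<close>

text \<open>These are the complex linear derivations; linearity over the complex numbers comes from
  the Leibniz rule and the vanishing on constants.\<close>

definition derivation :: "(zpoly \<Rightarrow> zpoly) \<Rightarrow> bool" where
  "derivation \<delta> \<longleftrightarrow> Modules.additive \<delta> \<and> (\<forall>F G. \<delta> (F * G) = \<delta> F * G + F * \<delta> G) \<and> (\<forall>c. \<delta> (const_zpoly c) = 0)"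

lemma derivation_additive: "derivation \<delta> \<Longrightarrow> Modules.additive \<delta>"
  and derivation_mult: "derivation \<delta> \<Longrightarrow> \<delta> (F * G) = \<delta> F * G + F * \<delta> G"
  and derivation_const: "derivation \<delta> \<Longrightarrow> \<delta> (const_zpoly c) = 0"
  by (auto simp: derivation_def)

lemmas derivation_add = additive.add[OF derivation_additive]
  and derivation_diff = additive.diff[OF derivation_additive]
  and derivation_minus = additive.minus[OF derivation_additive]
  and derivation_sum = additive.sum[OF derivation_additive]
  and derivation_zero = additive.zero[OF derivation_additive]

lemma derivation_const_mult: "derivation \<delta> \<Longrightarrow> \<delta> (const_zpoly c * F) = const_zpoly c * \<delta> F"
  by (simp add: derivation_mult derivation_const)

lemma derivation_power:
  "derivation \<delta> \<Longrightarrow> \<delta> (F ^ Suc n) = const_zpoly (of_nat (Suc n)) * F ^ n * \<delta> F"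
  by (induction n) (auto simp: derivation_mult const_zpoly_add algebra_simps)

lemma derivation_power':
  "derivation \<delta> \<Longrightarrow> \<delta> (F ^ n) = const_zpoly (of_nat n) * F ^ (n - 1) * \<delta> F"
  by (cases n) (auto simp: derivation_power derivation_const[of \<delta> 1, simplified] simp del: power_Suc)

lemma derivation_of_nat: "derivation \<delta> \<Longrightarrow> \<delta> (of_nat n) = 0"
  using derivation_const[of \<delta> "of_nat n"] by simp

lemmas derivation_simps = derivation_add derivation_diff derivation_minus derivation_sum derivation_zero
  derivation_const derivation_of_nat derivation_const_mult derivation_mult

lemma derivation_eqI:
  assumes "derivation \<delta>" "derivation \<epsilon>"
    and "\<delta> var_z1 = \<epsilon> var_z1" "\<delta> var_z2 = \<epsilon> var_z2" "\<delta> var_zb1 = \<epsilon> var_zb1" "\<delta> var_zb2 = \<epsilon> var_zb2"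
  shows "\<delta> F = \<epsilon> F"
  by (induction F rule: zpoly_induct) (auto simp: assms derivation_simps)

lemma derivationI:
  assumes "\<And>F G. \<delta> (F + G) = \<delta> F + \<delta> G" "\<And>F G. \<delta> (F * G) = \<delta> F * G + F * \<delta> G" "\<And>c. \<delta> (const_zpoly c) = 0"
  shows "derivation \<delta>"
  using assms by (auto simp: derivation_def intro: additive.intro)

lemma derivation_plus: "derivation \<delta> \<Longrightarrow> derivation \<epsilon> \<Longrightarrow> derivation (\<lambda>F. \<delta> F + \<epsilon> F)"
  by (rule derivationI) (auto simp: derivation_simps algebra_simps)

lemma derivation_left_mult: "derivation \<delta> \<Longrightarrow> derivation (\<lambda>F. G * \<delta> F)"
  by (rule derivationI) (auto simp: derivation_simps algebra_simps)

lemma derivation_conj: "derivation \<delta> \<Longrightarrow> derivation (\<lambda>F. conj_zpoly (\<delta> (conj_zpoly F)))"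
  by (rule derivationI) (auto simp: derivation_simps conj_simps algebra_simps)

lemma derivation_commutator:
  "derivation \<delta> \<Longrightarrow> derivation \<epsilon> \<Longrightarrow> derivation (\<lambda>F. \<delta> (\<epsilon> F) - \<epsilon> (\<delta> F))"
  by (rule derivationI) (auto simp: derivation_simps algebra_simps)

lemma derivation_leibniz:
  assumes "derivation \<delta>"
  shows "(\<delta> ^^ n) (F * G) = (\<Sum>i\<le>n. const_zpoly (of_nat (n choose i)) * ((\<delta> ^^ i) F * (\<delta> ^^ (n - i)) G))"
proof (induction n)
  case (Suc n)
  let ?t = "\<lambda>n i. const_zpoly (of_nat (n choose i)) * ((\<delta> ^^ i) F * (\<delta> ^^ (Suc n - i)) G)"
  have "(\<delta> ^^ Suc n) (F * G) = (\<Sum>i\<le>n. const_zpoly (of_nat (n choose i)) * ((\<delta> ^^ Suc i) F * (\<delta> ^^ (n - i)) G))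
        + (\<Sum>i\<le>n. const_zpoly (of_nat (n choose i)) * ((\<delta> ^^ i) F * (\<delta> ^^ (Suc n - i)) G))"
    using assms by (simp add: Suc derivation_simps Suc_diff_le sum.distrib[symmetric] algebra_simps)
  also have "(\<Sum>i\<le>n. const_zpoly (of_nat (n choose i)) * ((\<delta> ^^ i) F * (\<delta> ^^ (Suc n - i)) G))
       = (\<delta> ^^ 0) F * (\<delta> ^^ Suc n) G + (\<Sum>i\<le>n. const_zpoly (of_nat (n choose Suc i)) * ((\<delta> ^^ Suc i) F * (\<delta> ^^ (n - i)) G))"
  proof -
    have "(\<Sum>i\<le>n. const_zpoly (of_nat (n choose i)) * ((\<delta> ^^ i) F * (\<delta> ^^ (Suc n - i)) G))
       = (\<Sum>i\<le>Suc n. const_zpoly (of_nat (n choose i)) * ((\<delta> ^^ i) F * (\<delta> ^^ (Suc n - i)) G))"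
      by (simp add: binomial_eq_0)
    also have "\<dots> = (\<delta> ^^ 0) F * (\<delta> ^^ Suc n) G + (\<Sum>i\<le>n. const_zpoly (of_nat (n choose Suc i)) * ((\<delta> ^^ Suc i) F * (\<delta> ^^ (n - i)) G))"
      by (subst sum.atMost_Suc_shift) simp
    finally show ?thesis .
  qed
  finally show ?case
    by (subst sum.atMost_Suc_shift) (simp add: const_zpoly_add algebra_simps sum.distrib binomial_eq_0)
qed simp

section \<open>Partial derivatives and the differential of evaluation\<close>

text \<open>For exponent 0 the truncated subtraction is harmless, since the factor
  \<open>of_nat\<close> annihilates the term. The same holds for \<open>pd2\<close>.\<close>

definition pd1 :: "zpoly \<Rightarrow> zpoly" where
  "pd1 = lin_ext (\<lambda>m c. Poly_Mapping.single ((fst (fst m) - 1, snd (fst m)), snd m) (of_nat (fst (fst m)) * c))"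
definition pd2 :: "zpoly \<Rightarrow> zpoly" where
  "pd2 = lin_ext (\<lambda>m c. Poly_Mapping.single ((fst (fst m), snd (fst m) - 1), snd m) (of_nat (snd (fst m)) * c))"

lemma pd_single:
  "pd1 (Poly_Mapping.single ((a1, a2), b) c) = Poly_Mapping.single ((a1 - 1, a2), b) (of_nat a1 * c)"
  "pd2 (Poly_Mapping.single ((a1, a2), b) c) = Poly_Mapping.single ((a1, a2 - 1), b) (of_nat a2 * c)"
  unfolding pd1_def pd2_def by (subst lin_ext_single; simp)+

lemma derivation_from_singles:
  assumes "Modules.additive \<delta>" "\<And>c. \<delta> (const_zpoly c) = 0"
    and "\<And>m n c d. \<delta> (Poly_Mapping.single m c * Poly_Mapping.single n d) =
      \<delta> (Poly_Mapping.single m c) * Poly_Mapping.single n d + Poly_Mapping.single m c * \<delta> (Poly_Mapping.single n d)"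
  shows "derivation \<delta>"
proof (rule derivationI)
  show "\<delta> (F * G) = \<delta> F * G + F * \<delta> G" for F G
  proof (induction F arbitrary: G rule: poly_mapping_additive_induct)
    case (single m c)
    show ?case
      by (induction G rule: poly_mapping_additive_induct)
         (auto simp: assms(3) additive.add[OF assms(1)] algebra_simps)
  qed (auto simp: additive.add[OF assms(1)] algebra_simps)
qed (auto simp: assms(2) additive.add[OF assms(1)])

lemma derivation_pd1: "derivation pd1"
proof (rule derivation_from_singles)
  show "Modules.additive pd1"
    unfolding pd1_def by (rule additive_lin_ext) (simp add: single_add algebra_simps)
  show "pd1 (const_zpoly c) = 0" for c
    by (simp add: const_zpoly_def pd_single zero_prod_def)
  fix m n :: "(nat \<times> nat) \<times> nat \<times> nat" and c d :: complex
  obtain a1 a2 b a1' a2' b' where "m = ((a1, a2), b)" "n = ((a1', a2'), b')" by (metis surj_pair)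
  then show "pd1 (Poly_Mapping.single m c * Poly_Mapping.single n d) =
      pd1 (Poly_Mapping.single m c) * Poly_Mapping.single n d + Poly_Mapping.single m c * pd1 (Poly_Mapping.single n d)"
    by (cases a1; cases a1') (auto simp: mult_single pd_single algebra_simps simp flip: single_add)
qed

lemma derivation_pd2: "derivation pd2"
proof (rule derivation_from_singles)
  show "Modules.additive pd2"
    unfolding pd2_def by (rule additive_lin_ext) (simp add: single_add algebra_simps)
  show "pd2 (const_zpoly c) = 0" for c
    by (simp add: const_zpoly_def pd_single zero_prod_def)
  fix m n :: "(nat \<times> nat) \<times> nat \<times> nat" and c d :: complex
  obtain a1 a2 b a1' a2' b' where "m = ((a1, a2), b)" "n = ((a1', a2'), b')" by (metis surj_pair)
  then show "pd2 (Poly_Mapping.single m c * Poly_Mapping.single n d) =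
      pd2 (Poly_Mapping.single m c) * Poly_Mapping.single n d + Poly_Mapping.single m c * pd2 (Poly_Mapping.single n d)"
    by (cases a2; cases a2') (auto simp: mult_single pd_single algebra_simps simp flip: single_add)
qed

lemma pd_vars:
  "pd1 var_z1 = 1" "pd1 var_z2 = 0" "pd1 var_zb1 = 0" "pd1 var_zb2 = 0"
  "pd2 var_z1 = 0" "pd2 var_z2 = 1" "pd2 var_zb1 = 0" "pd2 var_zb2 = 0"
  by (simp_all add: var_defs pd_single zero_prod_def flip: single_one)

lemma lookup_pd1: "Poly_Mapping.lookup (pd1 F) ((a1, a2), b) = of_nat (Suc a1) * Poly_Mapping.lookup F ((Suc a1, a2), b)"
proof (induction F rule: poly_mapping_additive_induct)
  case (single m c)
  obtain a1' a2' b' where "m = ((a1', a2'), b')" by (metis surj_pair)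
  then show ?case by (cases a1') (auto simp: pd_single lookup_single when_def)
qed (simp add: lookup_add derivation_add[OF derivation_pd1] algebra_simps)

lemma lookup_pd2: "Poly_Mapping.lookup (pd2 F) ((a1, a2), b) = of_nat (Suc a2) * Poly_Mapping.lookup F ((a1, Suc a2), b)"
proof (induction F rule: poly_mapping_additive_induct)
  case (single m c)
  obtain a1' a2' b' where "m = ((a1', a2'), b')" by (metis surj_pair)
  then show ?case by (cases a2') (auto simp: pd_single lookup_single when_def)
qed (simp add: lookup_add derivation_add[OF derivation_pd2] algebra_simps)

text \<open>The derivatives with respect to cnj z1 and cnj z2 are \<open>pd1\<close> and
  \<open>pd2\<close> conjugated by \<open>conj_zpoly\<close>. The formula is stable under sums and
  products, so generators suffice.\<close>

lemma has_derivative_zpoly_eval: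
  "((\<lambda>z. zpoly_eval F (fst z) (snd z)) has_derivative
     (\<lambda>v. zpoly_eval (pd1 F) z1 z2 * fst v + zpoly_eval (pd2 F) z1 z2 * snd v
        + zpoly_eval (conj_zpoly (pd1 (conj_zpoly F))) z1 z2 * cnj (fst v)
        + zpoly_eval (conj_zpoly (pd2 (conj_zpoly F))) z1 z2 * cnj (snd v))) (at (z1, z2))"
proof (induction F rule: zpoly_induct)
  case (const c)
  then show ?case
    by (simp add: conj_simps derivation_simps derivation_pd1 derivation_pd2 zpoly_eval_simps)
next
  case z1
  then show ?case
    by (simp add: conj_simps pd_vars zpoly_eval_simps zpoly_eval_vars) (rule derivative_eq_intros refl)+
next
  case z2
  then show ?case
    by (simp add: conj_simps pd_vars zpoly_eval_simps zpoly_eval_vars) (rule derivative_eq_intros refl)+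
next
  case zb1
  then show ?case
    by (simp add: conj_simps pd_vars zpoly_eval_simps zpoly_eval_vars) (rule derivative_eq_intros refl)+
next
  case zb2
  then show ?case
    by (simp add: conj_simps pd_vars zpoly_eval_simps zpoly_eval_vars) (rule derivative_eq_intros refl)+
next
  case (add F G)
  show ?case
    unfolding zpoly_eval_simps conj_simps derivation_simps[OF derivation_pd1] derivation_simps[OF derivation_pd2]
    by (rule derivative_eq_intros add refl)+ (simp add: algebra_simps)
next
  case (mult F G)
  show ?case
    unfolding zpoly_eval_simps conj_simps derivation_simps[OF derivation_pd1] derivation_simps[OF derivation_pd2]
    by (rule derivative_eq_intros mult refl)+ (simp add: algebra_simps zpoly_eval_simps)
qed


section \<open>Identity theorem and sums of squares\<close>

lemma zpoly_eval_pd_eq_0: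
  assumes "open U" "(z1, z2) \<in> U" "\<And>z. z \<in> U \<Longrightarrow> zpoly_eval F (fst z) (snd z) = 0"
  shows "zpoly_eval (pd1 F) z1 z2 = 0" "zpoly_eval (pd2 F) z1 z2 = 0"
    "zpoly_eval (pd1 (conj_zpoly F)) z1 z2 = 0" "zpoly_eval (pd2 (conj_zpoly F)) z1 z2 = 0"
proof -
  define x y x' y' where xy: "x = zpoly_eval (pd1 F) z1 z2" "y = zpoly_eval (pd2 F) z1 z2"
    "x' = zpoly_eval (conj_zpoly (pd1 (conj_zpoly F))) z1 z2" "y' = zpoly_eval (conj_zpoly (pd2 (conj_zpoly F))) z1 z2"
  have "((\<lambda>z. zpoly_eval F (fst z) (snd z)) has_derivative (\<lambda>_. 0)) (at (z1, z2))"
    by (rule has_derivative_transform_within_open[of "\<lambda>_. 0" _ _ _ U]) (use assms in auto)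
  from has_derivative_unique[OF this has_derivative_zpoly_eval]
  have *: "x * fst v + y * snd v + x' * cnj (fst v) + y' * cnj (snd v) = 0" for v
    unfolding xy by metis
  \<comment> \<open>The directions 1 and \<i> in each variable separate the complex linear part of
    the differential from the antilinear part.\<close>
  have "x + x' = 0" "\<i> * (x - x') = 0" "y + y' = 0" "\<i> * (y - y') = 0"
    using *[of "(1,0)"] *[of "(\<i>,0)"] *[of "(0,1)"] *[of "(0,\<i>)"] by (simp_all add: algebra_simps)
  then have "x = 0" "x' = 0" "y = 0" "y' = 0" by (auto simp: add_eq_0_iff)
  then show "zpoly_eval (pd1 F) z1 z2 = 0" "zpoly_eval (pd2 F) z1 z2 = 0"
    "zpoly_eval (pd1 (conj_zpoly F)) z1 z2 = 0" "zpoly_eval (pd2 (conj_zpoly F)) z1 z2 = 0"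
    unfolding xy by (auto simp: zpoly_eval_conj)
qed

definition total_degree :: "(nat \<times> nat) \<times> nat \<times> nat \<Rightarrow> nat" where
  "total_degree m = fst (fst m) + snd (fst m) + fst (snd m) + snd (snd m)"

lemma total_degree_pd:
  assumes "\<And>m. m \<in> Poly_Mapping.keys F \<Longrightarrow> total_degree m \<le> Suc n"
  shows "m \<in> Poly_Mapping.keys (pd1 F) \<Longrightarrow> total_degree m \<le> n"
    "m \<in> Poly_Mapping.keys (pd2 F) \<Longrightarrow> total_degree m \<le> n"
proof -
  obtain a1 a2 b where m: "m = ((a1, a2), b)" by (metis surj_pair)
  show "m \<in> Poly_Mapping.keys (pd1 F) \<Longrightarrow> total_degree m \<le> n"
    using assms[of "((Suc a1, a2), b)"] by (simp add: m in_keys_iff lookup_pd1 total_degree_def)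
  show "m \<in> Poly_Mapping.keys (pd2 F) \<Longrightarrow> total_degree m \<le> n"
    using assms[of "((a1, Suc a2), b)"] by (simp add: m in_keys_iff lookup_pd2 total_degree_def)
qed

lemma zpoly_eqI_pd:
  assumes "pd1 F = 0" "pd2 F = 0" "pd1 (conj_zpoly F) = 0" "pd2 (conj_zpoly F) = 0"
  shows "F = const_zpoly (Poly_Mapping.lookup F 0)"
proof (rule poly_mapping_eqI)
  fix m :: "(nat \<times> nat) \<times> nat \<times> nat"
  obtain a1 a2 b1 b2 where m: "m = ((a1, a2), (b1, b2))" by (metis surj_pair)
  have "Poly_Mapping.lookup F ((Suc a1, a2), b) = 0" "Poly_Mapping.lookup F ((a1, Suc a2), b) = 0"
    "Poly_Mapping.lookup F (b, (Suc a1, a2)) = 0" "Poly_Mapping.lookup F (b, (a1, Suc a2)) = 0" for a1 a2 b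
    using lookup_pd1[of F a1 a2 b] lookup_pd2[of F a1 a2 b] lookup_pd1[of "conj_zpoly F" a1 a2 b]
      lookup_pd2[of "conj_zpoly F" a1 a2 b] assms by (simp_all add: lookup_conj del: of_nat_Suc)
  then show "Poly_Mapping.lookup F m = Poly_Mapping.lookup (const_zpoly (Poly_Mapping.lookup F 0)) m"
    unfolding m by (cases a1; cases a2; cases b1; cases b2)
      (auto simp: const_zpoly_def lookup_single when_def zero_prod_def)
qed

text \<open>Induction on the total degree: all four partial derivatives vanish on the same open set,
  hence are the zero polynomial, and a constant with a zero is 0. This allows passage between formal
  identities and identities of functions near a point.\<close>

lemma zpoly_eq_0_if_eval_eq_0_on_open:
  assumes "open U" "p \<in> U" "\<And>z. z \<in> U \<Longrightarrow> zpoly_eval F (fst z) (snd z) = 0"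
  shows "F = 0"
proof -
  have "F = 0" if "\<And>m. m \<in> Poly_Mapping.keys F \<Longrightarrow> total_degree m \<le> n"
    "\<And>z. z \<in> U \<Longrightarrow> zpoly_eval F (fst z) (snd z) = 0" for n F
    using that
  proof (induction n arbitrary: F)
    case 0
    have "F = const_zpoly (Poly_Mapping.lookup F 0)"
    proof (rule poly_mapping_eqI)
      fix m :: "(nat \<times> nat) \<times> nat \<times> nat"
      have "m = 0" if "Poly_Mapping.lookup F m \<noteq> 0"
        using 0(1)[of m] that by (auto simp: in_keys_iff total_degree_def zero_prod_def prod_eq_iff)
      then show "Poly_Mapping.lookup F m = Poly_Mapping.lookup (const_zpoly (Poly_Mapping.lookup F 0)) m"
        by (auto simp: const_zpoly_def lookup_single when_def)
    qed
    moreover have "zpoly_eval (const_zpoly (Poly_Mapping.lookup F 0)) (fst p) (snd p) = 0"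
      using 0(2)[OF assms(2)] calculation by metis
    ultimately show ?case by (metis zpoly_eval_const const_zpoly_0)
  next
    case (Suc n)
    have conj: "total_degree m \<le> Suc n" if "m \<in> Poly_Mapping.keys (conj_zpoly F)" for m
      using that Suc.prems(1)[of "(snd m, fst m)"] by (simp add: in_keys_iff lookup_conj total_degree_def)
    note pd = zpoly_eval_pd_eq_0[OF assms(1) _ Suc.prems(2)]
    have "pd1 F = 0" "pd2 F = 0" "pd1 (conj_zpoly F) = 0" "pd2 (conj_zpoly F) = 0"
      by (rule Suc.IH; use total_degree_pd[OF Suc.prems(1)] total_degree_pd[OF conj] pd in force)+
    then have "F = const_zpoly (Poly_Mapping.lookup F 0)" by (rule zpoly_eqI_pd)
    moreover have "zpoly_eval (const_zpoly (Poly_Mapping.lookup F 0)) (fst p) (snd p) = 0"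
      using Suc.prems(2)[OF assms(2)] calculation by metis
    ultimately show ?case by (metis zpoly_eval_const const_zpoly_0)
  qed
  from this[of F "Max (total_degree ` Poly_Mapping.keys F)"] assms(3) show ?thesis
    by simp
qed

lemma zpoly_eqI:
  assumes "\<And>z1 z2. zpoly_eval F z1 z2 = zpoly_eval G z1 z2"
  shows "F = G"
  using zpoly_eq_0_if_eval_eq_0_on_open[of UNIV _ "F - G"] assms by (simp add: zpoly_eval_simps)

text \<open>Values of polynomials are complex numbers, and these have no nilpotents. Later arguments
  cancel factors by means of this fact.\<close>

lemma zpoly_reduced: "(F :: zpoly) ^ n = 0 \<Longrightarrow> F = 0"
proof (rule zpoly_eqI)
  fix z1 z2 assume "F ^ n = 0"
  then have "zpoly_eval F z1 z2 ^ n = 0"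
    by (simp add: zpoly_eval_zero flip: zpoly_eval_power)
  then show "zpoly_eval F z1 z2 = zpoly_eval 0 z1 z2" by (simp add: zpoly_eval_zero)
qed

text \<open>At every point the sum is a sum of squared absolute values.\<close>

lemma sum_mult_conj_eq_0:
  assumes "finite I" "(\<Sum>i\<in>I. F i * conj_zpoly (F i)) = 0" "i \<in> I"
  shows "F i = 0"
proof (rule zpoly_eqI)
  fix z1 z2
  have "(\<Sum>i\<in>I. complex_of_real ((cmod (zpoly_eval (F i) z1 z2))\<^sup>2)) = zpoly_eval (\<Sum>i\<in>I. F i * conj_zpoly (F i)) z1 z2"
    by (simp add: zpoly_eval_simps zpoly_eval_conj flip: complex_norm_square)
  also have "\<dots> = 0" using assms by (simp add: zpoly_eval_zero)
  finally have "(\<Sum>i\<in>I. (cmod (zpoly_eval (F i) z1 z2))\<^sup>2) = 0"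
    unfolding of_real_sum[symmetric] by (simp only: of_real_eq_0_iff)
  then show "zpoly_eval (F i) z1 z2 = zpoly_eval 0 z1 z2"
    using assms by (subst (asm) sum_nonneg_eq_0_iff) (auto simp: zpoly_eval_zero)
qed

lemma real_valued_iff: "real_valued F \<longleftrightarrow> conj_zpoly F = F"
proof
  assume "real_valued F"
  then show "conj_zpoly F = F"
    by (intro zpoly_eqI) (auto simp: real_valued_def zpoly_eval_conj Reals_cnj_iff)
next
  assume "conj_zpoly F = F"
  then show "real_valued F"
    unfolding real_valued_def by (metis zpoly_eval_conj Reals_cnj_iff)
qed

subsection \<open>Gradings\<close>

text \<open>The homogeneous part of degree \<open>x\<close> for the grading that gives the exponent
  \<open>m\<close> the degree \<open>\<phi> m\<close>. The grading is a parameter because several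
  are used: weights of the holomorphic or antiholomorphic exponent, and eigenvalues.\<close>

definition component :: "('a \<Rightarrow> 'b) \<Rightarrow> 'b \<Rightarrow> ('a \<Rightarrow>\<^sub>0 complex) \<Rightarrow> ('a \<Rightarrow>\<^sub>0 complex)" where
  "component \<phi> x = lin_ext (\<lambda>m c. if \<phi> m = x then Poly_Mapping.single m c else 0)"

lemma additive_component: "Modules.additive (component \<phi> x)"
  unfolding component_def by (rule additive_lin_ext) (simp add: single_add)

lemmas component_add = additive.add[OF additive_component]
  and component_diff = additive.diff[OF additive_component]
  and component_minus = additive.minus[OF additive_component]
  and component_sum = additive.sum[OF additive_component]
  and component_zero = additive.zero[OF additive_component]

lemma component_single: "component \<phi> x (Poly_Mapping.single m c) = (if \<phi> m = x then Poly_Mapping.single m c else 0)"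
  unfolding component_def by (subst lin_ext_single) auto

lemma lookup_component: "Poly_Mapping.lookup (component \<phi> x F) m = (if \<phi> m = x then Poly_Mapping.lookup F m else 0)"
  by (induction F rule: poly_mapping_additive_induct)
     (auto simp: component_single component_add lookup_add lookup_single when_def)

lemma keys_component: "Poly_Mapping.keys (component \<phi> x F) = {m \<in> Poly_Mapping.keys F. \<phi> m = x}"
  by (auto simp: in_keys_iff lookup_component split: if_splits)

lemma component_eq_self: "(\<And>m. m \<in> Poly_Mapping.keys F \<Longrightarrow> \<phi> m = x) \<Longrightarrow> component \<phi> x F = F"
  by (intro poly_mapping_eqI) (auto simp: lookup_component in_keys_iff)

lemma component_eq_0: "(\<And>m. m \<in> Poly_Mapping.keys F \<Longrightarrow> \<phi> m \<noteq> x) \<Longrightarrow> component \<phi> x F = 0"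
  by (intro poly_mapping_eqI) (auto simp: lookup_component in_keys_iff)

lemma sum_component:
  assumes "finite I" "\<phi> ` Poly_Mapping.keys F \<subseteq> I"
  shows "(\<Sum>x\<in>I. component \<phi> x F) = F"
  using assms by (intro poly_mapping_eqI)
    (auto simp: lookup_sum lookup_component simp flip: not_in_keys_iff_lookup_eq_zero)

lemma component_mult_const: "component \<phi> x (const_zpoly c * F) = const_zpoly c * component \<phi> x F"
  by (intro poly_mapping_eqI) (auto simp: lookup_component)

text \<open>An additive map that sends degree y into degree \<open>f y\<close> commutes with taking
  parts; injectivity of \<open>f\<close> keeps different degrees apart.\<close>

lemma component_comp_linear:
  assumes "Modules.additive \<delta>"
    and "\<And>m n c. n \<in> Poly_Mapping.keys (\<delta> (Poly_Mapping.single m c)) \<Longrightarrow> \<psi> n = f (\<phi> m)" "inj f"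
  shows "component \<psi> (f x) (\<delta> F) = \<delta> (component \<phi> x F)"
proof (induction F rule: poly_mapping_additive_induct)
  case (single m c)
  show ?case using assms(2)[of _ m c] inj_eq[OF assms(3)]
    by (auto simp: component_single additive.zero[OF assms(1)] intro!: component_eq_self component_eq_0)
qed (simp add: component_add additive.add[OF assms(1)])

lemma component_mult:
  fixes \<phi> :: "(nat \<times> nat) \<times> nat \<times> nat \<Rightarrow> real"
  assumes "\<And>m n. \<phi> (m + n) = \<phi> m + \<phi> n" "finite I" "\<phi> ` Poly_Mapping.keys F \<subseteq> I"
  shows "component \<phi> x (F * G) = (\<Sum>y\<in>I. component \<phi> y F * component \<phi> (x - y) G)"
proof -
  have "component \<phi> x (H * G) = H * component \<phi> (x - y) G" if "\<And>m. m \<in> Poly_Mapping.keys H \<Longrightarrow> \<phi> m = y" for H y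
    using that
  proof -
    have single: "component \<phi> x (Poly_Mapping.single m c * G) = Poly_Mapping.single m c * component \<phi> (x - \<phi> m) G" for m c
      by (induction G rule: poly_mapping_additive_induct)
         (auto simp: component_single component_add mult_single distrib_left assms(1))
    have H: "H = (\<Sum>m\<in>Poly_Mapping.keys H. Poly_Mapping.single m (Poly_Mapping.lookup H m))"
      by (rule poly_mapping_eqI) (auto simp: lookup_sum lookup_single when_def in_keys_iff)
    have "component \<phi> x (H * G) = (\<Sum>m\<in>Poly_Mapping.keys H. component \<phi> x (Poly_Mapping.single m (Poly_Mapping.lookup H m) * G))"
      by (subst H) (simp add: sum_distrib_right component_sum)
    also have "\<dots> = (\<Sum>m\<in>Poly_Mapping.keys H. Poly_Mapping.single m (Poly_Mapping.lookup H m) * component \<phi> (x - y) G)"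
      using that by (simp add: single)
    also have "\<dots> = H * component \<phi> (x - y) G"
      by (subst (3) H) (simp add: sum_distrib_right)
    finally show ?thesis .
  qed
  from this[of "component \<phi> _ F"]
  have *: "component \<phi> x (component \<phi> y F * G) = component \<phi> y F * component \<phi> (x - y) G" for y
    by (simp add: keys_component)
  have "component \<phi> x (F * G) = component \<phi> x ((\<Sum>y\<in>I. component \<phi> y F) * G)"
    using assms by (simp add: sum_component)
  also have "\<dots> = (\<Sum>y\<in>I. component \<phi> y F * component \<phi> (x - y) G)"
    by (simp add: sum_distrib_right component_sum *)
  finally show ?thesis .
qed

lemma keys_additive:
  assumes "Modules.additive \<delta>" "n \<in> Poly_Mapping.keys (\<delta> F)"
  obtains m where "m \<in> Poly_Mapping.keys F" "n \<in> Poly_Mapping.keys (\<delta> (Poly_Mapping.single m (Poly_Mapping.lookup F m)))"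
proof -
  have F: "F = (\<Sum>m\<in>Poly_Mapping.keys F. Poly_Mapping.single m (Poly_Mapping.lookup F m))"
    by (rule poly_mapping_eqI) (auto simp: lookup_sum lookup_single when_def in_keys_iff)
  have "\<delta> F = (\<Sum>m\<in>Poly_Mapping.keys F. \<delta> (Poly_Mapping.single m (Poly_Mapping.lookup F m)))"
    by (subst F) (simp add: additive.sum[OF assms(1)])
  with assms(2) that show ?thesis
    using keys_sum[of "\<lambda>m. \<delta> (Poly_Mapping.single m (Poly_Mapping.lookup F m))" "Poly_Mapping.keys F"] by auto
qed

section \<open>Operators that lower an exponent\<close>

lemma ex_argmax_on:
  assumes "finite K" "K \<noteq> {}"
  shows "\<exists>m\<in>K. \<forall>n\<in>K. (f n :: 'b::linorder) \<le> f m"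
proof -
  have "Max (f ` K) \<in> f ` K" using assms by (intro Max_in) auto
  then obtain m where m: "m \<in> K" "Max (f ` K) = f m" by blast
  have "f n \<le> f m" if "n \<in> K" for n
    using that assms unfolding m(2)[symmetric] by (intro Max_ge) auto
  with m(1) show ?thesis by blast
qed

text \<open>A monomial of \<open>F\<close> with maximal \<open>h\<close> cannot occur in
  \<open>\<delta> F\<close>, so its coefficient in the eigenvalue equation is \<open>x\<close> times
  a nonzero number and also 0.\<close>

lemma lowering_eigenvalue:
  fixes h :: "(nat \<times> nat) \<times> nat \<times> nat \<Rightarrow> nat" and \<delta> :: "zpoly \<Rightarrow> zpoly"
  assumes "Modules.additive \<delta>"
    and low: "\<And>m n c. n \<in> Poly_Mapping.keys (\<delta> (Poly_Mapping.single m c)) \<Longrightarrow> h n < h m"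
    and "\<delta> F = const_zpoly x * F" "F \<noteq> 0"
  shows "x = 0"
proof -
  have "finite (Poly_Mapping.keys F)" "Poly_Mapping.keys F \<noteq> {}" using assms by auto
  from ex_argmax_on[OF this, of h]
  obtain m where m: "m \<in> Poly_Mapping.keys F" "\<And>n. n \<in> Poly_Mapping.keys F \<Longrightarrow> h n \<le> h m"
    by blast
  have "m \<notin> Poly_Mapping.keys (\<delta> F)"
    using m(2) low by (meson keys_additive[OF assms(1)] leD)
  then have "x * Poly_Mapping.lookup F m = 0" by (simp add: in_keys_iff assms(3))
  with m(1) show "x = 0" by (simp add: in_keys_iff)
qed

lemma lowering_nilpotent:
  fixes h :: "(nat \<times> nat) \<times> nat \<times> nat \<Rightarrow> nat" and \<delta> :: "zpoly \<Rightarrow> zpoly"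
  assumes "Modules.additive \<delta>"
    and low: "\<And>m n c. n \<in> Poly_Mapping.keys (\<delta> (Poly_Mapping.single m c)) \<Longrightarrow> h n < h m"
  shows "(\<And>m. m \<in> Poly_Mapping.keys F \<Longrightarrow> h m < k) \<Longrightarrow> (\<delta> ^^ k) F = 0"
proof (induction k arbitrary: F)
  case 0
  then have "Poly_Mapping.keys F = {}" by blast
  then show ?case by simp
next
  case (Suc k)
  have "(\<delta> ^^ k) (\<delta> F) = 0"
  proof (rule Suc.IH)
    show "h m < k" if "m \<in> Poly_Mapping.keys (\<delta> F)" for m
    proof -
      obtain m' where "m' \<in> Poly_Mapping.keys F" "m \<in> Poly_Mapping.keys (\<delta> (Poly_Mapping.single m' (Poly_Mapping.lookup F m')))"
        using keys_additive[OF assms(1) \<open>m \<in> Poly_Mapping.keys (\<delta> F)\<close>] by blast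
      then have "h m < h m'" "h m' < Suc k" by (auto intro: low Suc.prems)
      then show ?thesis by simp
    qed
  qed
  then show ?case by (simp only: funpow_Suc_right o_apply)
qed

section \<open>Holomorphic derivations, their weights and their conjugates\<close>

definition holomorphic_zpoly :: "zpoly \<Rightarrow> bool" where
  "holomorphic_zpoly F \<longleftrightarrow> (\<forall>m\<in>Poly_Mapping.keys F. snd m = 0)"

text \<open>Algebraic form of a vector field A1(z) d/dz1 + A2(z) d/dz2 with holomorphic polynomial
  coefficients; the coefficients are the values on \<open>var_z1\<close> and
  \<open>var_z2\<close>.\<close>

definition hol_derivation :: "(zpoly \<Rightarrow> zpoly) \<Rightarrow> bool" where
  "hol_derivation \<delta> \<longleftrightarrow> derivation \<delta> \<and> \<delta> var_zb1 = 0 \<and> \<delta> var_zb2 = 0 \<and>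
     holomorphic_zpoly (\<delta> var_z1) \<and> holomorphic_zpoly (\<delta> var_z2)"

definition graded_derivation :: "real \<times> real \<Rightarrow> real \<Rightarrow> (zpoly \<Rightarrow> zpoly) \<Rightarrow> bool" where
  "graded_derivation \<mu> \<rho> \<delta> \<longleftrightarrow> hol_derivation \<delta> \<and>
     (\<forall>m\<in>Poly_Mapping.keys (\<delta> var_z1). weighted_length \<mu> (fst m) = fst \<mu> + \<rho>) \<and>
     (\<forall>m\<in>Poly_Mapping.keys (\<delta> var_z2). weighted_length \<mu> (fst m) = snd \<mu> + \<rho>)"

lemma hol_derivation_D: "hol_derivation \<delta> \<Longrightarrow> derivation \<delta>"
  by (simp add: hol_derivation_def)

lemma graded_derivation_D: "graded_derivation \<mu> \<rho> \<delta> \<Longrightarrow> hol_derivation \<delta>"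
  by (simp add: graded_derivation_def)

lemma hol_derivation_eq:
  assumes "hol_derivation \<delta>"
  shows "\<delta> F = pd1 F * \<delta> var_z1 + pd2 F * \<delta> var_z2"
proof -
  have "derivation (\<lambda>F. pd1 F * \<delta> var_z1 + pd2 F * \<delta> var_z2)"
    by (intro derivationI) (simp_all add: derivation_simps[OF derivation_pd1] derivation_simps[OF derivation_pd2] algebra_simps)
  moreover have "derivation \<delta>" "\<delta> var_zb1 = 0" "\<delta> var_zb2 = 0" using assms by (simp_all add: hol_derivation_def)
  ultimately show ?thesis
    by (elim derivation_eqI) (simp_all add: pd_vars)
qed

lemma weighted_length_add: "weighted_length \<mu> (\<alpha> + \<beta>) = weighted_length \<mu> \<alpha> + weighted_length \<mu> \<beta>"
  by (simp add: weighted_length_def algebra_simps)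

lemma weighted_length_0 [simp]: "weighted_length \<mu> 0 = 0"
  by (simp add: weighted_length_def)

text \<open>Differentiation removes one factor zj and multiplies by a monomial of the jth
  coefficient, so the antiholomorphic exponent is untouched. The shift is written additively to
  avoid subtraction of natural numbers.\<close>

lemma keys_hol_derivation_single:
  assumes "hol_derivation \<delta>" "n \<in> Poly_Mapping.keys (\<delta> (Poly_Mapping.single m c))"
  shows "snd n = snd m"
    and "\<exists>k. (k \<in> Poly_Mapping.keys (\<delta> var_z1) \<and> fst n + (1, 0) = fst m + fst k) \<or>
      (k \<in> Poly_Mapping.keys (\<delta> var_z2) \<and> fst n + (0, 1) = fst m + fst k)"
proof -
  obtain a1 a2 b where m: "m = ((a1, a2), b)" by (metis surj_pair)
  let ?A = "Poly_Mapping.single ((a1 - 1, a2), b) (of_nat a1 * c) * \<delta> var_z1"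
  let ?B = "Poly_Mapping.single ((a1, a2 - 1), b) (of_nat a2 * c) * \<delta> var_z2"
  have "\<delta> (Poly_Mapping.single m c) = ?A + ?B"
    unfolding hol_derivation_eq[OF assms(1), of "Poly_Mapping.single m c"] unfolding m pd_single by (rule refl)
  with assms(2) have "n \<in> Poly_Mapping.keys ?A \<or> n \<in> Poly_Mapping.keys ?B"
    using Poly_Mapping.keys_add[of ?A ?B] by auto
  then obtain k where k: "snd k = 0" "snd n = b + snd k" "(k \<in> Poly_Mapping.keys (\<delta> var_z1) \<and> fst n + (1, 0) = fst m + fst k) \<or>
      (k \<in> Poly_Mapping.keys (\<delta> var_z2) \<and> fst n + (0, 1) = fst m + fst k)"
  proof
    assume n: "n \<in> Poly_Mapping.keys ?A"
    then have "a1 \<noteq> 0" by (intro notI) simp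
    from n obtain k where k: "k \<in> Poly_Mapping.keys (\<delta> var_z1)" "n = ((a1 - 1, a2), b) + k"
      using keys_mult[of "Poly_Mapping.single ((a1 - 1, a2), b) (of_nat a1 * c)" "\<delta> var_z1"]
      by (auto split: if_splits)
    have "snd k = 0" using k(1) assms(1) by (simp add: hol_derivation_def holomorphic_zpoly_def)
    moreover have "fst n + (1, 0) = fst m + fst k"
      using \<open>a1 \<noteq> 0\<close> unfolding k(2) m by (cases k) auto
    ultimately show thesis using k that by simp
  next
    assume n: "n \<in> Poly_Mapping.keys ?B"
    then have "a2 \<noteq> 0" by (intro notI) simp
    from n obtain k where k: "k \<in> Poly_Mapping.keys (\<delta> var_z2)" "n = ((a1, a2 - 1), b) + k"
      using keys_mult[of "Poly_Mapping.single ((a1, a2 - 1), b) (of_nat a2 * c)" "\<delta> var_z2"]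
      by (auto split: if_splits)
    have "snd k = 0" using k(1) assms(1) by (simp add: hol_derivation_def holomorphic_zpoly_def)
    moreover have "fst n + (0, 1) = fst m + fst k"
      using \<open>a2 \<noteq> 0\<close> unfolding k(2) m by (cases k) auto
    ultimately show thesis using k that by simp
  qed
  from k(1,2) show "snd n = snd m" by (simp add: m)
  from k(3) show "\<exists>k. (k \<in> Poly_Mapping.keys (\<delta> var_z1) \<and> fst n + (1, 0) = fst m + fst k) \<or>
      (k \<in> Poly_Mapping.keys (\<delta> var_z2) \<and> fst n + (0, 1) = fst m + fst k)"
    by blast
qed

lemma keys_graded_derivation_single:
  assumes "graded_derivation \<mu> \<rho> \<delta>" "n \<in> Poly_Mapping.keys (\<delta> (Poly_Mapping.single m c))"
  shows "weighted_length \<mu> (fst n) = weighted_length \<mu> (fst m) + \<rho>"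
proof -
  obtain k where k: "(k \<in> Poly_Mapping.keys (\<delta> var_z1) \<and> fst n + (1, 0) = fst m + fst k) \<or>
      (k \<in> Poly_Mapping.keys (\<delta> var_z2) \<and> fst n + (0, 1) = fst m + fst k)"
    using keys_hol_derivation_single(2)[OF graded_derivation_D[OF assms(1)] assms(2)] by blast
  then show ?thesis
  proof
    assume k: "k \<in> Poly_Mapping.keys (\<delta> var_z1) \<and> fst n + (1, 0) = fst m + fst k"
    then have "weighted_length \<mu> (fst n) + fst \<mu> = weighted_length \<mu> (fst m) + weighted_length \<mu> (fst k)"
      using weighted_length_add[of \<mu> "fst n" "(1,0)"] weighted_length_add[of \<mu> "fst m" "fst k"]
      by (simp add: weighted_length_def)
    then show ?thesis using k assms(1) by (simp add: graded_derivation_def)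
  next
    assume k: "k \<in> Poly_Mapping.keys (\<delta> var_z2) \<and> fst n + (0, 1) = fst m + fst k"
    then have "weighted_length \<mu> (fst n) + snd \<mu> = weighted_length \<mu> (fst m) + weighted_length \<mu> (fst k)"
      using weighted_length_add[of \<mu> "fst n" "(0,1)"] weighted_length_add[of \<mu> "fst m" "fst k"]
      by (simp add: weighted_length_def)
    then show ?thesis using k assms(1) by (simp add: graded_derivation_def)
  qed
qed

lemma keys_hol_derivation:
  assumes "hol_derivation \<delta>" "n \<in> Poly_Mapping.keys (\<delta> F)"
  obtains m where "m \<in> Poly_Mapping.keys F" "snd n = snd m"
  using keys_additive[OF derivation_additive[OF hol_derivation_D[OF assms(1)]] assms(2)]
    keys_hol_derivation_single(1)[OF assms(1)] by metis

lemma keys_graded_derivation: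
  assumes "graded_derivation \<mu> \<rho> \<delta>" "n \<in> Poly_Mapping.keys (\<delta> F)"
  obtains m where "m \<in> Poly_Mapping.keys F" "snd n = snd m" "weighted_length \<mu> (fst n) = weighted_length \<mu> (fst m) + \<rho>"
  using keys_additive[OF derivation_additive[OF hol_derivation_D[OF graded_derivation_D[OF assms(1)]]] assms(2)]
    keys_hol_derivation_single(1)[OF graded_derivation_D[OF assms(1)]] keys_graded_derivation_single[OF assms(1)] by metis

lemma holomorphic_zpoly_derivation: "hol_derivation \<delta> \<Longrightarrow> holomorphic_zpoly F \<Longrightarrow> holomorphic_zpoly (\<delta> F)"
  unfolding holomorphic_zpoly_def by (metis keys_hol_derivation)

lemma hol_derivation_conj_holomorphic:
  assumes "hol_derivation \<delta>" "holomorphic_zpoly F"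
  shows "\<delta> (conj_zpoly F) = 0"
proof -
  have 0: "snd m = 0" if "Poly_Mapping.lookup F m \<noteq> 0" for m
    using assms(2) that by (simp add: holomorphic_zpoly_def in_keys_iff)
  have 1: "Poly_Mapping.lookup (conj_zpoly F) ((Suc i, j), b) = 0"
    "Poly_Mapping.lookup (conj_zpoly F) ((i, Suc j), b) = 0" for i j b
    using 0[of "(b, (Suc i, j))"] 0[of "(b, (i, Suc j))"] by (auto simp: lookup_conj zero_prod_def)
  have "pd1 (conj_zpoly F) = 0"
  proof (rule poly_mapping_eqI)
    fix m :: "(nat \<times> nat) \<times> nat \<times> nat"
    obtain a1 a2 b where m: "m = ((a1, a2), b)" by (metis surj_pair)
    show "Poly_Mapping.lookup (pd1 (conj_zpoly F)) m = Poly_Mapping.lookup 0 m" by (simp add: m lookup_pd1 1)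
  qed
  moreover have "pd2 (conj_zpoly F) = 0"
  proof (rule poly_mapping_eqI)
    fix m :: "(nat \<times> nat) \<times> nat \<times> nat"
    obtain a1 a2 b where m: "m = ((a1, a2), b)" by (metis surj_pair)
    show "Poly_Mapping.lookup (pd2 (conj_zpoly F)) m = Poly_Mapping.lookup 0 m" by (simp add: m lookup_pd2 1)
  qed
  ultimately show ?thesis
    unfolding hol_derivation_eq[OF assms(1), of "conj_zpoly F"] by simp
qed

definition conj_derivation :: "(zpoly \<Rightarrow> zpoly) \<Rightarrow> zpoly \<Rightarrow> zpoly" where
  "conj_derivation \<delta> F = conj_zpoly (\<delta> (conj_zpoly F))"

lemma derivation_conj_derivation: "derivation \<delta> \<Longrightarrow> derivation (conj_derivation \<delta>)"
  unfolding conj_derivation_def[abs_def] by (rule derivation_conj)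

text \<open>The commutator is a derivation that vanishes on the four variables: one operator
  differentiates only in z with coefficients in z, the other only in cnj z with coefficients in cnj
  z.\<close>

lemma conj_derivation_commute:
  assumes "hol_derivation \<delta>" "hol_derivation \<epsilon>"
  shows "conj_derivation \<epsilon> (\<delta> F) = \<delta> (conj_derivation \<epsilon> F)"
proof -
  note d = hol_derivation_D[OF assms(1)] derivation_conj_derivation[OF hol_derivation_D[OF assms(2)]]
  have zero: "derivation (\<lambda>_. 0)" by (rule derivationI) auto
  have v: "\<delta> var_zb1 = 0" "\<delta> var_zb2 = 0" "\<epsilon> var_zb1 = 0" "\<epsilon> var_zb2 = 0" "\<delta> 0 = 0" "\<epsilon> 0 = 0"
    "\<delta> (conj_zpoly (\<epsilon> var_z1)) = 0" "\<delta> (conj_zpoly (\<epsilon> var_z2)) = 0"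
    "\<epsilon> (conj_zpoly (\<delta> var_z1)) = 0" "\<epsilon> (conj_zpoly (\<delta> var_z2)) = 0"
    using assms derivation_zero hol_derivation_conj_holomorphic by (auto simp: hol_derivation_def)
  have "\<delta> (conj_derivation \<epsilon> F) - conj_derivation \<epsilon> (\<delta> F) = (\<lambda>_. 0) F"
    by (rule derivation_eqI[OF derivation_commutator[OF d] zero])
      (simp_all add: conj_derivation_def conj_vars conj_zero v)
  then show ?thesis by simp
qed

section \<open>Exposed vertices of finite sets of exponents\<close>

lemma lookup_mult_sum:
  "Poly_Mapping.lookup (F * G) k = (\<Sum>m\<in>Poly_Mapping.keys F. \<Sum>n\<in>Poly_Mapping.keys G.
     if m + n = k then Poly_Mapping.lookup F m * Poly_Mapping.lookup G n else 0)"
  for F G :: zpoly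
proof -
  have *: "F = (\<Sum>m\<in>Poly_Mapping.keys F. Poly_Mapping.single m (Poly_Mapping.lookup F m))" for F :: zpoly
    by (rule poly_mapping_eqI) (auto simp: lookup_sum lookup_single when_def in_keys_iff)
  have "F * G = (\<Sum>m\<in>Poly_Mapping.keys F. \<Sum>n\<in>Poly_Mapping.keys G.
     Poly_Mapping.single (m + n) (Poly_Mapping.lookup F m * Poly_Mapping.lookup G n))"
    using arg_cong2[OF *[of F] *[of G], of "(*)"] by (simp only: sum_product mult_single)
  then show ?thesis by (simp add: lookup_sum lookup_single when_def)
qed

text \<open>Among the maximisers of \<open>\<phi>\<close>, then of \<open>\<psi>\<close>, a point of
  largest Euclidean norm is chosen. If it were the midpoint of two points of \<open>K\<close>, both
  would be maximisers as well, and strict convexity of the squared norm makes them equal to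
  it.\<close>

lemma exposed_vertex_exists:
  fixes \<phi> \<psi> :: "(nat \<times> nat) \<times> nat \<times> nat \<Rightarrow> real"
  assumes "finite K" "K \<noteq> {}" "\<And>m n. \<phi> (m + n) = \<phi> m + \<phi> n" "\<And>m n. \<psi> (m + n) = \<psi> m + \<psi> n"
  obtains p where "p \<in> K" "\<And>m. m \<in> K \<Longrightarrow> \<phi> m \<le> \<phi> p" "\<And>m. m \<in> K \<Longrightarrow> \<phi> m = \<phi> p \<Longrightarrow> \<psi> m \<le> \<psi> p"
    "\<And>m n. m \<in> K \<Longrightarrow> n \<in> K \<Longrightarrow> m + n = p + p \<Longrightarrow> m = p"
proof -
  define sq :: "(nat \<times> nat) \<times> nat \<times> nat \<Rightarrow> real" where
    "sq m = (real (fst (fst m)))\<^sup>2 + (real (snd (fst m)))\<^sup>2 + (real (fst (snd m)))\<^sup>2 + (real (snd (snd m)))\<^sup>2" for m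
  obtain p1 where p1: "p1 \<in> K" "\<And>n. n \<in> K \<Longrightarrow> \<phi> n \<le> \<phi> p1"
    using ex_argmax_on[OF assms(1,2), of \<phi>] by blast
  define K1 where "K1 = {m \<in> K. \<phi> m = \<phi> p1}"
  have "finite K1" "p1 \<in> K1" using assms(1) p1(1) by (simp_all add: K1_def)
  then obtain p2 where p2: "p2 \<in> K1" "\<And>n. n \<in> K1 \<Longrightarrow> \<psi> n \<le> \<psi> p2"
    using ex_argmax_on[OF \<open>finite K1\<close>, of \<psi>] by blast
  define K2 where "K2 = {m \<in> K1. \<psi> m = \<psi> p2}"
  have "finite K2" "p2 \<in> K2" using p2(1) \<open>finite K1\<close> by (simp_all add: K2_def)
  then obtain p where p: "p \<in> K2" "\<And>n. n \<in> K2 \<Longrightarrow> sq n \<le> sq p"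
    using ex_argmax_on[OF \<open>finite K2\<close>, of sq] by blast
  have eqs: "\<phi> p = \<phi> p1" "\<psi> p = \<psi> p2" using p(1) by (simp_all add: K2_def K1_def)
  show thesis
  proof (rule that[of p])
    show "p \<in> K" using p(1) by (simp add: K2_def K1_def)
    show "\<phi> m \<le> \<phi> p" if "m \<in> K" for m using p1(2) that eqs by simp
    show "\<psi> m \<le> \<psi> p" if "m \<in> K" "\<phi> m = \<phi> p" for m using p2(2) that eqs by (simp add: K1_def)
    fix m n assume mn: "m \<in> K" "n \<in> K" "m + n = p + p"
    have "\<phi> m + \<phi> n = \<phi> p + \<phi> p" "\<psi> m + \<psi> n = \<psi> p + \<psi> p"
      using mn(3) assms(3,4) by metis+
    moreover have "\<phi> m \<le> \<phi> p" "\<phi> n \<le> \<phi> p" using p1(2) mn eqs by simp_all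
    ultimately have K1: "m \<in> K1" "n \<in> K1" using mn(1,2) eqs by (simp_all add: K1_def)
    then have "\<psi> m \<le> \<psi> p" "\<psi> n \<le> \<psi> p" using p2(2) eqs by simp_all
    then have "m \<in> K2" "n \<in> K2" using \<open>\<psi> m + \<psi> n = \<psi> p + \<psi> p\<close> eqs K1 by (simp_all add: K2_def)
    then have le: "sq m + sq n \<le> sq p + sq p" using p(2)[of m] p(2)[of n] by linarith
    obtain a1 a2 b1 b2 a1' a2' b1' b2' where m: "m = ((a1, a2), b1, b2)" and n: "n = ((a1', a2'), b1', b2')"
      by (metis surj_pair)
    obtain c1 c2 d1 d2 where pc: "p = ((c1, c2), d1, d2)" by (metis surj_pair)
    have e: "real a1 + real a1' = 2 * real c1" "real a2 + real a2' = 2 * real c2"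
      "real b1 + real b1' = 2 * real d1" "real b2 + real b2' = 2 * real d2"
      using mn(3) by (auto simp: m n pc)
    \<comment> \<open>Parallelogram identity: two points with midpoint z have squared norms adding
      up to 2 |z|^2 plus half their squared distance.\<close>
    have par: "x\<^sup>2 + y\<^sup>2 = 2 * z\<^sup>2 + (x - y)\<^sup>2 / 2" if "x + y = 2 * z" for x y z :: real
      using arg_cong[OF that, of "\<lambda>t. t\<^sup>2"] by (simp add: power2_eq_square field_simps)
    have "(real a1 - real a1')\<^sup>2 / 2 + (real a2 - real a2')\<^sup>2 / 2 + (real b1 - real b1')\<^sup>2 / 2 + (real b2 - real b2')\<^sup>2 / 2 \<le> 0"
      using le par[OF e(1)] par[OF e(2)] par[OF e(3)] par[OF e(4)] by (simp add: sq_def m n pc)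
    moreover have "(real a1 - real a1')\<^sup>2 \<ge> 0" "(real a2 - real a2')\<^sup>2 \<ge> 0" "(real b1 - real b1')\<^sup>2 \<ge> 0" "(real b2 - real b2')\<^sup>2 \<ge> 0"
      by auto
    ultimately have "(real a1 - real a1')\<^sup>2 = 0" "(real a2 - real a2')\<^sup>2 = 0" "(real b1 - real b1')\<^sup>2 = 0" "(real b2 - real b2')\<^sup>2 = 0"
      by linarith+
    then show "m = p" using e by (auto simp: m pc)
  qed
qed

lemma const_mult_eq_0D:
  assumes "const_zpoly c * F = 0" "c \<noteq> 0"
  shows "F = 0"
proof -
  have "const_zpoly (inverse c) * (const_zpoly c * F) = F"
    using assms(2) by (simp add: mult.assoc[symmetric] const_zpoly_mult[symmetric])
  then show ?thesis using assms(1) by simp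
qed

section \<open>The tangency equations\<close>

text \<open>Algebraic content of a nonzero tangent field w Y + Z + g w^2 d/dw of weight 1.
  \<open>Y_eq\<close> and \<open>Z_eq\<close> come from the coefficients of u and of 1 in the
  tangency condition along w = u + i P. \<open>nondegenerate\<close> is the form of holomorphic
  nondegeneracy needed for fields in z, and \<open>nontrivial\<close> says that the field is not
  zero.\<close>

locale tangency =
  fixes \<mu> :: "real \<times> real" and P :: zpoly and Y Z :: "zpoly \<Rightarrow> zpoly" and g :: real
  assumes weights_pos: "fst \<mu> > 0" "snd \<mu> > 0"
    and conj_P: "conj_zpoly P = P"
    and homogeneous: "weighted_homogeneous \<mu> P"
    and no_pluriharmonic: "no_pluriharmonic_terms P"
    and Y_graded: "graded_derivation \<mu> 0 Y"
    and Z_graded: "graded_derivation \<mu> 1 Z"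
    and Y_eq: "Y P + conj_zpoly (Y P) = const_zpoly (2 * of_real g) * P"
    and Z_eq: "Z P + conj_zpoly (Z P) = const_zpoly (-2 * \<i>) * (P * (Y P - const_zpoly (of_real g) * P))"
    and nondegenerate: "\<And>\<delta>. hol_derivation \<delta> \<Longrightarrow> \<delta> P = 0 \<Longrightarrow> \<delta> var_z1 = 0 \<and> \<delta> var_z2 = 0"
    and nontrivial: "\<not> (Y var_z1 = 0 \<and> Y var_z2 = 0 \<and> Z var_z1 = 0 \<and> Z var_z2 = 0 \<and> g = 0)"
begin

abbreviation "level m \<equiv> weighted_length \<mu> (fst m)"
abbreviation "colevel m \<equiv> weighted_length \<mu> (snd m)"

lemma Y_hol: "hol_derivation Y" and Z_hol: "hol_derivation Z" and Y_der: "derivation Y" and Z_der: "derivation Z"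
  using Y_graded Z_graded graded_derivation_D hol_derivation_D by blast+

lemma level_colevel: "m \<in> Poly_Mapping.keys P \<Longrightarrow> level m + colevel m = 1"
  using homogeneous by (force simp: weighted_homogeneous_def)

lemma weighted_length_pos: "\<alpha> \<noteq> 0 \<Longrightarrow> weighted_length \<mu> \<alpha> > 0"
proof -
  assume "\<alpha> \<noteq> 0"
  then have "fst \<alpha> > 0 \<or> snd \<alpha> > 0" by (cases \<alpha>) (auto simp: zero_prod_def)
  then show ?thesis
    using weights_pos by (auto simp: weighted_length_def intro: add_pos_nonneg add_nonneg_pos)
qed

lemma level_pos: "m \<in> Poly_Mapping.keys P \<Longrightarrow> level m > 0"
  and colevel_pos: "m \<in> Poly_Mapping.keys P \<Longrightarrow> colevel m > 0"
  using no_pluriharmonic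
  by (auto intro!: weighted_length_pos simp: no_pluriharmonic_terms_def zero_prod_def case_prod_unfold)

lemma swap_keys: "m \<in> Poly_Mapping.keys P \<Longrightarrow> (snd m, fst m) \<in> Poly_Mapping.keys P"
  using lookup_conj[of P "(snd m, fst m)"] by (simp add: conj_P in_keys_iff)

text \<open>\<open>Z\<close> raises the level by 1, and levels in \<open>P\<close> are positive. By
  contrast, the conjugate of \<open>Z P\<close> keeps the holomorphic exponents of \<open>P\<close>,
  which have level below 1; thus the two terms on the left of \<open>Z_eq\<close> share no
  monomial.\<close>

lemma level_Z: "n \<in> Poly_Mapping.keys (Z P) \<Longrightarrow> level n > 1"
  using keys_graded_derivation[OF Z_graded] level_pos by (metis add.commute less_add_same_cancel1)

lemma keys_conj_Z:
  assumes "n \<in> Poly_Mapping.keys (conj_zpoly (Z P))"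
  obtains m where "m \<in> Poly_Mapping.keys P" "fst n = fst m"
proof -
  from assms have "(snd n, fst n) \<in> Poly_Mapping.keys (Z P)" by (simp add: in_keys_iff lookup_conj)
  then obtain m where m: "m \<in> Poly_Mapping.keys P" "fst n = snd m"
    by (metis keys_hol_derivation[OF Z_hol] snd_conv)
  show thesis by (rule that[OF swap_keys[OF m(1)]]) (simp add: m)
qed

lemma level_conj_Z: "n \<in> Poly_Mapping.keys (conj_zpoly (Z P)) \<Longrightarrow> level n < 1"
  using keys_conj_Z level_colevel colevel_pos by (metis less_add_same_cancel1)

definition "remainder = P * (Y P - const_zpoly (of_real g) * P)"

lemma Z_eq': "Z P + conj_zpoly (Z P) = const_zpoly (-2 * \<i>) * remainder"
  using Z_eq by (simp add: remainder_def)

text \<open>Level 1 lies strictly between the levels of \<open>Z P\<close> and those of its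
  conjugate, so the left side of \<open>Z_eq\<close> has no part there.\<close>

lemma component_1_remainder: "component level 1 remainder = 0"
proof -
  have "component level 1 (Z P) = 0" "component level 1 (conj_zpoly (Z P)) = 0"
    by (rule component_eq_0, use level_Z level_conj_Z in force)+
  then have "const_zpoly (-2 * \<i>) * component level 1 remainder = 0"
    using arg_cong[OF Z_eq', of "component level 1"] by (simp add: component_add component_mult_const)
  then show ?thesis by (rule const_mult_eq_0D) simp
qed

text \<open>Otherwise d/dz1 would annihilate \<open>P\<close>, against nondegeneracy.\<close>

lemma P_nonzero: "P \<noteq> 0"
proof
  assume "P = 0"
  have "hol_derivation pd1" by (simp add: hol_derivation_def derivation_pd1 pd_vars holomorphic_zpoly_def)
  from nondegenerate[OF this] \<open>P = 0\<close> show False by (simp add: pd_vars derivation_zero[OF derivation_pd1])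
qed

subsection \<open>The nilpotent case\<close>

text \<open>Here Y = \<kappa> E + N with the weighted Euler derivation E and N = b z2^k d/dz1, which
  is nilpotent on every polynomial. Comparing levels gives (N + cnj N) P_l = 0 for each level part
  P_l, and the level 1 part of \<open>remainder\<close> gives N F = 0 for F = sum of P_l cnj P_l. If
  e is the last power with N^e P nonzero, then N^(2e) F is a nonzero multiple of the sum of |N^e
  P_l|^2, so for e > 0 all these vanish; for e = 0 already N P = 0. Both are impossible.\<close>

lemma no_nilpotent_part:
  assumes Y1: "Y var_z1 = const_zpoly (\<kappa> * of_real (fst \<mu>)) * var_z1 + const_zpoly b * var_z2 ^ k"
    and Y2: "Y var_z2 = const_zpoly (\<kappa> * of_real (snd \<mu>)) * var_z2"
    and k: "fst \<mu> = real k * snd \<mu>" and b: "b \<noteq> 0"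
  shows False
proof -
  define N where "N F = const_zpoly b * var_z2 ^ k * pd1 F" for F
  define E :: "zpoly \<Rightarrow> zpoly" where "E = lin_ext (\<lambda>m c. Poly_Mapping.single m (of_real (level m) * c))"
  have N_der: "derivation N"
    unfolding N_def by (rule derivation_left_mult[OF derivation_pd1])
  have Nv: "N var_z1 = const_zpoly b * var_z2 ^ k" "N var_z2 = 0" "N var_zb1 = 0" "N var_zb2 = 0"
    by (simp_all add: N_def pd_vars)
  have key_z2: "Poly_Mapping.keys (const_zpoly b * var_z2 ^ k) \<subseteq> {((0, k), 0)}"
    by (simp add: var_powers const_zpoly_mult_single zero_prod_def)
  have N_graded: "graded_derivation \<mu> 0 N"
    using N_der key_z2 k unfolding graded_derivation_def hol_derivation_def Nv
    by (auto simp: holomorphic_zpoly_def weighted_length_def)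
  then have N_hol: "hol_derivation N" by (rule graded_derivation_D)
  note N_add = derivation_additive[OF N_der]
  have E_single: "E (Poly_Mapping.single m c) = Poly_Mapping.single m (of_real (level m) * c)" for m c
    unfolding E_def by (subst lin_ext_single) auto
  have E_add: "Modules.additive E"
    unfolding E_def by (rule additive_lin_ext) (simp add: single_add algebra_simps)
  have E_der: "derivation E"
  proof (rule derivation_from_singles[OF E_add])
    show "E (const_zpoly c) = 0" for c by (simp add: const_zpoly_def E_single)
  qed (simp add: mult_single E_single weighted_length_add algebra_simps flip: single_add)
  have Ev: "E var_z1 = const_zpoly (of_real (fst \<mu>)) * var_z1" "E var_z2 = const_zpoly (of_real (snd \<mu>)) * var_z2"
    "E var_zb1 = 0" "E var_zb2 = 0"
    by (simp_all add: var_defs E_single weighted_length_def const_zpoly_mult_single)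
  have Yv: "Y var_zb1 = 0" "Y var_zb2 = 0" using Y_hol by (simp_all add: hol_derivation_def)
  have Y_decomp: "Y F = const_zpoly \<kappa> * E F + N F" for F
  proof (rule derivation_eqI[OF Y_der])
    show "derivation (\<lambda>F. const_zpoly \<kappa> * E F + N F)"
      by (intro derivation_plus derivation_left_mult E_der N_der)
  qed (simp_all add: Y1 Y2 Nv Ev Yv const_zpoly_mult mult.assoc)
  have E_comp: "E (component level l F) = const_zpoly (of_real l) * component level l F" for l F
    by (induction F rule: poly_mapping_additive_induct)
      (auto simp: component_single E_single component_add additive.add[OF E_add] additive.zero[OF E_add] const_zpoly_mult_single distrib_left)
  have N_comp: "component level l (N F) = N (component level l F)" for l F
    by (rule component_comp_linear[OF N_add, where f = id and \<phi> = level and \<psi> = level, simplified])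
      (use keys_graded_derivation_single[OF N_graded] in auto)
  have Y_comp: "component level l (Y F) = Y (component level l F)" for l F
    by (rule component_comp_linear[OF derivation_additive[OF Y_der], where f = id and \<phi> = level and \<psi> = level, simplified])
      (use keys_graded_derivation_single[OF Y_graded] in auto)
  have conj_comp: "conj_zpoly (component level l P) = component level (1 - l) P" for l
  proof (rule poly_mapping_eqI)
    fix m
    have "Poly_Mapping.lookup P m = cnj (Poly_Mapping.lookup P (snd m, fst m))"
      using lookup_conj[of P m] by (simp add: conj_P)
    moreover have "Poly_Mapping.lookup P m \<noteq> 0 \<Longrightarrow> level m + colevel m = 1"
      using level_colevel[of m] by (simp add: in_keys_iff)
    ultimately show "Poly_Mapping.lookup (conj_zpoly (component level l P)) m = Poly_Mapping.lookup (component level (1 - l) P) m"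
      by (cases "Poly_Mapping.lookup P m = 0") (auto simp: lookup_conj lookup_component)
  qed
  define NB where "NB = conj_derivation N"
  have NB_der: "derivation NB" unfolding NB_def by (rule derivation_conj_derivation[OF N_der])
  have NNB: "NB (N F) = N (NB F)" for F unfolding NB_def by (rule conj_derivation_commute[OF N_hol N_hol])
  \<comment> \<open>N lowers the exponent of z1 and its conjugate lowers that of cnj z1. The sum of
    both exponents drops under either, so N + \<open>NB\<close> has no nonzero eigenvalue.\<close>
  define h where "h m = fst (fst m) + fst (snd m)" for m :: "(nat \<times> nat) \<times> nat \<times> nat"
  have N_low: "h n < h m" if n: "n \<in> Poly_Mapping.keys (N (Poly_Mapping.single m c))" for n m c
  proof -
    obtain a1 a2 b1 b2 where m: "m = ((a1, a2), (b1, b2))" by (metis surj_pair)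
    have eq: "N (Poly_Mapping.single m c) = Poly_Mapping.single ((a1 - 1, a2 + k), (b1, b2)) (b * (of_nat a1 * c))"
      by (simp add: N_def m pd_single var_powers const_zpoly_mult_single mult_single add.commute)
    have "a1 \<noteq> 0" using n unfolding eq by (intro notI) simp
    moreover have "n = ((a1 - 1, a2 + k), (b1, b2))" using n unfolding eq by (auto split: if_splits)
    ultimately show ?thesis by (simp add: h_def m)
  qed
  have NB_low: "h n < h m" if n: "n \<in> Poly_Mapping.keys (NB (Poly_Mapping.single m c))" for n m c
  proof -
    have "(snd n, fst n) \<in> Poly_Mapping.keys (N (Poly_Mapping.single (snd m, fst m) (cnj c)))"
      using n by (simp add: NB_def conj_derivation_def conj_single in_keys_iff lookup_conj)
    from N_low[OF this] show ?thesis by (simp add: h_def add.commute)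
  qed
  have NNB_low: "h n < h m" if n: "n \<in> Poly_Mapping.keys (N (Poly_Mapping.single m c) + NB (Poly_Mapping.single m c))" for n m c
    using n Poly_Mapping.keys_add[of "N (Poly_Mapping.single m c)" "NB (Poly_Mapping.single m c)"] N_low NB_low by blast
  have NNB_0: "N (component level l P) + NB (component level l P) = 0" and
    kappa_l: "component level l P \<noteq> 0 \<Longrightarrow> \<kappa> * l + cnj \<kappa> * (1 - l) = 2 * of_real g" for l
  proof -
    define Q where "Q = component level l P"
    have Q': "conj_zpoly Q = component level (1 - l) P" "conj_zpoly (component level (1 - l) P) = Q"
      by (simp_all add: Q_def conj_comp)
    have comp_conj: "component level l (conj_zpoly (Y P)) = conj_zpoly (Y (component level (1 - l) P))"
    proof -
      have "component level l (conj_zpoly (Y P)) = conj_zpoly (component colevel l (Y P))"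
        by (intro poly_mapping_eqI) (auto simp: lookup_component lookup_conj)
      also have "component colevel l (Y P) = Y (component colevel l P)"
        by (rule component_comp_linear[OF derivation_additive[OF Y_der], where f = id and \<phi> = colevel and \<psi> = colevel, simplified])
          (use keys_hol_derivation_single[OF Y_hol] in auto)
      also have "component colevel l P = component level (1 - l) P"
        using level_colevel by (intro poly_mapping_eqI) (force simp: lookup_component in_keys_iff)
      finally show ?thesis .
    qed
    have "Y Q + conj_zpoly (Y (conj_zpoly Q)) = const_zpoly (2 * of_real g) * Q"
      using arg_cong[OF Y_eq, of "component level l"]
      by (simp add: component_add component_mult_const Y_comp comp_conj Q' flip: Q_def)
    moreover have "Y Q = const_zpoly (\<kappa> * l) * Q + N Q"
      using Y_decomp[of Q] E_comp[of l P] by (simp add: Q_def const_zpoly_mult mult.assoc)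
    moreover have "conj_zpoly (Y (conj_zpoly Q)) = const_zpoly (cnj \<kappa> * (1 - l)) * Q + NB Q"
      using Y_decomp[of "conj_zpoly Q"] E_comp[of "1 - l" P]
      by (simp add: Q' conj_simps const_zpoly_mult mult.assoc NB_def conj_derivation_def)
    \<comment> \<open>At level l the derivations \<kappa> E and its conjugate act as scalars, so Q
      is an eigenvector of the lowering operator N + \<open>NB\<close>; hence the eigenvalue is
      0.\<close>
    ultimately have eq: "N Q + NB Q = const_zpoly (2 * of_real g - \<kappa> * l - cnj \<kappa> * (1 - l)) * Q"
      by (simp add: const_zpoly_diff const_zpoly_add const_zpoly_mult algebra_simps)
    have add: "Modules.additive (\<lambda>F. N F + NB F)"
      by (rule derivation_additive[OF derivation_plus[OF N_der NB_der]])
    have z: "2 * of_real g - \<kappa> * l - cnj \<kappa> * (1 - l) = 0" if "Q \<noteq> 0"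
      by (rule lowering_eigenvalue[OF add _ eq that, of h]) (rule NNB_low)
    show "N (component level l P) + NB (component level l P) = 0"
      using eq z unfolding Q_def[symmetric] by (cases "Q = 0") (auto simp: derivation_zero[OF N_der] derivation_zero[OF NB_der])
    show "component level l P \<noteq> 0 \<Longrightarrow> \<kappa> * l + cnj \<kappa> * (1 - l) = 2 * of_real g"
      using z unfolding Q_def[symmetric] by (simp add: algebra_simps)
  qed
  define L where "L = level ` Poly_Mapping.keys P"
  \<comment> \<open>The index set is symmetric under l -> 1 - l, so that conjugation permutes the
    parts indexed by it.\<close>
  define I where "I = L \<union> (\<lambda>l. 1 - l) ` L"
  have finI: "finite I" and I_sup: "level ` Poly_Mapping.keys P \<subseteq> I" by (simp_all add: I_def L_def)
  have I_sym: "bij_betw (\<lambda>l. 1 - l) I I"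
    by (rule bij_betw_byWitness[where f' = "\<lambda>l. 1 - l"]) (auto simp: I_def image_image)
  \<comment> \<open>Since cnj P_l = P_(1-l), this is the level 1 part of P^2, hence fixed by
    E.\<close>
  define F where "F = (\<Sum>l\<in>I. component level l P * conj_zpoly (component level l P))"
  have "(\<Sum>l\<in>I. component level l P * component level (1 - l) (Y P - const_zpoly (of_real g) * P)) = 0"
    using component_1_remainder unfolding remainder_def
    by (subst (asm) component_mult[OF _ finI I_sup]) (auto simp: weighted_length_add)
  then have c1: "(\<Sum>l\<in>I. component level l P * (Y (conj_zpoly (component level l P)) - const_zpoly (of_real g) * conj_zpoly (component level l P))) = 0"
    by (simp add: component_diff component_mult_const Y_comp conj_comp)
  have c2: "(\<Sum>l\<in>I. conj_zpoly (component level l P) * (Y (component level l P) - const_zpoly (of_real g) * component level l P)) = 0"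
    using c1 by (subst (asm) sum.reindex_bij_betw[OF I_sym, symmetric]) (simp add: conj_comp)
  \<comment> \<open>\<open>c1\<close> has Y on the second factor of each product and
    \<open>c2\<close>, its reindexed form, has Y on the first. Their sum is the Leibniz rule for Y
    F.\<close>
  have "Y F - const_zpoly (2 * of_real g) * F = 0"
    using arg_cong2[OF c1 c2, of "(+)"] unfolding F_def
    by (simp add: sum.distrib[symmetric] derivation_sum[OF Y_der] derivation_mult[OF Y_der] sum_distrib_left sum_subtractf[symmetric] const_zpoly_mult algebra_simps)
  moreover have "E F = F"
  proof -
    have "E (component level l P * conj_zpoly (component level l P)) = component level l P * conj_zpoly (component level l P)" for l
      unfolding derivation_mult[OF E_der] conj_comp E_comp by (simp add: const_zpoly_diff algebra_simps)
    then show ?thesis unfolding F_def by (simp add: derivation_sum[OF E_der])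
  qed
  ultimately have NF: "N F = const_zpoly (2 * of_real g - \<kappa>) * F"
    using Y_decomp[of F] by (simp add: const_zpoly_diff algebra_simps)
  have sum_P: "(\<Sum>l\<in>I. component level l P) = P" by (rule sum_component[OF finI I_sup])
  have "F \<noteq> 0"
    using sum_mult_conj_eq_0[OF finI, of "\<lambda>l. component level l P"] sum_P P_nonzero unfolding F_def
    by (metis (no_types, lifting) sum.neutral)
  then have "N F = 0"
    using lowering_eigenvalue[OF N_add N_low NF] NF by simp
  have ex: "\<exists>n. (N ^^ n) P = 0"
    using lowering_nilpotent[OF N_add N_low, where F = P and k = "Suc (Max (h ` Poly_Mapping.keys P))"] by (meson Max_ge finite_imageI finite_keys imageI less_Suc_eq_le)
  \<comment> \<open>The exponent e = d - 1 is the last one with N^e P nonzero; it exists because P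
    is nonzero.\<close>
  define d where "d = (LEAST n. (N ^^ n) P = 0)"
  have d: "(N ^^ d) P = 0" unfolding d_def using ex by (rule LeastI_ex)
  with P_nonzero obtain e where e: "d = Suc e" by (cases d) auto
  have Ne: "(N ^^ e) P \<noteq> 0" using not_less_Least[of e "\<lambda>n. (N ^^ n) P = 0"] e d_def by simp
  have N_pow_comp: "component level l ((N ^^ n) F) = (N ^^ n) (component level l F)" for l n F
    by (induction n) (auto simp: N_comp)
  have N_pow_0: "(N ^^ n) 0 = 0" for n by (induction n) (auto simp: derivation_zero[OF N_der])
  have N_pow_sum: "(N ^^ n) (\<Sum>l\<in>I. f l) = (\<Sum>l\<in>I. (N ^^ n) (f l))" for n and f :: "real \<Rightarrow> zpoly"
    by (induction n) (auto simp: derivation_sum[OF N_der])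
  show False
  proof (cases e)
    case 0
    then have "N P = 0" using d e by simp
    from nondegenerate[OF N_hol this] have "const_zpoly b * var_z2 ^ k = 0" by (simp add: Nv)
    then have "Poly_Mapping.lookup (const_zpoly b * var_z2 ^ k) ((0, k), 0) = 0" by simp
    with b show False by (simp add: var_powers zero_prod_def)
  next
    case (Suc e')
    have big: "(N ^^ n) (component level l P) = 0" if "n > e" for n l
    proof -
      have "(N ^^ n) P = 0"
      proof -
        have "n = (n - d) + d" using that e by simp
        then have "(N ^^ n) P = (N ^^ (n - d)) ((N ^^ d) P)" by (metis funpow_add o_apply)
        then show ?thesis by (simp add: d N_pow_0)
      qed
      then show ?thesis using N_pow_comp[of l n P] by (simp add: component_zero)
    qed
    have NB_pow: "NB ((N ^^ j) (component level l P)) = - (N ^^ Suc j) (component level l P)" for j l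
    proof -
      have "NB ((N ^^ j) (component level l P)) = (N ^^ j) (NB (component level l P))"
        by (induction j) (auto simp: NNB)
      also have "NB (component level l P) = - N (component level l P)"
        using NNB_0[of l] by (simp add: add_eq_0_iff)
      also have "(N ^^ j) (- N (component level l P)) = - (N ^^ j) (N (component level l P))"
        by (induction j) (auto simp: derivation_minus[OF N_der])
      finally show ?thesis by (simp only: funpow_Suc_right o_apply)
    qed
    have conj_pow: "(N ^^ j) (conj_zpoly (component level l P)) = const_zpoly ((-1) ^ j) * conj_zpoly ((N ^^ j) (component level l P))" for j l
    proof (induction j)
      case (Suc j)
      have "(N ^^ Suc j) (conj_zpoly (component level l P)) = const_zpoly ((-1) ^ j) * N (conj_zpoly ((N ^^ j) (component level l P)))"
        by (simp add: Suc derivation_const_mult[OF N_der])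
      also have "N (conj_zpoly ((N ^^ j) (component level l P))) = conj_zpoly (NB ((N ^^ j) (component level l P)))"
        by (simp add: NB_def conj_derivation_def)
      finally show ?case by (simp add: NB_pow conj_minus const_zpoly_minus)
    qed simp
    \<comment> \<open>In this branch e + e is at least 1, so N F = 0 suffices.\<close>
    have "(N ^^ (e + e)) F = 0"
      using \<open>N F = 0\<close> Suc by (simp only: add_Suc_right funpow_Suc_right o_apply N_pow_0)
    moreover have "(N ^^ (e + e)) F = (\<Sum>l\<in>I. (N ^^ (e + e)) (component level l P * conj_zpoly (component level l P)))"
      unfolding F_def by (rule N_pow_sum)
    moreover have "(N ^^ (e + e)) (component level l P * conj_zpoly (component level l P)) =
       const_zpoly (of_nat ((e + e) choose e) * (-1) ^ e) * ((N ^^ e) (component level l P) * conj_zpoly ((N ^^ e) (component level l P)))" for l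
    proof -
      have "(N ^^ (e + e)) (component level l P * conj_zpoly (component level l P)) =
        (\<Sum>i\<le>e + e. const_zpoly (of_nat ((e + e) choose i)) * ((N ^^ i) (component level l P) * (N ^^ (e + e - i)) (conj_zpoly (component level l P))))"
        by (rule derivation_leibniz[OF N_der])
      \<comment> \<open>In every term other than the middle one, N is applied more than e times to
        one of the factors.\<close>
      also have "\<dots> = (\<Sum>i\<le>e + e. if i = e then const_zpoly (of_nat ((e + e) choose e)) * ((N ^^ e) (component level l P) * (N ^^ e) (conj_zpoly (component level l P))) else 0)"
      proof (rule sum.cong[OF refl])
        fix i assume "i \<in> {..e + e}"
        then consider "i > e" | "e + e - i > e" | "i = e" by fastforce
        then show "const_zpoly (of_nat ((e + e) choose i)) * ((N ^^ i) (component level l P) * (N ^^ (e + e - i)) (conj_zpoly (component level l P))) =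
          (if i = e then const_zpoly (of_nat ((e + e) choose e)) * ((N ^^ e) (component level l P) * (N ^^ e) (conj_zpoly (component level l P))) else 0)"
          by cases (auto simp: big conj_comp)
      qed
      finally show ?thesis by (simp add: conj_pow const_zpoly_mult algebra_simps)
    qed
    ultimately have "const_zpoly (of_nat ((e + e) choose e) * (-1) ^ e) * (\<Sum>l\<in>I. (N ^^ e) (component level l P) * conj_zpoly ((N ^^ e) (component level l P))) = 0"
      by (simp add: sum_distrib_left)
    then have "(\<Sum>l\<in>I. (N ^^ e) (component level l P) * conj_zpoly ((N ^^ e) (component level l P))) = 0"
      by (rule const_mult_eq_0D) simp
    then have "(N ^^ e) (component level l P) = 0" if "l \<in> I" for l
      using sum_mult_conj_eq_0[OF finI, of "\<lambda>l. (N ^^ e) (component level l P)"] that by simp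
    then have "(\<Sum>l\<in>I. component level l ((N ^^ e) P)) = 0" by (simp add: N_pow_comp)
    moreover have "level ` Poly_Mapping.keys ((N ^^ e) P) \<subseteq> I"
    proof
      have *: "\<exists>m\<in>Poly_Mapping.keys P. level n = level m" if "n \<in> Poly_Mapping.keys ((N ^^ j) P)" for n j
        using that
      proof (induction j arbitrary: n)
        case (Suc j)
        then show ?case using keys_graded_derivation[OF N_graded] by simp metis
      qed auto
      fix x assume "x \<in> level ` Poly_Mapping.keys ((N ^^ e) P)"
      with * show "x \<in> I" unfolding I_def L_def by blast
    qed
    ultimately show False using Ne sum_component[OF finI] by metis
  qed
qed

end

section \<open>Vertices of the Newton polytope and the diagonal case\<close>

definition vertex_of :: "'a::plus set \<Rightarrow> 'a \<Rightarrow> bool" where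
  "vertex_of K p \<longleftrightarrow> p \<in> K \<and> (\<forall>m\<in>K. \<forall>n\<in>K. m + n = p + p \<longrightarrow> m = p)"

lemma vertex_of_maximal:
  fixes \<phi> \<psi> :: "(nat \<times> nat) \<times> nat \<times> nat \<Rightarrow> real"
  assumes "finite K" "K \<noteq> {}" "\<And>m n. \<phi> (m + n) = \<phi> m + \<phi> n" "\<And>m n. \<psi> (m + n) = \<psi> m + \<psi> n"
  shows "\<exists>p. vertex_of K p \<and> (\<forall>m\<in>K. \<phi> m \<le> \<phi> p) \<and> (\<forall>m\<in>K. \<phi> m = \<phi> p \<longrightarrow> \<psi> m \<le> \<psi> p)"
proof -
  obtain p where p: "p \<in> K" "\<And>m. m \<in> K \<Longrightarrow> \<phi> m \<le> \<phi> p" "\<And>m. m \<in> K \<Longrightarrow> \<phi> m = \<phi> p \<Longrightarrow> \<psi> m \<le> \<psi> p"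
    "\<And>m n. m \<in> K \<Longrightarrow> n \<in> K \<Longrightarrow> m + n = p + p \<Longrightarrow> m = p"
    using exposed_vertex_exists[of K \<phi> \<psi>, OF assms] by (metis (no_types))
  then show ?thesis unfolding vertex_of_def by (intro exI[of _ p]) (simp (no_asm_simp))
qed

context tangency
begin

text \<open>The only way to write twice a vertex as a sum of two exponents of \<open>P\<close> is
  the trivial one, so no cancellation can occur there.\<close>

lemma lookup_square_vertex:
  assumes "vertex_of (Poly_Mapping.keys P) p"
  shows "Poly_Mapping.lookup (P * P) (p + p) = (Poly_Mapping.lookup P p)\<^sup>2"
proof -
  have "Poly_Mapping.lookup (P * P) (p + p) = (\<Sum>m\<in>Poly_Mapping.keys P. \<Sum>n\<in>Poly_Mapping.keys P.
      if m = p \<and> n = p then Poly_Mapping.lookup P m * Poly_Mapping.lookup P n else 0)"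
    unfolding lookup_mult_sum
  proof (intro sum.cong refl)
    fix m n assume mn: "m \<in> Poly_Mapping.keys P" "n \<in> Poly_Mapping.keys P"
    have "m + n = p + p \<longleftrightarrow> m = p \<and> n = p"
      using assms mn unfolding vertex_of_def by (metis add.commute)
    then show "(if m + n = p + p then Poly_Mapping.lookup P m * Poly_Mapping.lookup P n else 0) =
      (if m = p \<and> n = p then Poly_Mapping.lookup P m * Poly_Mapping.lookup P n else 0)" by simp
  qed
  also have "\<dots> = (\<Sum>m\<in>Poly_Mapping.keys P. if m = p then Poly_Mapping.lookup P m * Poly_Mapping.lookup P p else 0)"
    using assms by (intro sum.cong refl) (auto simp: vertex_of_def)
  also have "\<dots> = (Poly_Mapping.lookup P p)\<^sup>2"
    using assms by (simp add: power2_eq_square vertex_of_def)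
  finally show ?thesis .
qed

end

locale diagonal_tangency = tangency +
  fixes a c :: complex
  assumes Y1: "Y var_z1 = const_zpoly a * var_z1" and Y2: "Y var_z2 = const_zpoly c * var_z2"
begin

text \<open>The eigenvalue of \<open>Y\<close> on monomials with holomorphic exponent
  \<open>\<alpha>\<close>.\<close>

definition "\<sigma> \<alpha> = a * of_nat (fst \<alpha>) + c * of_nat (snd \<alpha>)" for \<alpha> :: "nat \<times> nat"

lemma \<sigma>_add: "\<sigma> (\<alpha> + \<beta>) = \<sigma> \<alpha> + \<sigma> \<beta>" and \<sigma>_0: "\<sigma> 0 = 0"
  by (simp_all add: \<sigma>_def algebra_simps)

lemma lookup_Y: "Poly_Mapping.lookup (Y F) m = \<sigma> (fst m) * Poly_Mapping.lookup F m"
proof -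
  define D :: "zpoly \<Rightarrow> zpoly" where "D = lin_ext (\<lambda>m x. Poly_Mapping.single m (\<sigma> (fst m) * x))"
  have D_single: "D (Poly_Mapping.single m x) = Poly_Mapping.single m (\<sigma> (fst m) * x)" for m x
    unfolding D_def by (subst lin_ext_single) auto
  have D_add: "Modules.additive D"
    unfolding D_def by (rule additive_lin_ext) (simp add: single_add algebra_simps)
  have D_der: "derivation D"
  proof (rule derivation_from_singles[OF D_add])
    show "D (const_zpoly c) = 0" for c by (simp add: const_zpoly_def D_single \<sigma>_0)
  qed (simp add: mult_single D_single \<sigma>_add algebra_simps flip: single_add)
  have Dv: "D var_z1 = const_zpoly a * var_z1" "D var_z2 = const_zpoly c * var_z2" "D var_zb1 = 0" "D var_zb2 = 0"
    by (simp_all add: var_defs D_single \<sigma>_def const_zpoly_mult_single)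
  have "Y var_zb1 = 0" "Y var_zb2 = 0" using Y_hol by (simp_all add: hol_derivation_def)
  then have "Y F = D F" for F
    using derivation_eqI[OF Y_der D_der, of F] by (simp_all add: Dv Y1 Y2)
  moreover have "Poly_Mapping.lookup (D F) m = \<sigma> (fst m) * Poly_Mapping.lookup F m"
    by (induction F rule: poly_mapping_additive_induct)
      (auto simp: D_single lookup_single when_def additive.add[OF D_add] lookup_add algebra_simps)
  ultimately show ?thesis by simp
qed

lemma \<sigma>_keys:
  assumes "m \<in> Poly_Mapping.keys P"
  shows "\<sigma> (fst m) + cnj (\<sigma> (snd m)) = 2 * of_real g"
proof -
  have P: "cnj (Poly_Mapping.lookup P (snd m, fst m)) = Poly_Mapping.lookup P m"
    using lookup_conj[of P m] by (simp add: conj_P)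
  have "(\<sigma> (fst m) + cnj (\<sigma> (snd m))) * Poly_Mapping.lookup P m = 2 * of_real g * Poly_Mapping.lookup P m"
    using arg_cong[OF Y_eq, of "\<lambda>F. Poly_Mapping.lookup F m"]
    unfolding lookup_add lookup_conj lookup_Y lookup_const_mult
    by (simp add: P distrib_right)
  then show ?thesis using assms by (simp add: in_keys_iff)
qed

text \<open>As P (Y P) is half of Y (P^2), the remainder arises from P^2 by a diagonal
  operator.\<close>

lemma lookup_remainder: "Poly_Mapping.lookup remainder m = (\<sigma> (fst m) / 2 - of_real g) * Poly_Mapping.lookup (P * P) m"
proof -
  have "Y (P * P) = const_zpoly 2 * (P * Y P)"
    by (simp add: derivation_mult[OF Y_der] algebra_simps)
  then have "remainder = const_zpoly (1/2) * Y (P * P) - const_zpoly (of_real g) * (P * P)"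
    by (simp add: remainder_def mult.assoc[symmetric] const_zpoly_mult[symmetric] del: const_zpoly_numeral)
       (simp add: algebra_simps)
  then show ?thesis
    by (simp only: lookup_Y lookup_minus lookup_const_mult) (simp add: algebra_simps)
qed

text \<open>The remainder has coefficient (\<sigma> - g) times a nonzero square at p + p, so this
  monomial occurs in \<open>Z P\<close> or its conjugate. The first inherits its antiholomorphic
  exponents from \<open>P\<close>, the second its holomorphic ones.\<close>

lemma vertex_partner:
  assumes "vertex_of (Poly_Mapping.keys P) p"
    and "\<sigma> (fst p) \<noteq> of_real g"
  shows "\<exists>m\<in>Poly_Mapping.keys P. snd m = snd p + snd p \<or> fst m = fst p + fst p"
proof -
  have v: "Poly_Mapping.lookup (P * P) (p + p) = (Poly_Mapping.lookup P p)\<^sup>2"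
    by (rule lookup_square_vertex[OF assms(1)])
  have "Poly_Mapping.lookup (const_zpoly (-2 * \<i>) * remainder) (p + p) \<noteq> 0"
    unfolding lookup_const_mult lookup_remainder v
    using assms by (simp add: in_keys_iff \<sigma>_add vertex_of_def)
  then have "p + p \<in> Poly_Mapping.keys (Z P) \<or> p + p \<in> Poly_Mapping.keys (conj_zpoly (Z P))"
    unfolding Z_eq'[symmetric] by (auto simp: in_keys_iff lookup_add)
  then show ?thesis
  proof
    assume "p + p \<in> Poly_Mapping.keys (Z P)"
    then show ?thesis by (metis keys_hol_derivation[OF Z_hol] snd_add)
  next
    assume "p + p \<in> Poly_Mapping.keys (conj_zpoly (Z P))"
    then show ?thesis by (metis keys_conj_Z fst_add)
  qed
qed

text \<open>At a vertex where \<open>s * Im \<sigma>\<close> is largest and positive, the partner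
  from \<open>vertex_partner\<close> would have twice that value: by \<open>\<sigma>_keys\<close>
  both exponents of a monomial have the same imaginary part of \<sigma>. The sign \<open>s\<close>
  treats positive and negative imaginary parts together.\<close>

lemma Im_\<sigma>_le:
  assumes s: "s = 1 \<or> s = -1" and m: "m \<in> Poly_Mapping.keys P"
  shows "s * Im (\<sigma> (fst m)) \<le> 0"
proof (rule ccontr)
  assume "\<not> s * Im (\<sigma> (fst m)) \<le> 0"
  then have pos: "s * Im (\<sigma> (fst m)) > 0" by simp
  \<comment> \<open>The zero functional is the second criterion: ties are not broken here.\<close>
  have "\<exists>p. vertex_of (Poly_Mapping.keys P) p \<and> (\<forall>m\<in>Poly_Mapping.keys P. s * Im (\<sigma> (fst m)) \<le> s * Im (\<sigma> (fst p))) \<and>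
      (\<forall>m\<in>Poly_Mapping.keys P. s * Im (\<sigma> (fst m)) = s * Im (\<sigma> (fst p)) \<longrightarrow> 0 \<le> (0::real))"
    using P_nonzero by (intro vertex_of_maximal) (simp_all add: \<sigma>_add distrib_left)
  then obtain p where p: "vertex_of (Poly_Mapping.keys P) p" "\<And>m. m \<in> Poly_Mapping.keys P \<Longrightarrow> s * Im (\<sigma> (fst m)) \<le> s * Im (\<sigma> (fst p))"
    by blast
  have p0: "p \<in> Poly_Mapping.keys P" using p(1) by (simp add: vertex_of_def)
  have pp: "s * Im (\<sigma> (fst p)) > 0" using p(2)[OF m] pos by linarith
  then have "\<sigma> (fst p) \<noteq> of_real g" by auto
  from vertex_partner[OF p(1) this]
  obtain n where n: "n \<in> Poly_Mapping.keys P" "snd n = snd p + snd p \<or> fst n = fst p + fst p" by blast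
  have "Im (\<sigma> (fst n)) = 2 * Im (\<sigma> (fst p))"
    using n(2) arg_cong[OF \<sigma>_keys[OF n(1)], of Im] arg_cong[OF \<sigma>_keys[OF p0], of Im] by (auto simp: \<sigma>_add)
  with p(2)[OF n(1)] pp show False by auto
qed

lemma Im_\<sigma>: "m \<in> Poly_Mapping.keys P \<Longrightarrow> Im (\<sigma> (fst m)) = 0"
  using Im_\<sigma>_le[of 1 m] Im_\<sigma>_le[of "-1" m] by simp

text \<open>If g = 0, the real parts of \<sigma> on the two exponents are opposite, and the doubling
  argument at a vertex excludes positive values. By the symmetry of \<open>P\<close> all eigenvalues
  vanish and Y P = 0. Then Z P is minus its conjugate, which the levels exclude unless Z P = 0, and
  nondegeneracy makes the whole field trivial.\<close>

lemma g_nonzero: "g \<noteq> 0"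
proof
  assume g: "g = 0"
  have le: "Re (\<sigma> (fst m)) \<le> 0" if m: "m \<in> Poly_Mapping.keys P" for m
  proof (rule ccontr)
    assume pos: "\<not> Re (\<sigma> (fst m)) \<le> 0"
    have "\<exists>p. vertex_of (Poly_Mapping.keys P) p \<and> (\<forall>m\<in>Poly_Mapping.keys P. Re (\<sigma> (fst m)) \<le> Re (\<sigma> (fst p))) \<and>
        (\<forall>m\<in>Poly_Mapping.keys P. Re (\<sigma> (fst m)) = Re (\<sigma> (fst p)) \<longrightarrow> 0 \<le> (0::real))"
      using P_nonzero by (intro vertex_of_maximal) (simp_all add: \<sigma>_add)
    then obtain p where p: "vertex_of (Poly_Mapping.keys P) p" "\<And>m. m \<in> Poly_Mapping.keys P \<Longrightarrow> Re (\<sigma> (fst m)) \<le> Re (\<sigma> (fst p))"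
      by blast
    have p0: "p \<in> Poly_Mapping.keys P" using p(1) by (simp add: vertex_of_def)
    have pp: "Re (\<sigma> (fst p)) > 0" using p(2)[OF m] pos by linarith
    then have "\<sigma> (fst p) \<noteq> of_real g" using g by auto
    from vertex_partner[OF p(1) this]
    obtain n where n: "n \<in> Poly_Mapping.keys P" "snd n = snd p + snd p \<or> fst n = fst p + fst p" by blast
    have "Re (\<sigma> (fst n)) = 2 * Re (\<sigma> (fst p))"
      using n(2) arg_cong[OF \<sigma>_keys[OF n(1)], of Re] arg_cong[OF \<sigma>_keys[OF p0], of Re] g by (auto simp: \<sigma>_add)
    with p(2)[OF n(1)] pp show False by auto
  qed
  have "Re (\<sigma> (fst m)) = 0" if m: "m \<in> Poly_Mapping.keys P" for m
    using le[OF m] le[OF swap_keys[OF m]] arg_cong[OF \<sigma>_keys[OF m], of Re] g by simp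
  with Im_\<sigma> have "\<sigma> (fst m) = 0" if "m \<in> Poly_Mapping.keys P" for m
    using that by (simp add: complex_eq_iff)
  then have "Y P = 0"
    by (intro poly_mapping_eqI) (auto simp: lookup_Y in_keys_iff)
  moreover have "Z P = 0"
  proof (rule ccontr)
    assume "Z P \<noteq> 0"
    then have "Poly_Mapping.keys (Z P) \<noteq> {}" by simp
    then obtain m where m: "m \<in> Poly_Mapping.keys (Z P)" by blast
    have "Z P + conj_zpoly (Z P) = 0" using Z_eq \<open>Y P = 0\<close> g by simp
    then have "conj_zpoly (Z P) = - Z P" by (simp add: add_eq_0_iff)
    then have "m \<in> Poly_Mapping.keys (conj_zpoly (Z P))" using m by (simp add: in_keys_iff)
    then show False using level_Z[OF m] level_conj_Z[of m] by simp
  qed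
  ultimately show False
    using nondegenerate[OF Y_hol] nondegenerate[OF Z_hol] nontrivial g by blast
qed

section \<open>The normalised grading of the diagonal case\<close>

definition "s \<alpha> = Re (\<sigma> \<alpha>) / g" for \<alpha> :: "nat \<times> nat"

lemma s_add: "s (\<alpha> + \<beta>) = s \<alpha> + s \<beta>"
  by (simp add: s_def \<sigma>_add add_divide_distrib)

lemma s_eq: "m \<in> Poly_Mapping.keys P \<Longrightarrow> s (fst m) + s (snd m) = 2"
  using arg_cong[OF \<sigma>_keys, of m Re] g_nonzero by (simp add: s_def field_simps)

lemma \<sigma>_eq_s: "m \<in> Poly_Mapping.keys P \<Longrightarrow> \<sigma> (fst m) = of_real (g * s (fst m))"
  using Im_\<sigma>[of m] g_nonzero by (simp add: s_def complex_eq_iff)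

text \<open>Consider a vertex with maximal s and, among those, minimal level. If s were at least 2
  there, a partner with doubled holomorphic exponent would exceed the maximum. A partner with
  doubled antiholomorphic exponent has s-value 2 s - 2, so it ties with the maximum while its level
  2 l - 1 is smaller than l.\<close>

lemma s_max_less_2:
  obtains p where "p \<in> Poly_Mapping.keys P" "\<And>m. m \<in> Poly_Mapping.keys P \<Longrightarrow> s (fst m) \<le> s (fst p)"
    "s (fst p) < 2"
proof -
  have "\<exists>p. vertex_of (Poly_Mapping.keys P) p \<and> (\<forall>m\<in>Poly_Mapping.keys P. s (fst m) \<le> s (fst p)) \<and>
      (\<forall>m\<in>Poly_Mapping.keys P. s (fst m) = s (fst p) \<longrightarrow> - level m \<le> - level p)"
    using P_nonzero by (intro vertex_of_maximal) (simp_all add: s_add weighted_length_add)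
  then obtain p where p: "vertex_of (Poly_Mapping.keys P) p" "\<And>m. m \<in> Poly_Mapping.keys P \<Longrightarrow> s (fst m) \<le> s (fst p)"
    "\<And>m. m \<in> Poly_Mapping.keys P \<Longrightarrow> s (fst m) = s (fst p) \<Longrightarrow> - level m \<le> - level p"
    by blast
  have p0: "p \<in> Poly_Mapping.keys P" using p(1) by (simp add: vertex_of_def)
  have "s (fst p) < 2"
  proof (rule ccontr)
    assume "\<not> s (fst p) < 2"
    then have ge: "s (fst p) \<ge> 2" by simp
    then have "\<sigma> (fst p) \<noteq> of_real g" using \<sigma>_eq_s[OF p0] g_nonzero by auto
    from vertex_partner[OF p(1) this]
    obtain n where n: "n \<in> Poly_Mapping.keys P" "snd n = snd p + snd p \<or> fst n = fst p + fst p" by blast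
    from n(2) show False
    proof
      assume "fst n = fst p + fst p"
      then show False using p(2)[OF n(1)] ge by (simp add: s_add)
    next
      assume e: "snd n = snd p + snd p"
      then have "s (fst n) = 2 * s (fst p) - 2" using s_eq[OF n(1)] s_eq[OF p0] by (simp add: s_add)
      with p(2)[OF n(1)] ge have "s (fst n) = s (fst p)" by simp
      from p(3)[OF n(1) this] have "level p \<le> level n" by simp
      moreover have "level n = 2 * level p - 1"
        using e level_colevel[OF n(1)] level_colevel[OF p0] by (simp add: weighted_length_add)
      ultimately show False using level_colevel[OF p0] colevel_pos[OF p0] by simp
    qed
  qed
  with p0 p(2) that show thesis by blast
qed

abbreviation part :: "real \<Rightarrow> zpoly" where "part x \<equiv> component (\<lambda>m. s (fst m)) x P"

lemma conj_part: "conj_zpoly (part x) = part (2 - x)"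
proof (rule poly_mapping_eqI)
  fix m
  have "Poly_Mapping.lookup P m = cnj (Poly_Mapping.lookup P (snd m, fst m))"
    using lookup_conj[of P m] by (simp add: conj_P)
  moreover have "Poly_Mapping.lookup P m \<noteq> 0 \<Longrightarrow> s (fst m) + s (snd m) = 2"
    using s_eq[of m] by (simp add: in_keys_iff)
  ultimately show "Poly_Mapping.lookup (conj_zpoly (part x)) m = Poly_Mapping.lookup (part (2 - x)) m"
    by (cases "Poly_Mapping.lookup P m = 0") (auto simp: lookup_conj lookup_component)
qed

lemma keys_PP:
  assumes "m \<in> Poly_Mapping.keys (P * P)"
  shows "s (fst m) + s (snd m) = 4" "\<sigma> (fst m) = of_real (g * s (fst m))"
proof -
  obtain k n where kn: "m = k + n" "k \<in> Poly_Mapping.keys P" "n \<in> Poly_Mapping.keys P"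
    using keys_mult[of P P] assms by blast
  show "s (fst m) + s (snd m) = 4" using s_eq[OF kn(2)] s_eq[OF kn(3)] by (simp add: kn(1) s_add)
  show "\<sigma> (fst m) = of_real (g * s (fst m))"
    using \<sigma>_eq_s[OF kn(2)] \<sigma>_eq_s[OF kn(3)] by (simp add: kn(1) s_add \<sigma>_add algebra_simps)
qed

text \<open>\<open>Z\<close> preserves antiholomorphic exponents, and the two s-values in P^2 add up
  to 4, so the part x of P is matched with the part x + 2 of P^2. The scalar is -2 i (\<sigma>/2 -
  g) with \<sigma> = g (x + 2).\<close>

lemma Z_part:
  assumes "x > 0"
  shows "Z (part x) = const_zpoly (- \<i> * of_real (g * x)) * component (\<lambda>m. s (fst m)) (x + 2) (P * P)"
proof -
  obtain p where p: "p \<in> Poly_Mapping.keys P" "\<And>m. m \<in> Poly_Mapping.keys P \<Longrightarrow> s (fst m) \<le> s (fst p)" "s (fst p) < 2"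
    using s_max_less_2 by metis
  have "part x = component (\<lambda>m. s (snd m)) (2 - x) P"
    using s_eq by (intro poly_mapping_eqI) (force simp: lookup_component in_keys_iff)
  moreover have "Z (component (\<lambda>m. s (snd m)) (2 - x) P) = component (\<lambda>m. s (snd m)) (2 - x) (Z P)"
    by (rule component_comp_linear[OF derivation_additive[OF Z_der], where f = id and \<phi> = "\<lambda>m. s (snd m)" and \<psi> = "\<lambda>m. s (snd m)", simplified, symmetric])
      (use keys_hol_derivation_single[OF Z_hol] in auto)
  ultimately have Zp: "Z (part x) = component (\<lambda>m. s (snd m)) (2 - x) (Z P)" by simp
  show ?thesis
  proof (rule poly_mapping_eqI)
    fix m
    have eq: "Poly_Mapping.lookup (Z P) m + Poly_Mapping.lookup (conj_zpoly (Z P)) m = -2 * \<i> * ((\<sigma> (fst m) / 2 - of_real g) * Poly_Mapping.lookup (P * P) m)"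
      using arg_cong[OF Z_eq', of "\<lambda>F. Poly_Mapping.lookup F m"] by (simp add: lookup_add lookup_remainder)
    have disj: "Poly_Mapping.lookup (Z P) m = 0 \<or> Poly_Mapping.lookup (conj_zpoly (Z P)) m = 0"
      using level_Z[of m] level_conj_Z[of m] by (force simp: in_keys_iff)
    have PP: "Poly_Mapping.lookup (P * P) m = 0 \<or> (s (fst m) + s (snd m) = 4 \<and> \<sigma> (fst m) = of_real (g * s (fst m)))"
      using keys_PP[of m] by (auto simp: in_keys_iff)
    \<comment> \<open>The conjugate of \<open>Z P\<close> has only holomorphic exponents of
      \<open>P\<close>, whose s-value is below 2, hence below x + 2.\<close>
    have conj: "Poly_Mapping.lookup (conj_zpoly (Z P)) m = 0" if "s (fst m) = x + 2"
    proof (rule ccontr)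
      assume "Poly_Mapping.lookup (conj_zpoly (Z P)) m \<noteq> 0"
      then have "m \<in> Poly_Mapping.keys (conj_zpoly (Z P))" by (simp add: in_keys_iff)
      then obtain n where "n \<in> Poly_Mapping.keys P" "fst m = fst n" by (metis keys_conj_Z)
      then show False using p(2)[of n] p(3) that assms by simp
    qed
    show "Poly_Mapping.lookup (Z (part x)) m = Poly_Mapping.lookup (const_zpoly (- \<i> * of_real (g * x)) * component (\<lambda>m. s (fst m)) (x + 2) (P * P)) m"
    proof (cases "s (snd m) = 2 - x \<and> s (fst m) = x + 2")
      case True
      with eq conj PP show ?thesis by (auto simp: Zp lookup_component algebra_simps add_eq_0_iff2)
    next
      case False
      \<comment> \<open>Off the matching degrees P^2 has no such monomial, so the coefficients of
        \<open>Z P\<close> and its conjugate cancel; as their supports are disjoint, both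
        vanish.\<close>
      then have "s (snd m) = 2 - x \<or> s (fst m) = x + 2 \<Longrightarrow> Poly_Mapping.lookup (P * P) m = 0" using PP by auto
      with False eq disj show ?thesis by (auto simp: Zp lookup_component)
    qed
  qed
qed

end

context diagonal_tangency
begin

text \<open>Let a > 1 be the largest value, Q the top part and e = 2 - a the smallest value. By
  \<open>Z_part\<close> and the Leibniz rule, Z^k sends the part a - k e to a nonzero multiple of
  Q^(k+1) and kills all higher parts. The last positive a - n e must equal e, whose part is cnj Q.
  So Z^n (cnj Q) is a nonzero multiple of Q^(n+1). The conjugate W of Z commutes with Z and kills
  cnj Q, because Z Q = 0; hence it kills Q^(n+1), and then Q itself. But W Q = 0 means Z (cnj Q) =
  0, a contradiction.\<close>

lemma s_le_1:
  assumes "m0 \<in> Poly_Mapping.keys P"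
  shows "s (fst m0) \<le> 1"
proof (rule ccontr)
  assume m0: "\<not> s (fst m0) \<le> 1"
  obtain p where p: "p \<in> Poly_Mapping.keys P" "\<And>m. m \<in> Poly_Mapping.keys P \<Longrightarrow> s (fst m) \<le> s (fst p)" "s (fst p) < 2"
    by (metis s_max_less_2)
  define a where "a = s (fst p)"
  define e where "e = 2 - a"
  have a: "a > 1" "a < 2" using p(2)[OF assms] m0 p(3) by (auto simp: a_def)
  then have e: "0 < e" "e < 1" by (auto simp: e_def)
  define Q where "Q = part a"
  have "Poly_Mapping.lookup Q p \<noteq> 0" using p(1) by (simp add: Q_def lookup_component a_def in_keys_iff)
  then have Q_nonzero: "Q \<noteq> 0" by auto
  have part_large: "part x = 0" if "x > a" for x
    by (rule component_eq_0) (use p(2) that in \<open>force simp: a_def\<close>)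
  have part_small: "part x = 0" if "x < e" for x
    using conj_part[of "2 - x"] part_large[of "2 - x"] that by (simp add: e_def conj_zero)
  define ak where "ak k = a - real k * e" for k
  have chain: "ak k > 0 \<longrightarrow> (\<exists>b>0. (Z ^^ k) (part (ak k)) = const_zpoly ((- \<i> * of_real g) ^ k * of_real b) * Q ^ Suc k) \<and>
      (\<forall>x>ak k. (Z ^^ k) (part x) = 0)" (is "?C k") for k
  proof (induction k rule: less_induct)
    case (less k)
    show ?case
    proof (cases k)
      case 0
      then show ?thesis using part_large by (auto simp: ak_def Q_def intro!: exI[of _ 1])
    next
      case (Suc j)
      show ?thesis
      proof
        assume pos: "ak k > 0"
        have ak_ge: "ak i \<ge> ak k" if "i \<le> j" for i
          using that e Suc by (auto simp: ak_def intro!: mult_right_mono)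
        have IH: "?C i" if "i \<le> j" for i using less.IH[of i] that Suc by simp
        have "\<forall>i\<in>{..j}. \<exists>b>0. (Z ^^ i) (part (ak i)) = const_zpoly ((- \<i> * of_real g) ^ i * of_real b) * Q ^ Suc i"
          using IH ak_ge pos by force
        then obtain b where b: "\<And>i. i \<le> j \<Longrightarrow> b i > 0"
          "\<And>i. i \<le> j \<Longrightarrow> (Z ^^ i) (part (ak i)) = const_zpoly ((- \<i> * of_real g) ^ i * of_real (b i)) * Q ^ Suc i"
          by (metis atMost_iff)
        have zero: "(Z ^^ i) (part x) = 0" if "i \<le> j" "x > ak i" for i x
          using IH[OF that(1)] ak_ge[OF that(1)] pos that(2) by auto
        \<comment> \<open>The values \<open>ak i\<close> are added to the degrees of
          \<open>P\<close>, so that each can be singled out as a summation index.\<close>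
        define I where "I = (\<lambda>m. s (fst m)) ` Poly_Mapping.keys P \<union> ak ` {..j}"
        define t where "t x y i = const_zpoly (of_nat (j choose i)) * ((Z ^^ i) (part y) * (Z ^^ (j - i)) (part (x + 2 - y)))" for x y i
        have finI: "finite I" by (simp add: I_def)
        have Z_pow_const: "(Z ^^ n) (const_zpoly c * F) = const_zpoly c * (Z ^^ n) F" for n c F
          by (induction n) (auto simp: derivation_const_mult[OF Z_der])
        have Z_pow_sum: "(Z ^^ n) (\<Sum>y\<in>I. f y) = (\<Sum>y\<in>I. (Z ^^ n) (f y))" for n and f :: "real \<Rightarrow> zpoly"
          by (induction n) (auto simp: derivation_sum[OF Z_der])
        have expand: "(Z ^^ k) (part x) = const_zpoly (- \<i> * of_real (g * x)) * (\<Sum>i\<le>j. \<Sum>y\<in>I. t x y i)" if "x > 0" for x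
        proof -
          have "(Z ^^ k) (part x) = (Z ^^ j) (Z (part x))" by (simp only: Suc funpow_Suc_right o_apply)
          also have "component (\<lambda>m. s (fst m)) (x + 2) (P * P) = (\<Sum>y\<in>I. part y * part (x + 2 - y))"
            by (rule component_mult) (auto simp: s_add finI I_def)
          then have "(Z ^^ j) (Z (part x)) = const_zpoly (- \<i> * of_real (g * x)) * (\<Sum>y\<in>I. (Z ^^ j) (part y * part (x + 2 - y)))"
            by (simp only: Z_part[OF that] Z_pow_const Z_pow_sum)
          also have "(\<Sum>y\<in>I. (Z ^^ j) (part y * part (x + 2 - y))) = (\<Sum>y\<in>I. \<Sum>i\<le>j. t x y i)"
            unfolding t_def by (intro sum.cong refl derivation_leibniz[OF Z_der])
          also have "\<dots> = (\<Sum>i\<le>j. \<Sum>y\<in>I. t x y i)" by (rule sum.swap)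
          finally show ?thesis .
        qed
        \<comment> \<open>With k = j + 1 and a + e = 2, the threshold degrees of the two Leibniz
          factors add up exactly to the degree required by \<open>Z_part\<close>. Above the
          threshold one factor vanishes; at it a single pair of parts survives for each i.\<close>
        have ak_add: "ak i + ak (j - i) = ak k + 2" if "i \<le> j" for i
          using that by (simp add: ak_def Suc e_def of_nat_diff algebra_simps)
        have t_zero: "t x y i = 0" if "i \<le> j" "y > ak i \<or> x + 2 - y > ak (j - i)" for x y i
          using that(2) zero[OF that(1)] zero[of "j - i"] unfolding t_def by auto
        have large: "(Z ^^ k) (part x) = 0" if "x > ak k" for x
        proof -
          have "t x y i = 0" if "i \<le> j" for y i
            using ak_add[OF that] t_zero[OF that, of y x] \<open>x > ak k\<close> by linarith
          then show ?thesis using expand[of x] that pos by simp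
        qed
        define S where "S = (\<Sum>i\<le>j. real (j choose i) * b i * b (j - i))"
        \<comment> \<open>All contributions have the same phase and positive size, so they cannot
          cancel.\<close>
        have "S > 0" unfolding S_def by (intro sum_pos) (auto intro!: mult_pos_pos b)
        have "(\<Sum>y\<in>I. t (ak k) y i) = const_zpoly ((- \<i> * of_real g) ^ j * of_real (real (j choose i) * b i * b (j - i))) * Q ^ Suc k"
          if i: "i \<le> j" for i
        proof -
          have "t (ak k) y i = 0" if "y \<noteq> ak i" for y
            using ak_add[OF i] t_zero[OF i, of y "ak k"] that by linarith
          then have "(\<Sum>y\<in>I. t (ak k) y i) = (\<Sum>y\<in>{ak i}. t (ak k) y i)"
            by (intro sum.mono_neutral_right) (use finI i in \<open>auto simp: I_def\<close>)
          also have "\<dots> = const_zpoly (of_nat (j choose i)) * ((Z ^^ i) (part (ak i)) * (Z ^^ (j - i)) (part (ak (j - i))))"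
          proof -
            have "ak k + 2 - ak i = ak (j - i)" using ak_add[OF i] by simp
            then show ?thesis by (simp add: t_def)
          qed
          also have "\<dots> = const_zpoly (of_nat (j choose i)) * ((const_zpoly ((- \<i> * of_real g) ^ i * of_real (b i)) * Q ^ Suc i) *
               (const_zpoly ((- \<i> * of_real g) ^ (j - i) * of_real (b (j - i))) * Q ^ Suc (j - i)))"
            using b(2)[OF i] b(2)[of "j - i"] by simp
          also have "\<dots> = const_zpoly (of_nat (j choose i) * (((- \<i> * of_real g) ^ i * (- \<i> * of_real g) ^ (j - i)) * (of_real (b i) * of_real (b (j - i))))) *
              (Q ^ Suc i * Q ^ Suc (j - i))"
            by (simp only: const_zpoly_mult ac_simps)
          also have "Q ^ Suc i * Q ^ Suc (j - i) = Q ^ Suc k"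
            using i by (simp add: Suc power_add[symmetric] del: power_Suc)
          also have "(- \<i> * complex_of_real g) ^ i * (- \<i> * of_real g) ^ (j - i) = (- \<i> * of_real g) ^ j" using i by (simp flip: power_add)
          finally show ?thesis by (simp add: mult_ac)
        qed
        then have "(\<Sum>i\<le>j. \<Sum>y\<in>I. t (ak k) y i) = (\<Sum>i\<le>j. const_zpoly ((- \<i> * of_real g) ^ j * of_real (real (j choose i) * b i * b (j - i))) * Q ^ Suc k)"
          by (intro sum.cong) auto
        also have "\<dots> = const_zpoly ((- \<i> * of_real g) ^ j * of_real S) * Q ^ Suc k"
        proof -
          have cs: "const_zpoly (sum f A) = (\<Sum>i\<in>A. const_zpoly (f i))" for f and A :: "nat set"
            by (induction A rule: infinite_finite_induct) (auto simp: const_zpoly_add)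
          show ?thesis unfolding S_def of_real_sum sum_distrib_left cs sum_distrib_right ..
        qed
        finally have "(Z ^^ k) (part (ak k)) = const_zpoly (- \<i> * of_real (g * ak k)) * (const_zpoly ((- \<i> * of_real g) ^ j * of_real S) * Q ^ Suc k)"
          using expand[OF pos] by simp
        also have "\<dots> = const_zpoly ((- \<i> * of_real g) ^ k * of_real (ak k * S)) * Q ^ Suc k"
          by (simp add: Suc const_zpoly_mult[symmetric] mult.assoc[symmetric] del: power_Suc) (simp add: mult_ac)
        finally have "\<exists>b>0. (Z ^^ k) (part (ak k)) = const_zpoly ((- \<i> * of_real g) ^ k * of_real b) * Q ^ Suc k"
          using \<open>S > 0\<close> pos by (intro exI[of _ "ak k * S"]) simp
        with large show "(\<exists>b>0. (Z ^^ k) (part (ak k)) = const_zpoly ((- \<i> * of_real g) ^ k * of_real b) * Q ^ Suc k) \<and>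
          (\<forall>x>ak k. (Z ^^ k) (part x) = 0)" by blast
      qed
    qed
  qed
  have "\<exists>n. ak (Suc n) \<le> 0"
  proof -
    obtain n where "a < real n * e" using ex_less_of_nat_mult[OF e(1)] by blast
    then show ?thesis using e by (intro exI[of _ n]) (simp add: ak_def algebra_simps)
  qed
  \<comment> \<open>The last index with positive threshold. Since the part there is nonzero,
    \<open>ak n\<close> is at least e, and since the next threshold is not positive, it is at most
    e.\<close>
  define n where "n = (LEAST n. ak (Suc n) \<le> 0)"
  have n1: "ak (Suc n) \<le> 0" unfolding n_def using \<open>\<exists>n. ak (Suc n) \<le> 0\<close> by (rule LeastI_ex)
  have n2: "ak n > 0"
  proof (cases n)
    case 0
    then show ?thesis using a by (simp add: ak_def)
  next
    case (Suc n')
    then show ?thesis using not_less_Least[of n' "\<lambda>n. ak (Suc n) \<le> 0"] n_def by simp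
  qed
  obtain b where b: "b > 0" "(Z ^^ n) (part (ak n)) = const_zpoly ((- \<i> * of_real g) ^ n * of_real b) * Q ^ Suc n"
    using chain[of n] n2 by blast
  have Q_pow: "Q ^ Suc n \<noteq> 0" using Q_nonzero zpoly_reduced by blast
  have nz: "(Z ^^ n) (part (ak n)) \<noteq> 0"
    using const_mult_eq_0D[of "(- \<i> * of_real g) ^ n * of_real b" "Q ^ Suc n"] b Q_pow g_nonzero by auto
  have Z_pow_0: "(Z ^^ k) 0 = 0" for k by (induction k) (auto simp: derivation_zero[OF Z_der])
  have "part (ak n) \<noteq> 0" using nz Z_pow_0 by metis
  then have "ak n \<ge> e" using part_small[of "ak n"] by linarith
  moreover have "ak n \<le> e" using n1 by (simp add: ak_def algebra_simps)
  ultimately have "ak n = e" by simp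
  then have part_n: "part (ak n) = conj_zpoly Q" unfolding Q_def conj_part by (simp add: e_def)
  have "n \<noteq> 0" using \<open>ak n = e\<close> a e by (cases n) (auto simp: ak_def)
  define W where "W = conj_derivation Z"
  have W_der: "derivation W" unfolding W_def by (rule derivation_conj_derivation[OF Z_der])
  have WZ: "W (Z F) = Z (W F)" for F unfolding W_def by (rule conj_derivation_commute[OF Z_hol Z_hol])
  have "Z Q = 0" using chain[of 1] Z_part[of a] component_eq_0[of "P * P" "\<lambda>m. s (fst m)" "a + 2"] a
  proof -
    have "s (fst m) \<noteq> a + 2" if m: "m \<in> Poly_Mapping.keys (P * P)" for m
    proof -
      obtain k l where kl: "m = k + l" "k \<in> Poly_Mapping.keys P" "l \<in> Poly_Mapping.keys P"
        using keys_mult[of P P] m by blast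
      have "s (fst m) \<le> 2 * a" using p(2)[OF kl(2)] p(2)[OF kl(3)] by (simp add: kl(1) s_add a_def)
      then show ?thesis using a by simp
    qed
    then have "component (\<lambda>m. s (fst m)) (a + 2) (P * P) = 0" by (rule component_eq_0)
    then show ?thesis using Z_part[of a] a by (simp add: Q_def)
  qed
  have "W (conj_zpoly Q) = 0" by (simp add: W_def conj_derivation_def \<open>Z Q = 0\<close> conj_zero)
  then have "W ((Z ^^ k) (conj_zpoly Q)) = 0" for k
    by (induction k) (auto simp: WZ derivation_zero[OF Z_der])
  then have "W (const_zpoly ((- \<i> * of_real g) ^ n * of_real b) * Q ^ Suc n) = 0"
    using b(2) part_n by metis
  then have "const_zpoly ((- \<i> * of_real g) ^ n * of_real b) * (const_zpoly (of_nat (Suc n)) * (Q ^ n * W Q)) = 0"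
    by (simp only: derivation_const_mult[OF W_der] derivation_power[OF W_der] mult.assoc)
  then have "const_zpoly (of_nat (Suc n)) * (Q ^ n * W Q) = 0"
    by (rule const_mult_eq_0D) (use b g_nonzero in auto)
  then have QW: "Q ^ n * W Q = 0" by (rule const_mult_eq_0D) (simp del: of_nat_Suc)
  \<comment> \<open>The factor Q^n is removed by means of reducedness: a suitable power of the
    desired element is already 0. The same device yields W Q = 0 below.\<close>
  have "Q * W Q = 0"
  proof (rule zpoly_reduced)
    have "(Q * W Q) ^ Suc n = Q * (Q ^ n * W Q) * (W Q) ^ n" by (simp add: power_mult_distrib mult_ac)
    then show "(Q * W Q) ^ Suc n = 0" by (simp add: QW)
  qed
  then have "W (Q * W Q) = 0" by (simp add: derivation_zero[OF W_der])
  then have "W Q * W Q + Q * W (W Q) = 0" by (simp add: derivation_mult[OF W_der])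
  then have "W Q * (W Q * W Q + Q * W (W Q)) = 0" by simp
  then have "W Q * (W Q * W Q) + (Q * W Q) * W (W Q) = 0" by (simp add: algebra_simps)
  then have "(W Q) ^ 3 = 0" by (simp add: \<open>Q * W Q = 0\<close> power3_eq_cube mult.assoc)
  then have "W Q = 0" by (rule zpoly_reduced)
  then have "Z (conj_zpoly Q) = 0"
    using conj_conj[of "Z (conj_zpoly Q)"] by (simp add: W_def conj_derivation_def conj_zero)
  then have "(Z ^^ n) (conj_zpoly Q) = 0"
    using \<open>n \<noteq> 0\<close> by (cases n) (simp_all only: funpow_Suc_right o_apply Z_pow_0)
  then show False using nz part_n by simp
qed

text \<open>The bound \<open>s_le_1\<close> applies to a monomial and to its conjugate, and the two
  values add up to 2, so both are 1. The required weight is the real part of the eigenvalues of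
  \<open>Y\<close>, divided by \<open>g\<close>.\<close>

lemma balanced_P: "balanced P"
proof -
  have s1: "s (fst m) = 1" if m: "m \<in> Poly_Mapping.keys P" for m
    using s_le_1[OF m] s_le_1[OF swap_keys[OF m]] s_eq[OF m] by simp
  have s2: "s (snd m) = 1" if m: "m \<in> Poly_Mapping.keys P" for m
    using s1[OF m] s_eq[OF m] by simp
  define \<Lambda> where "\<Lambda> = (Re a / g, Re c / g)"
  have len: "weighted_length \<Lambda> \<alpha> = s \<alpha>" for \<alpha>
    by (simp add: weighted_length_def s_def \<sigma>_def \<Lambda>_def add_divide_distrib)
  obtain m where m: "m \<in> Poly_Mapping.keys P" using P_nonzero keys_eq_empty by blast
  have "\<Lambda> \<noteq> (0, 0)" using s1[OF m] len[of "fst m"] by (auto simp: weighted_length_def)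
  then show ?thesis unfolding balanced_def using s1 s2 len by (intro exI[of _ \<Lambda>]) auto
qed

end

subsection \<open>Weighted homogeneous coordinate changes\<close>

text \<open>The pull-back of a polynomial under z -> (G1, G2): the conjugate variables are replaced
  by the conjugates of \<open>G1\<close> and \<open>G2\<close>.\<close>

definition subst_zpoly :: "zpoly \<Rightarrow> zpoly \<Rightarrow> zpoly \<Rightarrow> zpoly" where
  "subst_zpoly G1 G2 = lin_ext (\<lambda>m c. const_zpoly c * G1 ^ fst (fst m) * G2 ^ snd (fst m)
     * conj_zpoly (G1 ^ fst (snd m) * G2 ^ snd (snd m)))"

lemma additive_subst: "Modules.additive (subst_zpoly G1 G2)"
  unfolding subst_zpoly_def by (rule additive_lin_ext) (simp add: const_zpoly_add algebra_simps)

lemmas subst_add = additive.add[OF additive_subst]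
  and subst_diff = additive.diff[OF additive_subst]
  and subst_minus = additive.minus[OF additive_subst]
  and subst_zero = additive.zero[OF additive_subst]

lemma subst_single: "subst_zpoly G1 G2 (Poly_Mapping.single m c) =
  const_zpoly c * G1 ^ fst (fst m) * G2 ^ snd (fst m) * conj_zpoly (G1 ^ fst (snd m) * G2 ^ snd (snd m))"
  unfolding subst_zpoly_def by (subst lin_ext_single) auto

lemma subst_mult: "subst_zpoly G1 G2 (F * H) = subst_zpoly G1 G2 F * subst_zpoly G1 G2 H"
  unfolding subst_zpoly_def
  by (rule lin_ext_mult) (auto simp: const_zpoly_add const_zpoly_mult power_add conj_mult algebra_simps)

lemma subst_const: "subst_zpoly G1 G2 (const_zpoly c) = const_zpoly c"
  by (simp add: const_zpoly_def[of c] subst_single)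

lemma subst_1: "subst_zpoly G1 G2 1 = 1"
  using subst_const[of G1 G2 1] by simp

lemma subst_power: "subst_zpoly G1 G2 (F ^ n) = subst_zpoly G1 G2 F ^ n"
  by (induction n) (auto simp: subst_mult subst_1)

lemma subst_vars:
  "subst_zpoly G1 G2 var_z1 = G1" "subst_zpoly G1 G2 var_z2 = G2"
  "subst_zpoly G1 G2 var_zb1 = conj_zpoly G1" "subst_zpoly G1 G2 var_zb2 = conj_zpoly G2"
  by (simp_all add: var_defs subst_single)

lemmas subst_simps = subst_add subst_diff subst_minus subst_zero subst_mult subst_const subst_1 subst_power subst_vars

lemma subst_conj: "subst_zpoly G1 G2 (conj_zpoly F) = conj_zpoly (subst_zpoly G1 G2 F)"
  by (induction F rule: zpoly_induct) (simp_all add: subst_simps conj_simps)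

lemma subst_subst: "subst_zpoly H1 H2 (subst_zpoly G1 G2 F) = subst_zpoly (subst_zpoly H1 H2 G1) (subst_zpoly H1 H2 G2) F"
  by (induction F rule: zpoly_induct) (simp_all add: subst_simps subst_conj)

lemma subst_id: "subst_zpoly var_z1 var_z2 F = F"
  by (induction F rule: zpoly_induct) (simp_all add: subst_simps conj_simps)

lemma zpoly_eval_subst:
  "zpoly_eval (subst_zpoly G1 G2 F) z1 z2 = zpoly_eval F (zpoly_eval G1 z1 z2) (zpoly_eval G2 z1 z2)"
  by (induction F rule: zpoly_induct) (simp_all add: subst_simps zpoly_eval_simps zpoly_eval_vars zpoly_eval_conj)

text \<open>Holomorphic polynomials that are weighted homogeneous of weight
  \<open>\<rho>\<close>.\<close>

definition hol_weight :: "real \<times> real \<Rightarrow> real \<Rightarrow> zpoly \<Rightarrow> bool" where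
  "hol_weight \<mu> \<rho> F \<longleftrightarrow> (\<forall>m\<in>Poly_Mapping.keys F. snd m = 0 \<and> weighted_length \<mu> (fst m) = \<rho>)"

lemma hol_weight_mult:
  assumes "hol_weight \<mu> \<rho> F" "hol_weight \<mu> \<rho>' G"
  shows "hol_weight \<mu> (\<rho> + \<rho>') (F * G)"
  unfolding hol_weight_def
proof
  fix m assume m: "m \<in> Poly_Mapping.keys (F * G)"
  obtain k l where kl: "m = k + l" "k \<in> Poly_Mapping.keys F" "l \<in> Poly_Mapping.keys G"
    using keys_mult[of F G] m by blast
  show "snd m = 0 \<and> weighted_length \<mu> (fst m) = \<rho> + \<rho>'"
    using assms kl by (auto simp: hol_weight_def weighted_length_add)
qed

lemma hol_weight_const: "hol_weight \<mu> 0 (const_zpoly c)"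
  by (auto simp: hol_weight_def const_zpoly_def)

lemma hol_weight_power: "hol_weight \<mu> \<rho> F \<Longrightarrow> hol_weight \<mu> (real n * \<rho>) (F ^ n)"
proof (induction n)
  case 0
  then show ?case using hol_weight_const[of \<mu> 1] by simp
next
  case (Suc n)
  from hol_weight_mult[OF Suc.prems Suc.IH[OF Suc.prems]] show ?case by (simp add: algebra_simps)
qed

lemma hol_weight_add: "hol_weight \<mu> \<rho> F \<Longrightarrow> hol_weight \<mu> \<rho> G \<Longrightarrow> hol_weight \<mu> \<rho> (F + G)"
  using Poly_Mapping.keys_add[of F G] unfolding hol_weight_def by blast

lemma hol_weight_const_mult: "hol_weight \<mu> \<rho> F \<Longrightarrow> hol_weight \<mu> \<rho> (const_zpoly c * F)"
  using hol_weight_mult[OF hol_weight_const] by simp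

lemma hol_weight_var: "hol_weight \<mu> (fst \<mu>) var_z1" "hol_weight \<mu> (snd \<mu>) var_z2"
  by (simp_all add: hol_weight_def var_defs weighted_length_def zero_prod_def)

lemma keys_subst_single:
  assumes "hol_weight \<mu> (fst \<mu>) G1" "hol_weight \<mu> (snd \<mu>) G2"
    and n: "n \<in> Poly_Mapping.keys (subst_zpoly G1 G2 (Poly_Mapping.single m c))"
  shows "weighted_length \<mu> (fst n) = weighted_length \<mu> (fst m)" "weighted_length \<mu> (snd n) = weighted_length \<mu> (snd m)"
proof -
  have *: "hol_weight \<mu> (weighted_length \<mu> \<alpha>) (G1 ^ fst \<alpha> * G2 ^ snd \<alpha>)" for \<alpha>
    using hol_weight_mult[OF hol_weight_power[OF assms(1), of "fst \<alpha>"] hol_weight_power[OF assms(2), of "snd \<alpha>"]]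
    by (simp add: weighted_length_def mult.commute)
  have 1: "hol_weight \<mu> (weighted_length \<mu> (fst m)) (const_zpoly c * G1 ^ fst (fst m) * G2 ^ snd (fst m))"
    unfolding mult.assoc by (rule hol_weight_const_mult[OF *])
  obtain k l where kl: "n = k + l" "k \<in> Poly_Mapping.keys (const_zpoly c * G1 ^ fst (fst m) * G2 ^ snd (fst m))"
      "l \<in> Poly_Mapping.keys (conj_zpoly (G1 ^ fst (snd m) * G2 ^ snd (snd m)))"
    using n keys_mult unfolding subst_single by blast
  have "(snd l, fst l) \<in> Poly_Mapping.keys (G1 ^ fst (snd m) * G2 ^ snd (snd m))"
    using kl(3) by (simp add: in_keys_iff lookup_conj)
  with *[of "snd m"] have "fst l = 0" "weighted_length \<mu> (snd l) = weighted_length \<mu> (snd m)"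
    unfolding hol_weight_def by (metis fst_conv snd_conv)+
  moreover have "snd k = 0" "weighted_length \<mu> (fst k) = weighted_length \<mu> (fst m)"
    using 1 kl(2) unfolding hol_weight_def by blast+
  ultimately show "weighted_length \<mu> (fst n) = weighted_length \<mu> (fst m)" "weighted_length \<mu> (snd n) = weighted_length \<mu> (snd m)"
    by (simp_all add: kl(1))
qed

lemma keys_subst:
  assumes "hol_weight \<mu> (fst \<mu>) G1" "hol_weight \<mu> (snd \<mu>) G2"
    and n: "n \<in> Poly_Mapping.keys (subst_zpoly G1 G2 F)"
  shows "\<exists>m\<in>Poly_Mapping.keys F. weighted_length \<mu> (fst n) = weighted_length \<mu> (fst m) \<and>
    weighted_length \<mu> (snd n) = weighted_length \<mu> (snd m)"
  using keys_additive[OF additive_subst n] keys_subst_single[OF assms(1,2)] by metis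

text \<open>\<open>(G1, G2)\<close> gives the new coordinates in terms of the old and
  \<open>(H1, H2)\<close> the old in terms of the new. A model \<open>P\<close> becomes
  \<open>subst_zpoly H1 H2 P\<close>, and the components have the weights of the coordinates they
  replace.\<close>

definition coordinate_change :: "real \<times> real \<Rightarrow> zpoly \<Rightarrow> zpoly \<Rightarrow> zpoly \<Rightarrow> zpoly \<Rightarrow> bool" where
  "coordinate_change \<mu> G1 G2 H1 H2 \<longleftrightarrow>
     hol_weight \<mu> (fst \<mu>) G1 \<and> hol_weight \<mu> (snd \<mu>) G2 \<and> hol_weight \<mu> (fst \<mu>) H1 \<and> hol_weight \<mu> (snd \<mu>) H2 \<and>
     subst_zpoly G1 G2 H1 = var_z1 \<and> subst_zpoly G1 G2 H2 = var_z2 \<and>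
     subst_zpoly H1 H2 G1 = var_z1 \<and> subst_zpoly H1 H2 G2 = var_z2"

lemma coordinate_change_sym: "coordinate_change \<mu> G1 G2 H1 H2 \<Longrightarrow> coordinate_change \<mu> H1 H2 G1 G2"
  by (auto simp: coordinate_change_def)

lemma coordinate_change_inverse: "coordinate_change \<mu> G1 G2 H1 H2 \<Longrightarrow> subst_zpoly G1 G2 (subst_zpoly H1 H2 F) = F"
  by (simp add: coordinate_change_def subst_subst subst_id)

text \<open>The push-forward of the vector field \<open>\<delta>\<close> to the new
  coordinates.\<close>

definition conjugate_derivation :: "zpoly \<Rightarrow> zpoly \<Rightarrow> zpoly \<Rightarrow> zpoly \<Rightarrow> (zpoly \<Rightarrow> zpoly) \<Rightarrow> zpoly \<Rightarrow> zpoly" where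
  "conjugate_derivation G1 G2 H1 H2 \<delta> F = subst_zpoly H1 H2 (\<delta> (subst_zpoly G1 G2 F))"

lemma weighted_length_eq_0_iff: "fst \<mu> > 0 \<Longrightarrow> snd \<mu> > 0 \<Longrightarrow> weighted_length \<mu> \<alpha> = 0 \<longleftrightarrow> \<alpha> = 0"
proof
  assume "fst \<mu> > 0" "snd \<mu> > 0" "weighted_length \<mu> \<alpha> = 0"
  then have "fst \<mu> * real (fst \<alpha>) = 0" "snd \<mu> * real (snd \<alpha>) = 0"
    unfolding weighted_length_def by (smt (verit) mult_nonneg_nonneg of_nat_0_le_iff)+
  with \<open>fst \<mu> > 0\<close> \<open>snd \<mu> > 0\<close> show "\<alpha> = 0" by (cases \<alpha>) (simp add: zero_prod_def)
qed simp

lemma hol_derivation_conjugate: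
  assumes "coordinate_change \<mu> G1 G2 H1 H2" "hol_derivation \<delta>" "fst \<mu> > 0" "snd \<mu> > 0"
  shows "hol_derivation (conjugate_derivation G1 G2 H1 H2 \<delta>)"
proof -
  note d = hol_derivation_D[OF assms(2)]
  note cc = assms(1)[unfolded coordinate_change_def]
  have hol: "holomorphic_zpoly G1" "holomorphic_zpoly G2"
    using cc by (auto simp: hol_weight_def holomorphic_zpoly_def)
  have "derivation (conjugate_derivation G1 G2 H1 H2 \<delta>)"
    unfolding conjugate_derivation_def[abs_def]
    by (rule derivationI)
      (simp_all add: subst_add subst_mult subst_const subst_zero derivation_add[OF d] derivation_mult[OF d] derivation_const[OF d]
         coordinate_change_inverse[OF coordinate_change_sym[OF assms(1)]])
  moreover have "holomorphic_zpoly (subst_zpoly H1 H2 F)" if "holomorphic_zpoly F" for F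
    unfolding holomorphic_zpoly_def
  proof
    fix n assume "n \<in> Poly_Mapping.keys (subst_zpoly H1 H2 F)"
    from keys_subst[OF _ _ this, of \<mu>] cc obtain m where "m \<in> Poly_Mapping.keys F" "weighted_length \<mu> (snd n) = weighted_length \<mu> (snd m)"
      by blast
    then show "snd n = 0" using that assms(3,4) by (simp add: holomorphic_zpoly_def flip: weighted_length_eq_0_iff)
  qed
  ultimately show ?thesis
    by (simp add: hol_derivation_def conjugate_derivation_def subst_vars hol holomorphic_zpoly_derivation[OF assms(2)]
        hol_derivation_conj_holomorphic[OF assms(2)] subst_zero)
qed

lemma graded_derivation_conjugate:
  assumes cc: "coordinate_change \<mu> G1 G2 H1 H2" and \<delta>: "graded_derivation \<mu> \<rho> \<delta>" and pos: "fst \<mu> > 0" "snd \<mu> > 0"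
  shows "graded_derivation \<mu> \<rho> (conjugate_derivation G1 G2 H1 H2 \<delta>)"
proof -
  have *: "weighted_length \<mu> (fst n) = x + \<rho>" if n: "n \<in> Poly_Mapping.keys (subst_zpoly H1 H2 (\<delta> G))" and G: "hol_weight \<mu> x G" for n G x
  proof -
    obtain m where m: "m \<in> Poly_Mapping.keys (\<delta> G)" "weighted_length \<mu> (fst n) = weighted_length \<mu> (fst m)"
      using keys_subst[OF _ _ n, of \<mu>] cc by (auto simp: coordinate_change_def)
    obtain k where "k \<in> Poly_Mapping.keys G" "weighted_length \<mu> (fst m) = weighted_length \<mu> (fst k) + \<rho>"
      using keys_graded_derivation[OF \<delta> m(1)] by metis
    with m(2) G show ?thesis by (simp add: hol_weight_def)
  qed
  show ?thesis
    using hol_derivation_conjugate[OF cc graded_derivation_D[OF \<delta>] pos] cc *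
    unfolding graded_derivation_def conjugate_derivation_def subst_vars coordinate_change_def by blast
qed

text \<open>Substitution by the inverse change is a ring isomorphism compatible with conjugation and
  weights, so every equation is transported. The nondegeneracy and nontriviality conditions are
  obtained by transporting derivations back.\<close>

lemma (in tangency) tangency_subst:
  assumes cc: "coordinate_change \<mu> G1 G2 H1 H2"
  shows "tangency \<mu> (subst_zpoly H1 H2 P) (conjugate_derivation G1 G2 H1 H2 Y) (conjugate_derivation G1 G2 H1 H2 Z) g"
proof
  note inv = coordinate_change_inverse[OF cc] coordinate_change_inverse[OF coordinate_change_sym[OF cc]]
  have Hw: "hol_weight \<mu> (fst \<mu>) H1" "hol_weight \<mu> (snd \<mu>) H2" using cc by (simp_all add: coordinate_change_def)
  show "fst \<mu> > 0" "snd \<mu> > 0" by (fact weights_pos)+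
  show "conj_zpoly (subst_zpoly H1 H2 P) = subst_zpoly H1 H2 P"
    using subst_conj[of H1 H2 P] conj_P by simp
  have keys: "weighted_length \<mu> (fst n) + weighted_length \<mu> (snd n) = 1 \<and> fst n \<noteq> 0 \<and> snd n \<noteq> 0"
    if n: "n \<in> Poly_Mapping.keys (subst_zpoly H1 H2 P)" for n
  proof -
    obtain m where "m \<in> Poly_Mapping.keys P" "level n = level m" "colevel n = colevel m"
      using keys_subst[OF Hw n] by blast
    then show ?thesis using level_colevel[of m] level_pos[of m] colevel_pos[of m] by auto
  qed
  show "weighted_homogeneous \<mu> (subst_zpoly H1 H2 P)"
    using keys unfolding weighted_homogeneous_def by force
  show "no_pluriharmonic_terms (subst_zpoly H1 H2 P)"
    using keys unfolding no_pluriharmonic_terms_def zero_prod_def by force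
  show "graded_derivation \<mu> 0 (conjugate_derivation G1 G2 H1 H2 Y)" "graded_derivation \<mu> 1 (conjugate_derivation G1 G2 H1 H2 Z)"
    by (rule graded_derivation_conjugate[OF cc _ weights_pos], fact Y_graded Z_graded)+
  show "conjugate_derivation G1 G2 H1 H2 Y (subst_zpoly H1 H2 P) + conj_zpoly (conjugate_derivation G1 G2 H1 H2 Y (subst_zpoly H1 H2 P)) =
      const_zpoly (2 * of_real g) * subst_zpoly H1 H2 P"
    using arg_cong[OF Y_eq, of "subst_zpoly H1 H2"]
    by (simp only: conjugate_derivation_def inv subst_add subst_mult subst_const subst_conj)
  show "conjugate_derivation G1 G2 H1 H2 Z (subst_zpoly H1 H2 P) + conj_zpoly (conjugate_derivation G1 G2 H1 H2 Z (subst_zpoly H1 H2 P)) =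
      const_zpoly (-2 * \<i>) * (subst_zpoly H1 H2 P * (conjugate_derivation G1 G2 H1 H2 Y (subst_zpoly H1 H2 P) - const_zpoly (of_real g) * subst_zpoly H1 H2 P))"
    using arg_cong[OF Z_eq, of "subst_zpoly H1 H2"]
    by (simp only: conjugate_derivation_def inv subst_add subst_diff subst_mult subst_const subst_conj)
  have zero: "derivation (\<lambda>_. 0)" by (rule derivationI) auto
  show "\<delta> var_z1 = 0 \<and> \<delta> var_z2 = 0" if \<delta>: "hol_derivation \<delta>" "\<delta> (subst_zpoly H1 H2 P) = 0" for \<delta>
  proof -
    define \<epsilon> where "\<epsilon> = conjugate_derivation H1 H2 G1 G2 \<delta>"
    have hol: "hol_derivation \<epsilon>"
      unfolding \<epsilon>_def by (rule hol_derivation_conjugate[OF coordinate_change_sym[OF cc] \<delta>(1) weights_pos])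
    have "\<epsilon> P = 0" by (simp add: \<epsilon>_def conjugate_derivation_def \<delta>(2) subst_zero)
    from nondegenerate[OF hol this] have "\<epsilon> F = 0" for F
      using derivation_eqI[OF hol_derivation_D[OF hol] zero, of F] hol by (simp add: hol_derivation_def)
    then have "subst_zpoly H1 H2 (\<epsilon> F) = 0" for F by (simp add: subst_zero)
    then have "\<delta> (subst_zpoly H1 H2 F) = 0" for F by (simp add: \<epsilon>_def conjugate_derivation_def inv)
    from this[of G1] this[of G2] show ?thesis using cc by (simp add: coordinate_change_def)
  qed
  have triv: "\<delta> var_z1 = 0 \<and> \<delta> var_z2 = 0"
    if \<delta>: "hol_derivation \<delta>" "conjugate_derivation G1 G2 H1 H2 \<delta> var_z1 = 0" "conjugate_derivation G1 G2 H1 H2 \<delta> var_z2 = 0" for \<delta>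
  proof -
    note hol = hol_derivation_conjugate[OF cc \<delta>(1) weights_pos]
    have "conjugate_derivation G1 G2 H1 H2 \<delta> F = 0" for F
      using derivation_eqI[OF hol_derivation_D[OF hol] zero, of F] hol \<delta>(2,3) by (simp add: hol_derivation_def)
    then have "subst_zpoly G1 G2 (conjugate_derivation G1 G2 H1 H2 \<delta> F) = 0" for F by (simp add: subst_zero)
    then have "\<delta> (subst_zpoly G1 G2 F) = 0" for F by (simp add: conjugate_derivation_def inv)
    from this[of H1] this[of H2] show ?thesis using cc by (simp add: coordinate_change_def)
  qed
  show "\<not> (conjugate_derivation G1 G2 H1 H2 Y var_z1 = 0 \<and> conjugate_derivation G1 G2 H1 H2 Y var_z2 = 0 \<and>
     conjugate_derivation G1 G2 H1 H2 Z var_z1 = 0 \<and> conjugate_derivation G1 G2 H1 H2 Z var_z2 = 0 \<and> g = 0)"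
    using triv[OF Y_hol] triv[OF Z_hol] nontrivial by blast
qed

section \<open>Normal form of the weight 0 derivation\<close>

definition balanceable :: "real \<times> real \<Rightarrow> zpoly \<Rightarrow> bool" where
  "balanceable \<mu> P \<longleftrightarrow> (\<exists>G1 G2 H1 H2. coordinate_change \<mu> G1 G2 H1 H2 \<and> balanced (subst_zpoly H1 H2 P))"

lemma balanceable_subst:
  assumes cc: "coordinate_change \<mu> G1 G2 H1 H2" and bal: "balanceable \<mu> (subst_zpoly H1 H2 P)" and pos: "fst \<mu> > 0" "snd \<mu> > 0"
  shows "balanceable \<mu> P"
proof -
  obtain G1' G2' H1' H2' where cc': "coordinate_change \<mu> G1' G2' H1' H2'" and b: "balanced (subst_zpoly H1' H2' (subst_zpoly H1 H2 P))"
    using bal by (auto simp: balanceable_def)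
  have w: "hol_weight \<mu> x (subst_zpoly K1 K2 K)" if K: "hol_weight \<mu> (fst \<mu>) K1" "hol_weight \<mu> (snd \<mu>) K2" "hol_weight \<mu> x K" for K1 K2 K x
    unfolding hol_weight_def
  proof
    fix n assume n: "n \<in> Poly_Mapping.keys (subst_zpoly K1 K2 K)"
    obtain m where "m \<in> Poly_Mapping.keys K" "weighted_length \<mu> (fst n) = weighted_length \<mu> (fst m)" "weighted_length \<mu> (snd n) = weighted_length \<mu> (snd m)"
      using keys_subst[OF K(1,2) n] by blast
    with K(3) show "snd n = 0 \<and> weighted_length \<mu> (fst n) = x"
      using weighted_length_eq_0_iff[OF pos, of "snd n"] by (simp add: hol_weight_def)
  qed
  have "coordinate_change \<mu> (subst_zpoly G1 G2 G1') (subst_zpoly G1 G2 G2') (subst_zpoly H1' H2' H1) (subst_zpoly H1' H2' H2)"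
    using cc cc' unfolding coordinate_change_def
    by (simp add: w subst_subst[symmetric] coordinate_change_inverse[OF cc] coordinate_change_inverse[OF cc']
        coordinate_change_inverse[OF coordinate_change_sym[OF cc]] coordinate_change_inverse[OF coordinate_change_sym[OF cc']])
  with b show ?thesis unfolding balanceable_def subst_subst by blast
qed

lemma coordinate_change_id: "coordinate_change \<mu> var_z1 var_z2 var_z1 var_z2"
  by (simp add: coordinate_change_def hol_weight_var subst_vars)

text \<open>If a = k c with b nonzero, then Y is a multiple of the Euler derivation plus a nilpotent
  part, which \<open>no_nilpotent_part\<close> excludes. If a differs from k c, a shear z1 + e z2^k
  is an eigenvector of Y and makes it diagonal.\<close>

lemma (in tangency) balanceable_triangular:
  assumes Y1: "Y var_z1 = const_zpoly a * var_z1 + const_zpoly b * var_z2 ^ k"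
    and Y2: "Y var_z2 = const_zpoly c * var_z2" and k: "b \<noteq> 0 \<Longrightarrow> fst \<mu> = real k * snd \<mu>"
  shows "balanceable \<mu> P"
proof -
  consider "b = 0" | "b \<noteq> 0" "a = of_nat k * c" | "b \<noteq> 0" "a \<noteq> of_nat k * c" by blast
  then show ?thesis
  proof cases
    case 1
    interpret diagonal_tangency \<mu> P Y Z g a c
      by unfold_locales (simp_all add: Y1 Y2 1)
    from balanced_P show ?thesis
      unfolding balanceable_def using coordinate_change_id subst_id by metis
  next
    case 2
    define \<kappa> where "\<kappa> = c / of_real (snd \<mu>)"
    have "\<kappa> * of_real (snd \<mu>) = c" "\<kappa> * of_real (fst \<mu>) = a"
      using weights_pos k[OF 2(1)] 2(2) by (simp_all add: \<kappa>_def field_simps)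
    then have False
      using no_nilpotent_part[of \<kappa> b k] Y1 Y2 k[OF 2(1)] 2(1) by simp
    then show ?thesis ..
  next
    case 3
    \<comment> \<open>This solves b + k e c = a e, which says that z1 + e z2^k is an eigenvector of
      Y with eigenvalue a.\<close>
    define e where "e = b / (a - of_nat k * c)"
    have e: "b + of_nat k * e * c = a * e" using 3(2) by (simp add: e_def field_simps)
    define G1 where "G1 = var_z1 + const_zpoly e * var_z2 ^ k"
    define H1 where "H1 = var_z1 + const_zpoly (- e) * var_z2 ^ k"
    have w: "hol_weight \<mu> (fst \<mu>) (var_z1 + const_zpoly x * var_z2 ^ k)" for x
      unfolding k[OF 3(1)]
      using hol_weight_var[of \<mu>] k[OF 3(1)] by (intro hol_weight_add hol_weight_const_mult hol_weight_power) auto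
    have wGH: "hol_weight \<mu> (fst \<mu>) G1" "hol_weight \<mu> (fst \<mu>) H1" by (simp_all only: G1_def H1_def w)
    have cc: "coordinate_change \<mu> G1 var_z2 H1 var_z2"
      unfolding coordinate_change_def
      by (simp add: wGH hol_weight_var) (simp add: G1_def H1_def subst_simps const_zpoly_minus)
    interpret T: tangency \<mu> "subst_zpoly H1 var_z2 P" "conjugate_derivation G1 var_z2 H1 var_z2 Y" "conjugate_derivation G1 var_z2 H1 var_z2 Z" g
      by (rule tangency_subst[OF cc])
    have kk: "of_nat k * (var_z2 ^ (k - 1) * var_z2) = of_nat k * var_z2 ^ k" by (cases k) (auto simp: mult.commute)
    have "Y G1 = const_zpoly a * var_z1 + (const_zpoly b * var_z2 ^ k + const_zpoly (e * c) * (of_nat k * (var_z2 ^ (k - 1) * var_z2)))"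
      by (simp add: G1_def derivation_add[OF Y_der] derivation_const_mult[OF Y_der] derivation_power'[OF Y_der] Y1 Y2 const_zpoly_mult mult_ac add.assoc)
    also have "const_zpoly b * var_z2 ^ k + const_zpoly (e * c) * (of_nat k * (var_z2 ^ (k - 1) * var_z2)) = const_zpoly (b + of_nat k * e * c) * var_z2 ^ k"
      unfolding kk by (simp add: const_zpoly_add const_zpoly_mult algebra_simps)
    finally have "Y G1 = const_zpoly a * G1"
      unfolding e by (simp add: G1_def const_zpoly_mult distrib_left mult.assoc)
    then have "conjugate_derivation G1 var_z2 H1 var_z2 Y var_z1 = const_zpoly a * var_z1"
      using cc by (simp add: conjugate_derivation_def subst_vars subst_mult subst_const coordinate_change_def)
    moreover have "conjugate_derivation G1 var_z2 H1 var_z2 Y var_z2 = const_zpoly c * var_z2"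
      by (simp add: conjugate_derivation_def subst_simps Y2)
    ultimately interpret D: diagonal_tangency \<mu> "subst_zpoly H1 var_z2 P" "conjugate_derivation G1 var_z2 H1 var_z2 Y" "conjugate_derivation G1 var_z2 H1 var_z2 Z" g a c
      by unfold_locales
    from D.balanced_P cc show ?thesis unfolding balanceable_def by blast
  qed
qed

lemma complex_quadratic_root:
  assumes "d \<noteq> (0::complex)"
  obtains y where "d * y\<^sup>2 + p * y + q = 0"
proof
  define r y where ry: "r = csqrt (p\<^sup>2 - 4 * d * q)" "y = (- p + r) / (2 * d)"
  have "2 * d * y + p = r" using assms by (simp add: ry)
  moreover have "r\<^sup>2 = p\<^sup>2 - 4 * d * q" by (simp add: ry)
  ultimately have "(2 * d * y + p)\<^sup>2 - p\<^sup>2 + 4 * d * q = 0" by simp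
  moreover have "(2 * d * y + p)\<^sup>2 - p\<^sup>2 + 4 * d * q = 4 * d * (d * y\<^sup>2 + p * y + q)"
    by (simp add: power2_eq_square algebra_simps)
  ultimately have "4 * d * (d * y\<^sup>2 + p * y + q) = 0" by simp
  with assms show "d * y\<^sup>2 + p * y + q = 0" by simp
qed

text \<open>Because the second weight is positive and at most the first, a monomial of weight
  \<open>fst \<mu>\<close> is z1 or a power of z2 alone.\<close>

lemma hol_weight_fst_form:
  assumes F: "hol_weight \<mu> (fst \<mu>) F" and pos: "0 < snd \<mu>" "snd \<mu> \<le> fst \<mu>"
  obtains a b k where "F = const_zpoly a * var_z1 + const_zpoly b * var_z2 ^ k" "b \<noteq> 0 \<Longrightarrow> fst \<mu> = real k * snd \<mu>"
    "fst \<mu> = snd \<mu> \<Longrightarrow> k = 1"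
proof -
  \<comment> \<open>The default 1 occurs only when \<open>fst \<mu>\<close> is no natural multiple
    of \<open>snd \<mu>\<close>, and then \<open>b\<close> is 0.\<close>
  define k where "k = (if \<exists>k. fst \<mu> = real k * snd \<mu> then (SOME k. fst \<mu> = real k * snd \<mu>) else 1)"
  have k: "fst \<mu> = real k * snd \<mu>" if "fst \<mu> = real j * snd \<mu>" for j
    using that unfolding k_def by (auto intro: someI[of _ j])
  define a where "a = Poly_Mapping.lookup F ((1, 0), 0)"
  define b where "b = (if fst \<mu> = real k * snd \<mu> then Poly_Mapping.lookup F ((0, k), 0) else 0)"
  show thesis
  proof (rule that[of a b k])
    show "F = const_zpoly a * var_z1 + const_zpoly b * var_z2 ^ k"
    proof (rule poly_mapping_eqI)
      fix m :: "(nat \<times> nat) \<times> nat \<times> nat"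
      obtain i j \<beta> where m: "m = ((i, j), \<beta>)" by (metis surj_pair)
      have z: "((0::nat, k), (0::nat,0::nat)) = ((0, k), 0)" "((1::nat, 0::nat), (0::nat,0::nat)) = ((1, 0), 0)" by (simp_all add: zero_prod_def)
      have R: "Poly_Mapping.lookup (const_zpoly a * var_z1 + const_zpoly b * var_z2 ^ k) m =
         (if m = ((1, 0), 0) then a else 0) + (if m = ((0, k), 0) then b else 0)"
        unfolding lookup_add lookup_const_mult var_powers var_z1_def lookup_single z by (auto simp: when_def)
      show "Poly_Mapping.lookup F m = Poly_Mapping.lookup (const_zpoly a * var_z1 + const_zpoly b * var_z2 ^ k) m"
      proof (cases "Poly_Mapping.lookup F m = 0")
        case True
        then show ?thesis unfolding R by (auto simp: a_def b_def)
      next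
        case False
        then have "m \<in> Poly_Mapping.keys F" by (simp add: in_keys_iff)
        then have wl: "fst \<mu> * real i + snd \<mu> * real j = fst \<mu>" and \<beta>: "\<beta> = 0"
          using F by (auto simp: hol_weight_def weighted_length_def m)
        have "i < 2"
        proof (rule ccontr)
          assume "\<not> i < 2"
          then have "fst \<mu> * 2 \<le> fst \<mu> * real i" using pos by (intro mult_left_mono) auto
          moreover have "snd \<mu> * real j \<ge> 0" using pos by simp
          ultimately show False using wl pos by linarith
        qed
        then consider "i = 0" | "i = 1" by linarith
        then show ?thesis
        proof cases
          case 1
          then have "fst \<mu> = real j * snd \<mu>" using wl by (simp add: mult.commute)
          with k[OF this] pos have "j = k" "fst \<mu> = real k * snd \<mu>" by auto
          then show ?thesis unfolding R using 1 \<beta> by (simp add: m b_def)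
        next
          case 2
          then have "j = 0" using wl pos by simp
          then show ?thesis unfolding R using 2 \<beta> by (simp add: m a_def)
        qed
      qed
    qed
    show "b \<noteq> 0 \<Longrightarrow> fst \<mu> = real k * snd \<mu>" by (auto simp: b_def split: if_splits)
    show "k = 1" if "fst \<mu> = snd \<mu>"
      using k[of 1] that pos by simp
  qed
qed

lemma hol_weight_snd_form:
  assumes F: "hol_weight \<mu> (snd \<mu>) F" and pos: "0 < snd \<mu>" "snd \<mu> \<le> fst \<mu>"
  obtains d c where "F = const_zpoly d * var_z1 + const_zpoly c * var_z2" "d \<noteq> 0 \<Longrightarrow> fst \<mu> = snd \<mu>"
proof -
  define c where "c = Poly_Mapping.lookup F ((0, 1), 0)"
  define d where "d = Poly_Mapping.lookup F ((1, 0), 0)"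
  show thesis
  proof (rule that[of d c])
    show "F = const_zpoly d * var_z1 + const_zpoly c * var_z2"
    proof (rule poly_mapping_eqI)
      fix m :: "(nat \<times> nat) \<times> nat \<times> nat"
      obtain i j \<beta> where m: "m = ((i, j), \<beta>)" by (metis surj_pair)
      have z: "((0::nat, 1::nat), (0::nat,0::nat)) = ((0, 1), 0)" "((1::nat, 0::nat), (0::nat,0::nat)) = ((1, 0), 0)" by (simp_all add: zero_prod_def)
      have R: "Poly_Mapping.lookup (const_zpoly d * var_z1 + const_zpoly c * var_z2) m =
         (if m = ((1, 0), 0) then d else 0) + (if m = ((0, 1), 0) then c else 0)"
        unfolding lookup_add lookup_const_mult var_defs lookup_single z by (auto simp: when_def)
      show "Poly_Mapping.lookup F m = Poly_Mapping.lookup (const_zpoly d * var_z1 + const_zpoly c * var_z2) m"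
      proof (cases "Poly_Mapping.lookup F m = 0")
        case True
        then show ?thesis unfolding R by (auto simp: c_def d_def)
      next
        case False
        then have "m \<in> Poly_Mapping.keys F" by (simp add: in_keys_iff)
        then have wl: "fst \<mu> * real i + snd \<mu> * real j = snd \<mu>" and \<beta>: "\<beta> = 0"
          using F by (auto simp: hol_weight_def weighted_length_def m)
        have "i + j = 1"
        proof -
          have "snd \<mu> * real (i + j) \<le> snd \<mu>"
            using wl mult_right_mono[OF pos(2), of "real i"] by (simp add: algebra_simps)
          then have "i + j \<le> 1" using pos by (simp add: mult_le_cancel_left1)
          moreover have "i + j \<noteq> 0"
          proof
            assume "i + j = 0"
            then have "i = 0" "j = 0" by auto
            then show False using wl pos by simp
          qed
          ultimately show ?thesis by linarith
        qed
        then consider "i = 0" "j = 1" | "i = 1" "j = 0" by linarith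
        then show ?thesis unfolding R by cases (auto simp: m \<beta> c_def d_def)
      qed
    qed
    show "fst \<mu> = snd \<mu>" if "d \<noteq> 0"
    proof -
      have "((1, 0), 0) \<in> Poly_Mapping.keys F" using that by (simp add: d_def in_keys_iff)
      then show ?thesis using F by (auto simp: hol_weight_def weighted_length_def)
    qed
  qed
qed

text \<open>If z1 occurs in Y z2, the weights are equal and Y is linear. Then an eigenvector among
  the linear forms, taken as the new second coordinate, makes Y triangular.\<close>

theorem (in tangency) balanceable_P:
  assumes "snd \<mu> \<le> fst \<mu>"
  shows "balanceable \<mu> P"
proof -
  have "hol_weight \<mu> (fst \<mu>) (Y var_z1)" "hol_weight \<mu> (snd \<mu>) (Y var_z2)"
    using Y_graded by (auto simp: hol_weight_def graded_derivation_def hol_derivation_def holomorphic_zpoly_def)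
  then obtain a b k c d where Y1: "Y var_z1 = const_zpoly a * var_z1 + const_zpoly b * var_z2 ^ k"
    and k: "b \<noteq> 0 \<Longrightarrow> fst \<mu> = real k * snd \<mu>" "fst \<mu> = snd \<mu> \<Longrightarrow> k = 1"
    and Y2: "Y var_z2 = const_zpoly d * var_z1 + const_zpoly c * var_z2" and d: "d \<noteq> 0 \<Longrightarrow> fst \<mu> = snd \<mu>"
    using hol_weight_fst_form[OF _ weights_pos(2) assms] hol_weight_snd_form[OF _ weights_pos(2) assms] by metis
  show ?thesis
  proof (cases "d = 0")
    case True
    then show ?thesis using balanceable_triangular[OF Y1 _ k(1)] Y2 by simp
  next
    case False
    then have eq: "fst \<mu> = snd \<mu>" "k = 1" using d k by auto
    \<comment> \<open>The quadratic equation says that z1 + y z2 is an eigenvector of Y, with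
      eigenvalue a + y d. The change below also swaps the coordinates, so that this form becomes the
      second one.\<close>
    obtain y where y: "d * y\<^sup>2 + (a - c) * y + (- b) = 0" using complex_quadratic_root[OF False] by blast
    define G2 where "G2 = var_z1 + const_zpoly y * var_z2"
    define H1 where "H1 = var_z2 + const_zpoly (- y) * var_z1"
    have w: "hol_weight \<mu> (fst \<mu>) var_z1" "hol_weight \<mu> (fst \<mu>) var_z2" using hol_weight_var[of \<mu>] eq by simp_all
    have wGH: "hol_weight \<mu> (fst \<mu>) G2" "hol_weight \<mu> (fst \<mu>) H1"
      unfolding G2_def H1_def by (intro hol_weight_add hol_weight_const_mult w)+
    have cc: "coordinate_change \<mu> var_z2 G2 H1 var_z1"
      unfolding coordinate_change_def eq(1)[symmetric]
      by (simp add: w wGH) (simp add: G2_def H1_def subst_simps const_zpoly_minus)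
    interpret T: tangency \<mu> "subst_zpoly H1 var_z1 P" "conjugate_derivation var_z2 G2 H1 var_z1 Y" "conjugate_derivation var_z2 G2 H1 var_z1 Z" g
      by (rule tangency_subst[OF cc])
    have "conjugate_derivation var_z2 G2 H1 var_z1 Y var_z1 = const_zpoly (c - d * y) * var_z1 + const_zpoly d * var_z2 ^ 1"
      by (simp add: conjugate_derivation_def subst_simps Y2 H1_def const_zpoly_diff const_zpoly_mult const_zpoly_minus algebra_simps)
    moreover have "conjugate_derivation var_z2 G2 H1 var_z1 Y var_z2 = const_zpoly (a + y * d) * var_z2"
    proof -
      have YG2: "Y G2 = const_zpoly a * var_z1 + const_zpoly b * var_z2 + const_zpoly y * (const_zpoly d * var_z1 + const_zpoly c * var_z2)"
        by (simp add: G2_def derivation_add[OF Y_der] derivation_const_mult[OF Y_der] Y1 Y2 eq)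
      have "conjugate_derivation var_z2 G2 H1 var_z1 Y var_z2 = const_zpoly (a + y * d) * var_z2 - const_zpoly (d * y\<^sup>2 + (a - c) * y + (- b)) * var_z1"
        unfolding conjugate_derivation_def subst_vars YG2
        by (simp add: subst_simps H1_def const_zpoly_diff const_zpoly_add const_zpoly_mult const_zpoly_minus power2_eq_square algebra_simps)
      then show ?thesis unfolding y by simp
    qed
    ultimately have "balanceable \<mu> (subst_zpoly H1 var_z1 P)"
      by (rule T.balanceable_triangular) (simp add: eq)
    then show ?thesis by (rule balanceable_subst[OF cc _ weights_pos])
  qed
qed

subsection \<open>The model function and its derivative\<close>

lemma has_derivative_zpoly_eval_vec:
  "((\<lambda>q::complex^3. zpoly_eval F (q $ 1) (q $ 2)) has_derivative
     (\<lambda>v. zpoly_eval (pd1 F) (q $ 1) (q $ 2) * v $ 1 + zpoly_eval (pd2 F) (q $ 1) (q $ 2) * v $ 2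
        + zpoly_eval (conj_zpoly (pd1 (conj_zpoly F))) (q $ 1) (q $ 2) * cnj (v $ 1)
        + zpoly_eval (conj_zpoly (pd2 (conj_zpoly F))) (q $ 1) (q $ 2) * cnj (v $ 2))) (at q)"
proof -
  have "((\<lambda>q::complex^3. (q $ 1, q $ 2)) has_derivative (\<lambda>v. (v $ 1, v $ 2))) (at q)"
    by (intro derivative_intros bounded_linear.has_derivative[OF bounded_linear_vec_nth] has_derivative_ident)
  from has_derivative_compose[OF this, of "\<lambda>z. zpoly_eval F (fst z) (snd z)"] has_derivative_zpoly_eval
  show ?thesis by fastforce
qed

text \<open>For real \<open>P\<close> the antilinear terms are the conjugates of the linear ones,
  which produces twice the real part.\<close>

lemma has_derivative_model_function:
  assumes "conj_zpoly P = P"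
  shows "(model_function P has_derivative
    (\<lambda>v. Im (v $ 3) - 2 * Re (zpoly_eval (pd1 P) (q $ 1) (q $ 2) * v $ 1 + zpoly_eval (pd2 P) (q $ 1) (q $ 2) * v $ 2))) (at q)"
proof -
  have "(model_function P has_derivative (\<lambda>v. Im (v $ 3) - Re (zpoly_eval (pd1 P) (q $ 1) (q $ 2) * v $ 1 + zpoly_eval (pd2 P) (q $ 1) (q $ 2) * v $ 2
        + zpoly_eval (conj_zpoly (pd1 (conj_zpoly P))) (q $ 1) (q $ 2) * cnj (v $ 1)
        + zpoly_eval (conj_zpoly (pd2 (conj_zpoly P))) (q $ 1) (q $ 2) * cnj (v $ 2)))) (at q)"
    unfolding model_function_def[abs_def]
    by (intro derivative_intros has_derivative_zpoly_eval_vec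
       bounded_linear.has_derivative[OF bounded_linear_vec_nth] has_derivative_ident)
  then show ?thesis by (simp add: assms zpoly_eval_conj algebra_simps)
qed

lemma three_distinct: "(1::3) \<noteq> 2" "(1::3) \<noteq> 3" "(2::3) \<noteq> 3" "(2::3) \<noteq> 1" "(3::3) \<noteq> 1" "(3::3) \<noteq> 2"
  by simp_all

lemma wirtinger_model:
  assumes "conj_zpoly P = P"
  shows "wirtinger 1 (model_function P) q = - zpoly_eval (pd1 P) (q $ 1) (q $ 2)"
    "wirtinger 2 (model_function P) q = - zpoly_eval (pd2 P) (q $ 1) (q $ 2)"
    "wirtinger 3 (model_function P) q = - \<i> / 2"
  unfolding wirtinger_def frechet_derivative_at[OF has_derivative_model_function[OF assms], symmetric]
  by (simp_all add: axis_def complex_eq_iff)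

lemma vf_apply_model:
  assumes "conj_zpoly P = P"
  shows "vf_apply X (model_function P) q =
    - (zpoly_eval (pd1 P) (q $ 1) (q $ 2) * X q $ 1 + zpoly_eval (pd2 P) (q $ 1) (q $ 2) * X q $ 2) - \<i> / 2 * X q $ 3"
  unfolding vf_apply_def sum_3 wirtinger_model[OF assms] by simp

text \<open>Tangency of Re X is thus a condition on the real differential, which can be tested with
  curves; the factor 1/2 comes from the Wirtinger derivatives.\<close>

lemma Re_vf_apply_model:
  assumes "conj_zpoly P = P"
  shows "Re (vf_apply X (model_function P) q) = frechet_derivative (model_function P) (at q) (X q) / 2"
  unfolding frechet_derivative_at[OF has_derivative_model_function[OF assms], symmetric] vf_apply_model[OF assms]
  by (simp add: algebra_simps)

subsection \<open>Germs of polynomial vector fields\<close>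

lemma vf_germ_cases:
  obtains F where "holomorphic_near_0 F" "X = abs_vf_germ F"
proof
  have "germ_rel (rep_vf_germ X) (rep_vf_germ X)" by (rule Quotient_rep_reflp[OF Quotient_vf_germ])
  then show "holomorphic_near_0 (rep_vf_germ X)" by (simp add: germ_rel_def)
  show "X = abs_vf_germ (rep_vf_germ X)" by (simp add: Quotient_abs_rep[OF Quotient_vf_germ])
qed

lemma abs_vf_germ_eq_iff:
  assumes "holomorphic_near_0 F" "holomorphic_near_0 G"
  shows "abs_vf_germ F = abs_vf_germ G \<longleftrightarrow> (\<forall>\<^sub>F q in nhds 0. F q = G q)"
  using Quotient_rel[OF Quotient_vf_germ, of F G] germ_rel_refl[OF assms(1)] germ_rel_refl[OF assms(2)] assms
  by (auto simp: germ_rel_def)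

lemma abs_vf_germ_eq_0_iff:
  assumes "holomorphic_near_0 F"
  shows "abs_vf_germ F = 0 \<longleftrightarrow> (\<forall>\<^sub>F q in nhds 0. F q = 0)"
  unfolding zero_vf_germ_def by (rule abs_vf_germ_eq_iff[OF assms holomorphic_near_0_zero])

lemma complex_tangent_abs:
  assumes "holomorphic_near_0 F"
  shows "complex_tangent P (abs_vf_germ F) \<longleftrightarrow>
    (\<forall>\<^sub>F q in nhds 0. q \<in> model_hypersurface P \<longrightarrow> vf_apply F (model_function P) q = 0)"
  by (rule complex_tangent.abs_eq) (rule germ_rel_refl[OF assms])

lemma real_tangent_abs:
  assumes "holomorphic_near_0 F"
  shows "real_tangent P (abs_vf_germ F) \<longleftrightarrow>
    (\<forall>\<^sub>F q in nhds 0. q \<in> model_hypersurface P \<longrightarrow> Re (vf_apply F (model_function P) q) = 0)"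
  by (rule real_tangent.abs_eq) (rule germ_rel_refl[OF assms])

lemma has_weight_abs:
  assumes "holomorphic_near_0 X"
  shows "has_weight \<mu> \<nu> (abs_vf_germ X) \<longleftrightarrow> (\<exists>F :: 3 \<Rightarrow> hpoly.
     (\<forall>j. \<forall>m\<in>Poly_Mapping.keys (F j).
        (\<Sum>k\<in>UNIV. coordinate_weight \<mu> k * real (m k)) - coordinate_weight \<mu> j = \<nu>) \<and>
     (\<forall>\<^sub>F q in nhds 0. \<forall>j. X q $ j = hpoly_eval (F j) q))"
  by (rule has_weight.abs_eq) (rule germ_rel_refl[OF assms])

section \<open>Holomorphic nondegeneracy in terms of derivations\<close>

lemma hol_derivation_pd1: "hol_derivation pd1" and hol_derivation_pd2: "hol_derivation pd2"
  by (simp_all add: hol_derivation_def derivation_pd1 derivation_pd2 pd_vars holomorphic_zpoly_def)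

lemma has_derivative_holomorphic_zpoly:
  assumes "holomorphic_zpoly F"
  shows "((\<lambda>q::complex^3. zpoly_eval F (q $ 1) (q $ 2)) has_derivative
     (\<lambda>v. zpoly_eval (pd1 F) (q $ 1) (q $ 2) * v $ 1 + zpoly_eval (pd2 F) (q $ 1) (q $ 2) * v $ 2)) (at q)"
  using has_derivative_zpoly_eval_vec[of F q]
  by (simp add: hol_derivation_conj_holomorphic[OF hol_derivation_pd1 assms] hol_derivation_conj_holomorphic[OF hol_derivation_pd2 assms]
      conj_zero zpoly_eval_zero)

lemma complex_differentiable_at_vector:
  fixes F :: "complex^3 \<Rightarrow> complex^3"
  assumes "\<And>j. ((\<lambda>q. F q $ j) has_derivative D j) (at q)" "\<And>j c x. D j (c *s x) = c * D j x"
  shows "complex_differentiable_at F q"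
  unfolding complex_differentiable_at_def
proof (intro exI conjI allI)
  show "(F has_derivative (\<lambda>v. \<chi> j. D j v)) (at q)"
  proof (subst has_derivative_componentwise_within, intro ballI)
    fix i :: "complex^3" assume "i \<in> Basis"
    then obtain j b where i: "i = axis j b" "b \<in> Basis" by (auto simp: Basis_vec_def)
    have "((\<lambda>x. F x $ j \<bullet> b) has_derivative (\<lambda>v. D j v \<bullet> b)) (at q)"
      by (intro derivative_intros assms(1))
    then show "((\<lambda>x. F x \<bullet> i) has_derivative (\<lambda>v. (\<chi> j. D j v) \<bullet> i)) (at q)"
      by (simp add: i inner_axis)
  qed
  show "(\<chi> j. D j (c *s x)) = c *s (\<chi> j. D j x)" for c x
    by (simp add: vec_eq_iff assms(2))
qed

lemma nhds_0_vec3_projection: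
  assumes "\<forall>\<^sub>F q in nhds (0::complex^3). Q q"
  obtains r where "r > 0" "\<And>z1 z2 w. cmod z1 < r \<Longrightarrow> cmod z2 < r \<Longrightarrow> cmod w < r \<Longrightarrow> Q (vector [z1, z2, w])"
proof -
  obtain d where d: "d > 0" "\<And>q. dist q 0 < d \<Longrightarrow> Q q"
    using assms by (auto simp: eventually_nhds_metric)
  have "Q (vector [z1, z2, w])" if "cmod z1 < d / 3" "cmod z2 < d / 3" "cmod w < d / 3" for z1 z2 w
  proof (rule d(2))
    have "norm (vector [z1, z2, w] :: complex^3) \<le> (\<Sum>i\<in>UNIV. norm ((vector [z1, z2, w] :: complex^3) $ i))"
      unfolding norm_vec_def by (rule L2_set_le_sum) simp
    also have "\<dots> = cmod z1 + cmod z2 + cmod w" by (simp add: sum_3)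
    finally show "dist (vector [z1, z2, w] :: complex^3) 0 < d" using that by simp
  qed
  with d(1) show thesis using that[of "d / 3"] by simp
qed

lemma holomorphic_zpoly_eq_0:
  assumes "r > 0" "\<And>z1 z2. cmod z1 < r \<Longrightarrow> cmod z2 < r \<Longrightarrow> zpoly_eval F z1 z2 = 0"
  shows "F = 0"
  by (rule zpoly_eq_0_if_eval_eq_0_on_open[of "ball 0 r \<times> ball 0 r" "(0, 0)"]) (use assms in \<open>auto intro: open_Times\<close>)

text \<open>The derivation is read as a vector field that is independent of w and has no d/dw
  component. It sends the model function to -\<delta> P, so \<delta> P = 0 makes it complex tangent
  and its germ is zero.\<close>

lemma nondegenerate_derivation:
  assumes P: "conj_zpoly P = P" and nd: "holomorphically_nondegenerate P" and \<delta>: "hol_derivation \<delta>" "\<delta> P = 0"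
  shows "\<delta> var_z1 = 0 \<and> \<delta> var_z2 = 0"
proof -
  define F :: "complex^3 \<Rightarrow> complex^3" where
    "F q = vector [zpoly_eval (\<delta> var_z1) (q $ 1) (q $ 2), zpoly_eval (\<delta> var_z2) (q $ 1) (q $ 2), 0]" for q
  have hol: "holomorphic_zpoly (\<delta> var_z1)" "holomorphic_zpoly (\<delta> var_z2)" using \<delta>(1) by (simp_all add: hol_derivation_def)
  have "complex_differentiable_at F q" for q
  proof (rule complex_differentiable_at_vector)
    let ?D = "\<lambda>G v. zpoly_eval (pd1 G) (q $ 1) (q $ 2) * v $ 1 + zpoly_eval (pd2 G) (q $ 1) (q $ 2) * v $ 2 :: complex"
    show "((\<lambda>q. F q $ j) has_derivative (if j = 1 then ?D (\<delta> var_z1) else if j = 2 then ?D (\<delta> var_z2) else (\<lambda>_. 0))) (at q)" for j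
      using exhaust_3[of j] has_derivative_holomorphic_zpoly[OF hol(1)] has_derivative_holomorphic_zpoly[OF hol(2)] by (auto simp: F_def)
  qed (auto simp: algebra_simps)
  then have hF: "holomorphic_near_0 F" by (simp add: holomorphic_near_0_def)
  have "vf_apply F (model_function P) q = - zpoly_eval (\<delta> P) (q $ 1) (q $ 2)" for q
    unfolding hol_derivation_eq[OF \<delta>(1), of P] by (simp add: vf_apply_model[OF P] F_def zpoly_eval_simps)
  then have "complex_tangent P (abs_vf_germ F)" by (simp add: complex_tangent_abs[OF hF] \<delta>(2) zpoly_eval_zero)
  then have "abs_vf_germ F = 0" using nd by (auto simp: holomorphically_nondegenerate_def)
  then have "\<forall>\<^sub>F q in nhds 0. F q = 0" by (simp add: abs_vf_germ_eq_0_iff[OF hF])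
  from nhds_0_vec3_projection[OF this] obtain r where r: "r > 0"
    "\<And>z1 z2 w. cmod z1 < r \<Longrightarrow> cmod z2 < r \<Longrightarrow> cmod w < r \<Longrightarrow> F (vector [z1, z2, w]) = 0" by blast
  have "zpoly_eval (\<delta> var_z1) z1 z2 = 0" "zpoly_eval (\<delta> var_z2) z1 z2 = 0" if "cmod z1 < r" "cmod z2 < r" for z1 z2
    using r(2)[OF that, of 0] r(1) by (auto simp: F_def vec_eq_iff forall_3)
  with holomorphic_zpoly_eq_0[OF r(1)] show ?thesis by blast
qed

subsection \<open>Vector fields of weight 1\<close>

text \<open>Terms are collected by powers of w. Each factor w uses up weight 1 and the other weights
  are nonnegative, which bounds the power by \<open>N\<close>.\<close>

lemma hpoly_split:
  assumes F: "\<And>m. m \<in> Poly_Mapping.keys F \<Longrightarrow> (\<Sum>k\<in>UNIV. coordinate_weight \<mu> k * real (m k)) = \<rho>"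
    and pos: "fst \<mu> \<ge> 0" "snd \<mu> \<ge> 0" and N: "\<rho> < real N + 1"
  shows "\<exists>A. (\<forall>n. hol_weight \<mu> (\<rho> - real n) (A n)) \<and>
    (\<forall>q. hpoly_eval F q = (\<Sum>n\<le>N. zpoly_eval (A n) (q $ 1) (q $ 2) * (q $ 3) ^ n))"
proof -
  define K where "K n = {m \<in> Poly_Mapping.keys F. m 3 = n}" for n
  define A :: "nat \<Rightarrow> zpoly" where "A n = (\<Sum>m\<in>K n. Poly_Mapping.single ((m 1, m 2), (0, 0)) (Poly_Mapping.lookup F m))" for n
  have w: "fst \<mu> * real (m 1) + snd \<mu> * real (m 2) + real (m 3) = \<rho>" if "m \<in> Poly_Mapping.keys F" for m
    using F[OF that] by (simp add: sum_3 coordinate_weight_def)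
  have le: "m 3 \<le> N" if "m \<in> Poly_Mapping.keys F" for m
  proof -
    have "fst \<mu> * real (m 1) \<ge> 0" "snd \<mu> * real (m 2) \<ge> 0" using pos by simp_all
    then show ?thesis using w[OF that] N by linarith
  qed
  have "hol_weight \<mu> (\<rho> - real n) (A n)" for n
    unfolding hol_weight_def
  proof
    fix m assume "m \<in> Poly_Mapping.keys (A n)"
    then have "m \<in> (\<Union>m'\<in>K n. Poly_Mapping.keys (Poly_Mapping.single ((m' 1, m' 2), (0::nat, 0::nat)) (Poly_Mapping.lookup F m')))"
      unfolding A_def by (rule subsetD[OF keys_sum])
    then obtain m' where m': "m' \<in> K n" "m \<in> Poly_Mapping.keys (Poly_Mapping.single ((m' 1, m' 2), (0::nat, 0::nat)) (Poly_Mapping.lookup F m'))"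
      by blast
    then have "m = ((m' 1, m' 2), (0, 0))" by (simp split: if_splits)
    then show "snd m = 0 \<and> weighted_length \<mu> (fst m) = \<rho> - real n"
      using w[of m'] m'(1) by (auto simp: K_def weighted_length_def zero_prod_def)
  qed
  moreover have "hpoly_eval F q = (\<Sum>n\<le>N. zpoly_eval (A n) (q $ 1) (q $ 2) * (q $ 3) ^ n)" for q
  proof -
    have "hpoly_eval F q = (\<Sum>n\<le>N. \<Sum>m\<in>K n. Poly_Mapping.lookup F m * (\<Prod>j\<in>UNIV. (q $ j) ^ m j))"
    proof -
      have "(\<lambda>m. m 3) ` Poly_Mapping.keys F \<subseteq> {..N}" using le by (simp add: image_subset_iff)
      from sum.group[OF finite_keys finite_atMost this, of "\<lambda>m. Poly_Mapping.lookup F m * (\<Prod>j\<in>UNIV. (q $ j) ^ m j)"]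
      show ?thesis unfolding hpoly_eval_def K_def by (rule sym)
    qed
    also have "\<dots> = (\<Sum>n\<le>N. zpoly_eval (A n) (q $ 1) (q $ 2) * (q $ 3) ^ n)"
    proof (rule sum.cong[OF refl])
      fix n
      show "(\<Sum>m\<in>K n. Poly_Mapping.lookup F m * (\<Prod>j\<in>UNIV. (q $ j) ^ m j)) = zpoly_eval (A n) (q $ 1) (q $ 2) * (q $ 3) ^ n"
        unfolding A_def zpoly_eval_sum sum_distrib_right
      proof (rule sum.cong[OF refl])
        fix m assume "m \<in> K n"
        then have "m 3 = n" by (simp add: K_def)
        moreover have "(\<Prod>j\<in>UNIV. (q $ j) ^ m j) = (q $ 1) ^ m 1 * (q $ 2) ^ m 2 * (q $ 3) ^ m 3"
          unfolding UNIV_3 by (simp add: mult.assoc)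
        ultimately show "Poly_Mapping.lookup F m * (\<Prod>j\<in>UNIV. (q $ j) ^ m j) =
            zpoly_eval (Poly_Mapping.single ((m 1, m 2), (0, 0)) (Poly_Mapping.lookup F m)) (q $ 1) (q $ 2) * (q $ 3) ^ n"
          by (simp add: zpoly_eval_single)
      qed
    qed
    finally show ?thesis .
  qed
  ultimately show ?thesis by blast
qed

lemma real_quadratic_eq_0:
  fixes a b c r :: real
  assumes "r > 0" "\<And>u. \<bar>u\<bar> < r \<Longrightarrow> a * u\<^sup>2 + b * u + c = 0"
  shows "a = 0" "b = 0" "c = 0"
proof -
  have 0: "c = 0" using assms(2)[of 0] assms(1) by simp
  have "a * (r / 2)\<^sup>2 + b * (r / 2) = 0" "a * (r / 2)\<^sup>2 - b * (r / 2) = 0"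
    using assms(2)[of "r / 2"] assms(2)[of "- (r / 2)"] assms(1) 0 by simp_all
  then have "a * (r / 2)\<^sup>2 = 0" "b * (r / 2) = 0" by linarith+
  with assms(1) 0 show "a = 0" "b = 0" "c = 0" by auto
qed

text \<open>These polynomials form an ideal stable under conjugation, which contains no nonzero
  pluriharmonic polynomial.\<close>

definition mixed :: "zpoly \<Rightarrow> bool" where
  "mixed F \<longleftrightarrow> (\<forall>m\<in>Poly_Mapping.keys F. fst m \<noteq> 0 \<and> snd m \<noteq> 0)"

lemma mixed_add: "mixed F \<Longrightarrow> mixed G \<Longrightarrow> mixed (F + G)"
  using Poly_Mapping.keys_add[of F G] unfolding mixed_def by blast

lemma mixed_mult: "mixed F \<Longrightarrow> mixed (F * G)"
  unfolding mixed_def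
proof
  fix m assume F: "\<forall>m\<in>Poly_Mapping.keys F. fst m \<noteq> 0 \<and> snd m \<noteq> 0" and m: "m \<in> Poly_Mapping.keys (F * G)"
  obtain k l where "m = k + l" "k \<in> Poly_Mapping.keys F" using keys_mult[of F G] m by blast
  with F show "fst m \<noteq> 0 \<and> snd m \<noteq> 0" by (cases k; cases l) (auto simp: zero_prod_def prod_eq_iff)
qed

lemma mixed_const_mult: "mixed F \<Longrightarrow> mixed (const_zpoly c * F)"
  using mixed_mult[of F "const_zpoly c"] by (simp add: mult.commute)

lemma mixed_conj: "mixed F \<Longrightarrow> mixed (conj_zpoly F)"
  unfolding mixed_def keys_conj by auto

text \<open>A monomial of \<open>C\<close> is holomorphic and not constant, so nothing in the
  conjugate of \<open>C\<close> can cancel it; but it is not a mixed monomial.\<close>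

lemma holomorphic_pluriharmonic_eq_0:
  assumes C: "hol_weight \<mu> \<rho> C" "\<rho> \<noteq> 0" and "mixed (C - conj_zpoly C)"
  shows "C = 0"
proof (rule poly_mapping_eqI, rule ccontr)
  fix m assume "Poly_Mapping.lookup C m \<noteq> Poly_Mapping.lookup 0 m"
  then have m: "m \<in> Poly_Mapping.keys C" by (simp add: in_keys_iff)
  then have s: "snd m = 0" and f: "fst m \<noteq> 0" using C by (auto simp: hol_weight_def)
  then have "Poly_Mapping.lookup C (snd m, fst m) = 0"
    using C(1) by (metis hol_weight_def in_keys_iff snd_conv)
  then have "m \<in> Poly_Mapping.keys (C - conj_zpoly C)"
    using m by (simp add: in_keys_iff lookup_minus lookup_conj)
  with assms(3) s show False by (simp add: mixed_def)
qed

lemma graded_derivation_of_components: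
  assumes A: "hol_weight \<mu> (fst \<mu> + \<rho>) A1" "hol_weight \<mu> (snd \<mu> + \<rho>) A2"
  shows "graded_derivation \<mu> \<rho> (\<lambda>F. pd1 F * A1 + pd2 F * A2)"
proof -
  have "derivation (\<lambda>F. pd1 F * A1 + pd2 F * A2)"
    by (intro derivationI) (simp_all add: derivation_simps[OF derivation_pd1] derivation_simps[OF derivation_pd2] algebra_simps)
  then show ?thesis
    using A by (simp add: graded_derivation_def hol_derivation_def pd_vars holomorphic_zpoly_def hol_weight_def)
qed

text \<open>A holomorphic derivation leaves antiholomorphic exponents alone, and with weight at
  least 0 it does not lower the weight of the holomorphic exponent, which is positive on
  \<open>P\<close>.\<close>

lemma mixed_graded_derivation:
  assumes \<delta>: "graded_derivation \<mu> \<rho> \<delta>" and \<mu>: "fst \<mu> > 0" "snd \<mu> > 0" "\<rho> \<ge> 0" and P: "no_pluriharmonic_terms P"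
  shows "mixed (\<delta> P)"
  unfolding mixed_def
proof
  fix n assume "n \<in> Poly_Mapping.keys (\<delta> P)"
  then obtain m where m: "m \<in> Poly_Mapping.keys P" "snd n = snd m" "weighted_length \<mu> (fst n) = weighted_length \<mu> (fst m) + \<rho>"
    using keys_graded_derivation[OF \<delta>] by metis
  have nz: "fst m \<noteq> 0" "snd m \<noteq> 0" using P m(1) by (auto simp: no_pluriharmonic_terms_def zero_prod_def case_prod_unfold)
  have "weighted_length \<mu> (fst m) \<noteq> 0" using nz(1) weighted_length_eq_0_iff[OF \<mu>(1,2)] by blast
  moreover have "weighted_length \<mu> (fst m) \<ge> 0" using \<mu> by (simp add: weighted_length_def)
  ultimately have "weighted_length \<mu> (fst n) \<noteq> 0" using m(3) \<mu>(3) by linarith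
  then show "fst n \<noteq> 0 \<and> snd n \<noteq> 0" using nz m(2) by auto
qed

text \<open>For fixed z and w = u + i P(z) the condition Im (C2 w^2 + C1 w + C0) = 2 Re (w Y P + Z
  P) is quadratic in the real variable u. Its coefficients vanish for all small z, hence identically
  as polynomials; the conclusions list those of u^2, u and 1, up to constants.\<close>

lemma eventually_tangent_quadratic:
  fixes A1 A2 B1 B2 C1 C2 C0 :: zpoly
  assumes P: "conj_zpoly P = P"
    and tan: "\<forall>\<^sub>F q in nhds (0::complex^3). q \<in> model_hypersurface P \<longrightarrow> Re (vf_apply X (model_function P) q) = 0"
    and X: "\<forall>\<^sub>F q in nhds 0. X q $ 1 = zpoly_eval A1 (q $ 1) (q $ 2) * q $ 3 + zpoly_eval B1 (q $ 1) (q $ 2) \<and>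
      X q $ 2 = zpoly_eval A2 (q $ 1) (q $ 2) * q $ 3 + zpoly_eval B2 (q $ 1) (q $ 2) \<and>
      X q $ 3 = zpoly_eval C2 (q $ 1) (q $ 2) * (q $ 3)\<^sup>2 + zpoly_eval C1 (q $ 1) (q $ 2) * q $ 3 + zpoly_eval C0 (q $ 1) (q $ 2)"
    and P0: "zpoly_eval P 0 0 = 0"
  defines "Y \<equiv> \<lambda>F. pd1 F * A1 + pd2 F * A2" and "Z \<equiv> \<lambda>F. pd1 F * B1 + pd2 F * B2"
  shows "C2 - conj_zpoly C2 = 0"
    and "C1 - conj_zpoly C1 + const_zpoly (2 * \<i>) * (P * (C2 + conj_zpoly C2)) - const_zpoly (2 * \<i>) * (Y P + conj_zpoly (Y P)) = 0"
    and "C0 - conj_zpoly C0 + const_zpoly \<i> * (P * (C1 + conj_zpoly C1)) - P * P * (C2 - conj_zpoly C2)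
      - const_zpoly (2 * \<i>) * (const_zpoly \<i> * (P * (Y P - conj_zpoly (Y P))) + Z P + conj_zpoly (Z P)) = 0"
      (is "?E0 = 0")
proof -
  from nhds_0_vec3_projection[OF eventually_conj[OF tan X]] obtain r where r: "r > 0"
    "\<And>z1 z2 w. cmod z1 < r \<Longrightarrow> cmod z2 < r \<Longrightarrow> cmod w < r \<Longrightarrow>
      (vector [z1, z2, w] \<in> model_hypersurface P \<longrightarrow> Re (vf_apply X (model_function P) (vector [z1, z2, w])) = 0) \<and>
      X (vector [z1, z2, w]) $ 1 = zpoly_eval A1 z1 z2 * w + zpoly_eval B1 z1 z2 \<and>
      X (vector [z1, z2, w]) $ 2 = zpoly_eval A2 z1 z2 * w + zpoly_eval B2 z1 z2 \<and>
      X (vector [z1, z2, w]) $ 3 = zpoly_eval C2 z1 z2 * w\<^sup>2 + zpoly_eval C1 z1 z2 * w + zpoly_eval C0 z1 z2"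
    by auto
  have "isCont (\<lambda>z. zpoly_eval P (fst z) (snd z)) (0, 0)"
    by (rule has_derivative_continuous[OF has_derivative_zpoly_eval])
  then obtain d where d: "d > 0" "\<And>z. dist z (0, 0) < d \<Longrightarrow> dist (zpoly_eval P (fst z) (snd z)) 0 < r / 2"
    using r(1) unfolding continuous_at_eps_delta by (metis P0 fst_conv half_gt_zero snd_conv)
  define U where "U = ball (0, 0) d \<inter> (ball (0::complex) r \<times> ball (0::complex) r)"
  have U: "open U" "(0, 0) \<in> U" using d r by (auto simp: U_def intro: open_Int open_Times)
  have quad: "Im (zpoly_eval C2 z1 z2) = 0"
     "Im (zpoly_eval C1 z1 z2) + 2 * Re p * Re (zpoly_eval C2 z1 z2) - 2 * Re (zpoly_eval (Y P) z1 z2) = 0"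
     "Im (zpoly_eval C0 z1 z2) + Re p * Re (zpoly_eval C1 z1 z2) - (Re p)\<^sup>2 * Im (zpoly_eval C2 z1 z2)
       - 2 * (Re (zpoly_eval (Z P) z1 z2) - Re p * Im (zpoly_eval (Y P) z1 z2)) = 0"
    if z: "(z1, z2) \<in> U" and p: "p = zpoly_eval P z1 z2" for z1 z2 p
  proof -
    have small: "cmod z1 < r" "cmod z2 < r" "cmod p < r / 2"
      using z d(2)[of "(z1, z2)"] by (auto simp: U_def p dist_commute)
    have pr: "p = of_real (Re p)"
      using zpoly_eval_conj[of P z1 z2] by (simp add: P p complex_eq_iff)
    have "Im (zpoly_eval C2 z1 z2) * u\<^sup>2 + (Im (zpoly_eval C1 z1 z2) + 2 * Re p * Re (zpoly_eval C2 z1 z2) - 2 * Re (zpoly_eval (Y P) z1 z2)) * u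
      + (Im (zpoly_eval C0 z1 z2) + Re p * Re (zpoly_eval C1 z1 z2) - (Re p)\<^sup>2 * Im (zpoly_eval C2 z1 z2)
       - 2 * (Re (zpoly_eval (Z P) z1 z2) - Re p * Im (zpoly_eval (Y P) z1 z2))) = 0" if u: "\<bar>u\<bar> < r / 2" for u
    proof -
      define w where "w = Complex u (Re p)"
      \<comment> \<open>Bounding both |u| and |P| by r/2 keeps the point w = u + i P in the disc
        where tangency and the formula for X hold.\<close>
      have "cmod w \<le> \<bar>u\<bar> + \<bar>Re p\<bar>" using cmod_le[of w] by (simp add: w_def)
      also have "\<dots> < r" using u small(3) abs_Re_le_cmod[of p] by linarith
      finally have "cmod w < r" .
      note R = r(2)[OF small(1,2) this]
      have "vector [z1, z2, w] \<in> model_hypersurface P"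
        by (simp add: model_hypersurface_def model_function_def w_def flip: p)
      then have tan0: "Re (vf_apply X (model_function P) (vector [z1, z2, w])) = 0" using R by blast
      have Xs: "X (vector [z1, z2, w]) $ 1 = zpoly_eval A1 z1 z2 * w + zpoly_eval B1 z1 z2"
        "X (vector [z1, z2, w]) $ 2 = zpoly_eval A2 z1 z2 * w + zpoly_eval B2 z1 z2"
        "X (vector [z1, z2, w]) $ 3 = zpoly_eval C2 z1 z2 * w\<^sup>2 + zpoly_eval C1 z1 z2 * w + zpoly_eval C0 z1 z2"
        using R by blast+
      have Re_eq: "Re (- S - \<i> / 2 * T) = - Re S + Im T / 2" for S T by simp
      have "- Re (zpoly_eval (pd1 P) z1 z2 * (zpoly_eval A1 z1 z2 * w + zpoly_eval B1 z1 z2) + zpoly_eval (pd2 P) z1 z2 * (zpoly_eval A2 z1 z2 * w + zpoly_eval B2 z1 z2))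
         + Im (zpoly_eval C2 z1 z2 * w\<^sup>2 + zpoly_eval C1 z1 z2 * w + zpoly_eval C0 z1 z2) / 2 = 0"
        using tan0 unfolding vf_apply_model[OF P] Re_eq Xs vector_3 .
      moreover have "zpoly_eval (pd1 P) z1 z2 * (zpoly_eval A1 z1 z2 * w + zpoly_eval B1 z1 z2) + zpoly_eval (pd2 P) z1 z2 * (zpoly_eval A2 z1 z2 * w + zpoly_eval B2 z1 z2)
        = zpoly_eval (Y P) z1 z2 * w + zpoly_eval (Z P) z1 z2"
        by (simp add: Y_def Z_def zpoly_eval_simps algebra_simps)
      moreover have "- x + y / 2 = 0 \<Longrightarrow> y = 2 * x" for x y :: real by simp
      ultimately have "Im (zpoly_eval C2 z1 z2 * w\<^sup>2 + zpoly_eval C1 z1 z2 * w + zpoly_eval C0 z1 z2) = 2 * Re (zpoly_eval (Y P) z1 z2 * w + zpoly_eval (Z P) z1 z2)"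
        by metis
      then show ?thesis
        by (simp add: w_def power2_eq_square algebra_simps)
    qed
    note quad = this
    have r2: "r / 2 > 0" using r(1) by simp
    show "Im (zpoly_eval C2 z1 z2) = 0"
     "Im (zpoly_eval C1 z1 z2) + 2 * Re p * Re (zpoly_eval C2 z1 z2) - 2 * Re (zpoly_eval (Y P) z1 z2) = 0"
     "Im (zpoly_eval C0 z1 z2) + Re p * Re (zpoly_eval C1 z1 z2) - (Re p)\<^sup>2 * Im (zpoly_eval C2 z1 z2)
       - 2 * (Re (zpoly_eval (Z P) z1 z2) - Re p * Im (zpoly_eval (Y P) z1 z2)) = 0"
      by (rule real_quadratic_eq_0[OF r2 quad], assumption)+
  qed
  have real: "zpoly_eval P z1 z2 = of_real (Re (zpoly_eval P z1 z2))" for z1 z2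
    using zpoly_eval_conj[of P z1 z2] by (simp add: P complex_eq_iff)
  have re: "w + cnj w = of_real (2 * Re w)" and im: "w - cnj w = of_real (2 * Im w) * \<i>" for w
    by (simp_all add: complex_eq_iff)
  show "C2 - conj_zpoly C2 = 0"
    by (rule zpoly_eq_0_if_eval_eq_0_on_open[OF U]) (use quad(1) in \<open>auto simp: zpoly_eval_simps zpoly_eval_conj im\<close>)
  show "C1 - conj_zpoly C1 + const_zpoly (2 * \<i>) * (P * (C2 + conj_zpoly C2)) - const_zpoly (2 * \<i>) * (Y P + conj_zpoly (Y P)) = 0"
  proof (rule zpoly_eq_0_if_eval_eq_0_on_open[OF U])
    fix z assume "z \<in> U"
    then have z: "(fst z, snd z) \<in> U" by simp
    show "zpoly_eval (C1 - conj_zpoly C1 + const_zpoly (2 * \<i>) * (P * (C2 + conj_zpoly C2)) - const_zpoly (2 * \<i>) * (Y P + conj_zpoly (Y P))) (fst z) (snd z) = 0"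
      unfolding zpoly_eval_simps zpoly_eval_conj re im
      using quad(2)[OF z refl] real[of "fst z" "snd z"] by (simp add: complex_eq_iff algebra_simps)
  qed
  show "?E0 = 0"
  proof (rule zpoly_eq_0_if_eval_eq_0_on_open[OF U])
    fix z assume "z \<in> U"
    then have z: "(fst z, snd z) \<in> U" by simp
    show "zpoly_eval ?E0 (fst z) (snd z) = 0"
      unfolding add.assoc[of _ "Z P"] unfolding zpoly_eval_simps zpoly_eval_conj re im
      using quad(3)[OF z refl] real[of "fst z" "snd z"] by (simp add: complex_eq_iff algebra_simps power2_eq_square)
  qed
qed

lemma zpoly_eval_0_0: "no_pluriharmonic_terms P \<Longrightarrow> zpoly_eval P 0 0 = 0"
  unfolding zpoly_eval_def no_pluriharmonic_terms_def by (intro sum.neutral) (auto simp: power_0_left)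

lemma hol_weight_0_const:
  assumes "hol_weight \<mu> 0 C" "fst \<mu> > 0" "snd \<mu> > 0"
  shows "C = const_zpoly (Poly_Mapping.lookup C 0)"
proof (rule poly_mapping_eqI)
  fix m
  have "m = 0" if "Poly_Mapping.lookup C m \<noteq> 0"
    using assms(1) that weighted_length_eq_0_iff[OF assms(2,3), of "fst m"]
    by (auto simp: hol_weight_def in_keys_iff prod_eq_iff)
  then show "Poly_Mapping.lookup C m = Poly_Mapping.lookup (const_zpoly (Poly_Mapping.lookup C 0)) m"
    by (auto simp: const_zpoly_def lookup_single when_def)
qed

text \<open>The coefficients of d/dz1 and d/dz2 have weight below 2, hence are at most linear in w;
  that of d/dw has weight 2, hence is at most quadratic in w. In the equations from
  \<open>eventually_tangent_quadratic\<close>, the differences of \<open>C 1\<close> and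
  \<open>C 0\<close> with their conjugates equal mixed polynomials, so both coefficients are
  0.\<close>

lemma tangency_of_graded_component:
  assumes P: "conj_zpoly P = P" "weighted_homogeneous \<mu> P" "no_pluriharmonic_terms P" "holomorphically_nondegenerate P"
    and \<mu>: "fst \<mu> > 0" "snd \<mu> > 0" "fst \<mu> \<le> 1 / 2" "snd \<mu> \<le> 1 / 2"
    and X: "X \<in> graded_component P \<mu> 1" "X \<noteq> 0"
  shows "\<exists>Y Z g. tangency \<mu> P Y Z g"
proof -
  obtain V where V: "holomorphic_near_0 V" "X = abs_vf_germ V" by (rule vf_germ_cases)
  have tan: "\<forall>\<^sub>F q in nhds 0. q \<in> model_hypersurface P \<longrightarrow> Re (vf_apply V (model_function P) q) = 0"
    using X(1) by (simp add: graded_component_def aut_def V(2) real_tangent_abs[OF V(1)])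
  have "has_weight \<mu> 1 (abs_vf_germ V)" using X(1) by (simp add: graded_component_def V(2))
  then obtain F :: "3 \<Rightarrow> hpoly" where
    F0: "\<forall>j. \<forall>m\<in>Poly_Mapping.keys (F j). (\<Sum>k\<in>UNIV. coordinate_weight \<mu> k * real (m k)) - coordinate_weight \<mu> j = 1"
    and VF: "\<forall>\<^sub>F q in nhds 0. \<forall>j. V q $ j = hpoly_eval (F j) q"
    unfolding has_weight_abs[OF V(1)] by blast
  have F: "(\<Sum>k\<in>UNIV. coordinate_weight \<mu> k * real (m k)) = 1 + coordinate_weight \<mu> j" if "m \<in> Poly_Mapping.keys (F j)" for j m
  proof -
    have "(\<Sum>k\<in>UNIV. coordinate_weight \<mu> k * real (m k)) - coordinate_weight \<mu> j = 1" using F0 that by blast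
    then show ?thesis by linarith
  qed
  obtain A1 where A1: "\<And>n. hol_weight \<mu> (1 + fst \<mu> - real n) (A1 n)" "\<And>q. hpoly_eval (F 1) q = (\<Sum>n\<le>1. zpoly_eval (A1 n) (q $ 1) (q $ 2) * (q $ 3) ^ n)"
    using hpoly_split[of "F 1" \<mu> "1 + fst \<mu>" 1] F[of _ 1] \<mu> by (auto simp: coordinate_weight_def)
  obtain A2 where A2: "\<And>n. hol_weight \<mu> (1 + snd \<mu> - real n) (A2 n)" "\<And>q. hpoly_eval (F 2) q = (\<Sum>n\<le>1. zpoly_eval (A2 n) (q $ 1) (q $ 2) * (q $ 3) ^ n)"
    using hpoly_split[of "F 2" \<mu> "1 + snd \<mu>" 1] F[of _ 2] \<mu> by (auto simp: coordinate_weight_def)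
  obtain C where C: "\<And>n. hol_weight \<mu> (2 - real n) (C n)" "\<And>q. hpoly_eval (F 3) q = (\<Sum>n\<le>2. zpoly_eval (C n) (q $ 1) (q $ 2) * (q $ 3) ^ n)"
    using hpoly_split[of "F 3" \<mu> 2 2] F[of _ 3] \<mu> by (auto simp: coordinate_weight_def)
  define Y where "Y F = pd1 F * A1 1 + pd2 F * A2 1" for F
  define Z where "Z F = pd1 F * A1 0 + pd2 F * A2 0" for F
  have YZ: "graded_derivation \<mu> 0 Y" "graded_derivation \<mu> 1 Z"
    unfolding Y_def[abs_def] Z_def[abs_def]
    by (rule graded_derivation_of_components; use A1(1)[of 0] A1(1)[of 1] A2(1)[of 0] A2(1)[of 1] in \<open>simp add: add.commute\<close>)+
  have "\<forall>\<^sub>F q in nhds 0. V q $ 1 = zpoly_eval (A1 1) (q $ 1) (q $ 2) * q $ 3 + zpoly_eval (A1 0) (q $ 1) (q $ 2) \<and>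
      V q $ 2 = zpoly_eval (A2 1) (q $ 1) (q $ 2) * q $ 3 + zpoly_eval (A2 0) (q $ 1) (q $ 2) \<and>
      V q $ 3 = zpoly_eval (C 2) (q $ 1) (q $ 2) * (q $ 3)\<^sup>2 + zpoly_eval (C 1) (q $ 1) (q $ 2) * q $ 3 + zpoly_eval (C 0) (q $ 1) (q $ 2)"
    using VF by eventually_elim (simp add: A1(2) A2(2) C(2) numeral_2_eq_2)
  note E = eventually_tangent_quadratic[OF P(1) tan this zpoly_eval_0_0[OF P(3)], folded Y_def Z_def]
  define c where "c = Poly_Mapping.lookup (C 2) 0"
  have C2: "C 2 = const_zpoly c"
    unfolding c_def by (rule hol_weight_0_const[OF _ \<mu>(1,2)]) (use C(1)[of 2] in simp)
  have "const_zpoly (c - cnj c) = 0" using E(1) by (simp add: C2 conj_const const_zpoly_diff)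
  then have "Poly_Mapping.lookup (const_zpoly (c - cnj c)) 0 = 0" by simp
  then have c: "c = of_real (Re c)" by (simp add: const_zpoly_def complex_eq_iff)
  \<comment> \<open>\<open>C 2\<close> has weight 0, so it is a constant, and the u^2 equation makes
    it real.\<close>
  define g where "g = Re c"
  have C2': "C 2 + conj_zpoly (C 2) = const_zpoly (2 * of_real g)" "C 2 - conj_zpoly (C 2) = 0"
    unfolding C2 conj_const g_def by (subst (1 2) c; simp flip: const_zpoly_add const_zpoly_diff)+
  have mP: "mixed P" using P(3) by (auto simp: mixed_def no_pluriharmonic_terms_def zero_prod_def)
  have mYZ: "mixed (Y P)" "mixed (Z P)"
    using mixed_graded_derivation[OF YZ(1) \<mu>(1,2) _ P(3)] mixed_graded_derivation[OF YZ(2) \<mu>(1,2) _ P(3)] by simp_all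
  have m1: "C 1 - conj_zpoly (C 1) = const_zpoly (- 2 * \<i>) * (P * const_zpoly (2 * of_real g)) + const_zpoly (2 * \<i>) * (Y P + conj_zpoly (Y P))"
    using E(2) unfolding C2' by (simp add: const_zpoly_minus algebra_simps add_eq_0_iff)
  have "mixed (C 1 - conj_zpoly (C 1))"
    unfolding m1 by (intro mixed_add mixed_const_mult mixed_mult mixed_conj mP mYZ)
  then have C1: "C 1 = 0" by (rule holomorphic_pluriharmonic_eq_0[rotated 2]) (use C(1)[of 1] in auto)
  have "const_zpoly (2 * \<i>) * (const_zpoly (2 * of_real g) * P - (Y P + conj_zpoly (Y P))) = 0"
    using m1 C1 by (simp add: conj_zero const_zpoly_minus algebra_simps)
  then have "const_zpoly (2 * of_real g) * P - (Y P + conj_zpoly (Y P)) = 0" by (rule const_mult_eq_0D) simp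
  then have Y_eq: "Y P + conj_zpoly (Y P) = const_zpoly (2 * of_real g) * P" by simp
  have m0: "C 0 - conj_zpoly (C 0) = const_zpoly (2 * \<i>) * (const_zpoly \<i> * (P * (Y P - conj_zpoly (Y P))) + Z P + conj_zpoly (Z P))"
    using E(3) C1 by (simp add: C2'(2) conj_zero)
  have "mixed (C 0 - conj_zpoly (C 0))"
    unfolding m0 by (intro mixed_add mixed_const_mult mixed_mult mixed_conj mP mYZ)
  then have C0: "C 0 = 0" by (rule holomorphic_pluriharmonic_eq_0[rotated 2]) (use C(1)[of 0] in auto)
  have "const_zpoly (2 * \<i>) * (const_zpoly \<i> * (P * (Y P - conj_zpoly (Y P))) + Z P + conj_zpoly (Z P)) = 0"
    using m0 by (simp add: C0 conj_zero)
  then have "const_zpoly \<i> * (P * (Y P - conj_zpoly (Y P))) + Z P + conj_zpoly (Z P) = 0" by (rule const_mult_eq_0D) simp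
  moreover have "conj_zpoly (Y P) = const_zpoly (2 * of_real g) * P - Y P" using Y_eq by (simp add: algebra_simps)
  ultimately have Z_eq: "Z P + conj_zpoly (Z P) = const_zpoly (-2 * \<i>) * (P * (Y P - const_zpoly (of_real g) * P))"
    by (simp add: const_zpoly_mult const_zpoly_minus algebra_simps add_eq_0_iff)
  have nontriv: "\<not> (Y var_z1 = 0 \<and> Y var_z2 = 0 \<and> Z var_z1 = 0 \<and> Z var_z2 = 0 \<and> g = 0)"
  proof
    assume *: "Y var_z1 = 0 \<and> Y var_z2 = 0 \<and> Z var_z1 = 0 \<and> Z var_z2 = 0 \<and> g = 0"
    then have "A1 1 = 0" "A2 1 = 0" "A1 0 = 0" "A2 0 = 0" by (simp_all add: Y_def Z_def pd_vars)
    moreover have "C 2 = 0" using * c by (simp add: C2 g_def)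
    ultimately have "hpoly_eval (F j) q = 0" for j q
      using exhaust_3[of j] C1 by (auto simp: A1(2) A2(2) C(2) C0 numeral_2_eq_2 zpoly_eval_zero)
    then have "\<forall>\<^sub>F q in nhds 0. V q = 0"
      using VF by (auto simp: vec_eq_iff elim: eventually_mono)
    then show False using X(2) by (simp add: V(2) abs_vf_germ_eq_0_iff[OF V(1)])
  qed
  have "tangency \<mu> P Y Z g"
    by unfold_locales (use \<mu> P YZ Y_eq Z_eq nontriv nondegenerate_derivation[OF P(1,4)] in blast)+
  then show ?thesis by blast
qed

section \<open>Polynomial automorphisms as multitype coordinates\<close>

lemma iterated_deriv_zero: "iterated_deriv ds (\<lambda>_. 0) = (\<lambda>_. 0)"
  by (induction ds) (auto simp: frechet_derivative_const)

lemma o_weight_zero: "o_weight \<Lambda> (\<lambda>_. 0)"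
  unfolding o_weight_def smooth_on_def iterated_deriv_zero
  by (auto intro!: exI[of _ UNIV])

lemma zpoly_eval_hol_weight_0:
  assumes "hol_weight \<mu> \<rho> G" "\<rho> \<noteq> 0"
  shows "zpoly_eval G 0 0 = 0"
  unfolding zpoly_eval_def
proof (intro sum.neutral ballI)
  fix m assume m: "m \<in> Poly_Mapping.keys G"
  then have "fst m \<noteq> 0" using assms by (auto simp: hol_weight_def)
  then show "(case m of (x, xa) \<Rightarrow> (case x of (a1, a2) \<Rightarrow> \<lambda>(b1, b2). Poly_Mapping.lookup G ((a1, a2), b1, b2) * 0 ^ a1 * 0 ^ a2 * cnj 0 ^ b1 * cnj 0 ^ b2) xa) = 0"
    by (cases m) (auto simp: zero_prod_def power_0_left split: if_splits)
qed

definition coordinate_map :: "zpoly \<Rightarrow> zpoly \<Rightarrow> complex^3 \<Rightarrow> complex^3" where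
  "coordinate_map G1 G2 q = vector [zpoly_eval G1 (q $ 1) (q $ 2), zpoly_eval G2 (q $ 1) (q $ 2), q $ 3]"

lemma complex_differentiable_coordinate_map:
  assumes hol: "holomorphic_zpoly G1" "holomorphic_zpoly G2"
  shows "complex_differentiable_at (coordinate_map G1 G2) q"
proof (rule complex_differentiable_at_vector)
  let ?D = "\<lambda>G v. zpoly_eval (pd1 G) (q $ 1) (q $ 2) * v $ 1 + zpoly_eval (pd2 G) (q $ 1) (q $ 2) * v $ 2 :: complex"
  show "((\<lambda>q. coordinate_map G1 G2 q $ j) has_derivative (if j = 1 then ?D G1 else if j = 2 then ?D G2 else (\<lambda>v. v $ 3))) (at q)" for j
    using exhaust_3[of j] has_derivative_holomorphic_zpoly[OF hol(1)] has_derivative_holomorphic_zpoly[OF hol(2)]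
      bounded_linear.has_derivative[OF bounded_linear_vec_nth has_derivative_ident, of "3::3"]
    by (auto simp: coordinate_map_def)
qed (auto simp: algebra_simps)

lemma coordinate_map_inverse:
  assumes "coordinate_change \<mu> G1 G2 H1 H2"
  shows "coordinate_map H1 H2 (coordinate_map G1 G2 q) = q"
  using assms by (simp add: coordinate_map_def coordinate_change_def vec_eq_iff forall_3 zpoly_eval_vars flip: zpoly_eval_subst)

text \<open>The coordinate change, extended by w -> w, is a polynomial automorphism of the whole
  space. It turns the model into a model exactly, so the remainder is 0.\<close>

lemma (in tangency) balanced_multitype_coordinates:
  assumes "snd \<mu> \<le> fst \<mu>" and mt: "multitype_weight (model_hypersurface P) 0 \<mu>"
  shows "\<exists>\<Phi> U. multitype_coordinates (model_hypersurface P) 0 \<Phi> U \<and> balanced_in_coordinates (model_hypersurface P) 0 \<Phi> U"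
proof -
  obtain G1 G2 H1 H2 where cc: "coordinate_change \<mu> G1 G2 H1 H2" and bal: "balanced (subst_zpoly H1 H2 P)"
    using balanceable_P[OF assms(1)] by (auto simp: balanceable_def)
  define Q where "Q = subst_zpoly H1 H2 P"
  define \<Phi> where "\<Phi> = coordinate_map G1 G2"
  interpret T: tangency \<mu> Q "conjugate_derivation G1 G2 H1 H2 Y" "conjugate_derivation G1 G2 H1 H2 Z" g
    unfolding Q_def by (rule tangency_subst[OF cc])
  have lead: "leading_polynomial \<mu> Q"
    unfolding leading_polynomial_def real_valued_iff
    using T.P_nonzero T.conj_P T.homogeneous T.no_pluriharmonic by blast
  have hol: "holomorphic_zpoly G1" "holomorphic_zpoly G2" "holomorphic_zpoly H1" "holomorphic_zpoly H2"
    using cc by (auto simp: coordinate_change_def hol_weight_def holomorphic_zpoly_def)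
  note inv = coordinate_map_inverse[OF cc] coordinate_map_inverse[OF coordinate_change_sym[OF cc]]
  have inv_\<Phi>: "inv_into UNIV \<Phi> = coordinate_map H1 H2"
    by (rule inv_equality) (simp_all add: \<Phi>_def inv)
  have range: "range \<Phi> = UNIV" using inv(2) unfolding \<Phi>_def by (metis surjI)
  have \<Phi>0: "\<Phi> 0 = 0"
    using cc weights_pos zpoly_eval_hol_weight_0[of \<mu> "fst \<mu>" G1] zpoly_eval_hol_weight_0[of \<mu> "snd \<mu>" G2]
    by (simp add: \<Phi>_def coordinate_map_def coordinate_change_def vec_eq_iff forall_3)
  have coords: "local_coordinates \<Phi> UNIV 0"
    unfolding local_coordinates_def holomorphic_map_on_def inv_\<Phi> range
    using \<Phi>0 inv(1) complex_differentiable_coordinate_map[OF hol(1,2)] complex_differentiable_coordinate_map[OF hol(3,4)]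
    by (auto simp: \<Phi>_def intro: inj_on_inverseI)
  have "zpoly_eval P z1 z2 = zpoly_eval Q (zpoly_eval G1 z1 z2) (zpoly_eval G2 z1 z2)" for z1 z2
    using zpoly_eval_subst[of G1 G2 Q z1 z2] by (simp add: Q_def coordinate_change_inverse[OF cc])
  then have M: "q \<in> model_hypersurface P \<longleftrightarrow> \<Phi> q \<in> model_hypersurface Q" for q
    by (simp add: model_hypersurface_def model_function_def \<Phi>_def coordinate_map_def)
  have "given_by (model_hypersurface P) \<Phi> UNIV \<mu> Q"
    unfolding given_by_def
  proof (intro exI conjI ballI)
    show "o_weight \<mu> (\<lambda>_. 0)" by (rule o_weight_zero)
    show "q \<in> model_hypersurface P \<longleftrightarrow> Im (\<Phi> q $ 3) = Re (zpoly_eval Q (\<Phi> q $ 1) (\<Phi> q $ 2)) + 0" for q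
      unfolding M by (simp add: model_hypersurface_def model_function_def)
  qed
  with coords lead mt have "multitype_coordinates (model_hypersurface P) 0 \<Phi> UNIV"
    unfolding multitype_coordinates_def adapted_coordinates_def by blast
  moreover have "\<Phi> ` (model_hypersurface P \<inter> UNIV) = model_hypersurface Q \<inter> range \<Phi>"
    using range by (simp add: set_eq_iff image_iff surj_def) (metis M)
  with lead bal mt have "balanced_in_coordinates (model_hypersurface P) 0 \<Phi> UNIV"
    unfolding balanced_in_coordinates_def Q_def by blast
  ultimately show ?thesis by blast
qed

lemma balanced_coordinates_of_dim:
  assumes "finite_multitype (model_hypersurface P) 0 \<mu>" "real_valued P" "weighted_homogeneous \<mu> P"
    "no_pluriharmonic_terms P" "holomorphically_nondegenerate P" and dim: "dim (graded_component P \<mu> 1) > 0"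
  shows "\<exists>\<Phi> U. multitype_coordinates (model_hypersurface P) 0 \<Phi> U \<and> balanced_in_coordinates (model_hypersurface P) 0 \<Phi> U"
proof -
  have \<mu>: "multitype_weight (model_hypersurface P) 0 \<mu>" "fst \<mu> \<noteq> 0" "snd \<mu> \<noteq> 0" "is_weight \<mu>"
    using assms(1) by (auto simp: finite_multitype_def multitype_weight_def)
  then have pos: "fst \<mu> > 0" "snd \<mu> > 0" "fst \<mu> \<le> 1/2" "snd \<mu> \<le> 1/2" "snd \<mu> \<le> fst \<mu>"
    by (auto simp: is_weight_def)
  have "\<not> graded_component P \<mu> 1 \<subseteq> {0}"
  proof
    assume "graded_component P \<mu> 1 \<subseteq> {0}"
    then have "dim (graded_component P \<mu> 1) \<le> card ({} :: vf_germ set)"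
      by (intro dim_le_card) auto
    with dim show False by simp
  qed
  then obtain X where X: "X \<in> graded_component P \<mu> 1" "X \<noteq> 0" by blast
  obtain Y Z g where "tangency \<mu> P Y Z g"
    using tangency_of_graded_component[OF _ assms(3,4,5) pos(1-4) X] assms(2) by (auto simp: real_valued_iff)
  then interpret tangency \<mu> P Y Z g .
  show ?thesis by (rule balanced_multitype_coordinates[OF pos(5) \<mu>(1)])
qed

subsection \<open>Taylor expansion in several complex variables\<close>

definition taylor_coeff :: "nat \<Rightarrow> (complex \<Rightarrow> complex) \<Rightarrow> complex" where
  "taylor_coeff k f = (deriv ^^ k) f 0 / fact k"

lemma norm_taylor_coeff_le:
  assumes "f holomorphic_on ball 0 r" "r > 0" "\<And>z. z \<in> ball 0 r \<Longrightarrow> norm (f z) \<le> B"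
  shows "norm (taylor_coeff k f) \<le> B * (2 / r) ^ k"
proof -
  have "norm ((deriv ^^ k) f 0) \<le> fact k * B / (r / 2) ^ k"
  proof (rule Cauchy_inequality)
    show "f holomorphic_on ball 0 (r / 2)" by (rule holomorphic_on_subset[OF assms(1)]) (use assms(2) in auto)
    show "continuous_on (cball 0 (r / 2)) f"
      by (rule holomorphic_on_imp_continuous_on, rule holomorphic_on_subset[OF assms(1)]) (use assms(2) in auto)
  qed (use assms in auto)
  from divide_right_mono[OF this, of "fact k"]
  have "norm (taylor_coeff k f) \<le> (fact k * B / (r / 2) ^ k) / fact k"
    by (simp add: taylor_coeff_def norm_divide)
  also have "\<dots> = B * (2 / r) ^ k" by (simp add: power_divide)
  finally show ?thesis .
qed

text \<open>Cauchy's estimate on radius r/2 bounds the tail by a geometric series, whose ratio 2 |z|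
  / r is at most 1/2 when |z| is at most r/4.\<close>

lemma taylor_remainder_le:
  assumes f: "f holomorphic_on ball 0 r" and r: "r > 0" and B: "\<And>z. z \<in> ball 0 r \<Longrightarrow> norm (f z) \<le> B"
    and z: "norm z \<le> r / 4"
  shows "norm (f z - (\<Sum>k\<le>n. taylor_coeff k f * z ^ k)) \<le> 2 * B * (2 / r) ^ Suc n * norm z ^ Suc n"
proof -
  have B0: "B \<ge> 0" using B[of 0] r norm_ge_zero[of "f 0"] by (simp del: norm_ge_zero)
  define q where "q = 2 * norm z / r"
  have q: "0 \<le> q" "q \<le> 1 / 2" using z r by (auto simp: q_def field_simps)
  have sums: "(\<lambda>k. taylor_coeff k f * z ^ k) sums f z"
    using holomorphic_power_series[OF f, of z] z r by (simp add: taylor_coeff_def)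
  have tail: "(\<lambda>k. taylor_coeff (k + Suc n) f * z ^ (k + Suc n)) sums (f z - (\<Sum>k<Suc n. taylor_coeff k f * z ^ k))"
    using sums_iff_shift[of "\<lambda>k. taylor_coeff k f * z ^ k" "Suc n"] sums by simp
  have le: "norm (taylor_coeff (k + Suc n) f * z ^ (k + Suc n)) \<le> B * q ^ Suc n * (1 / 2) ^ k" for k
  proof -
    have "norm (taylor_coeff (k + Suc n) f * z ^ (k + Suc n)) \<le> (B * (2 / r) ^ (k + Suc n)) * norm z ^ (k + Suc n)"
      unfolding norm_mult norm_power by (intro mult_right_mono norm_taylor_coeff_le[OF f r B]) auto
    also have "\<dots> = B * q ^ Suc n * q ^ k"
      by (simp add: q_def power_add power_divide power_mult_distrib field_simps)
    also have "\<dots> \<le> B * q ^ Suc n * (1 / 2) ^ k"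
      using q B0 by (intro mult_left_mono power_mono) auto
    finally show ?thesis .
  qed
  have g: "(\<lambda>k. B * q ^ Suc n * (1 / 2) ^ k) sums (B * q ^ Suc n * 2)"
    using sums_mult[OF geometric_sums[of "1 / 2 :: real"], of "B * q ^ Suc n"] by simp
  have "norm (suminf (\<lambda>k. taylor_coeff (k + Suc n) f * z ^ (k + Suc n))) \<le> suminf (\<lambda>k. B * q ^ Suc n * (1 / 2) ^ k)"
    by (rule norm_suminf_le) (use le sums_summable[OF g] in auto)
  then have "norm (f z - (\<Sum>k<Suc n. taylor_coeff k f * z ^ k)) \<le> B * q ^ Suc n * 2"
    using tail g by (simp add: sums_iff)
  then show ?thesis by (simp only: lessThan_Suc_atMost) (simp add: q_def power_divide power_mult_distrib mult_ac)
qed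

text \<open>The kth coefficient in \<open>x\<close> is the limit of the normalised kth remainder at
  points \<open>x n\<close> tending to 0, uniformly in the parameter \<open>y\<close>. By induction
  on k, regularity of \<open>g\<close> in the parameter therefore passes to its Taylor
  coefficients.\<close>

lemma taylor_coeff_uniform_limit:
  assumes g: "\<And>y. y \<in> S \<Longrightarrow> (\<lambda>x. g x y) holomorphic_on ball 0 r" and r: "r > 0"
    and B: "\<And>x y. x \<in> ball 0 r \<Longrightarrow> y \<in> S \<Longrightarrow> norm (g x y) \<le> B"
  defines "x \<equiv> \<lambda>n. of_real (r / (4 * real (Suc n)))"
  shows "x n \<in> ball 0 r"
    and "uniform_limit S (\<lambda>n y. (g (x n) y - (\<Sum>j<k. taylor_coeff j (\<lambda>x. g x y) * x n ^ j)) / x n ^ k)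
      (\<lambda>y. taylor_coeff k (\<lambda>x. g x y)) sequentially"
proof -
  have nx: "norm (x n) = r / (4 * real (Suc n))" for n
    unfolding x_def norm_of_real by (rule abs_of_nonneg) (use r in simp)
  have x0: "x n \<noteq> 0" for n using r by (simp add: x_def del: of_nat_Suc)
  have xr: "norm (x n) \<le> r / 4" for n unfolding nx using r by (simp add: field_simps)
  have "norm (x n) < r" using xr[of n] r by linarith
  then show "x n \<in> ball 0 r" by (simp add: dist_norm)
  have le: "dist ((g (x n) y - (\<Sum>j<k. taylor_coeff j (\<lambda>x. g x y) * x n ^ j)) / x n ^ k) (taylor_coeff k (\<lambda>x. g x y))
      \<le> 2 * B * (2 / r) ^ Suc k * norm (x n)" if y: "y \<in> S" for n y
  proof -
    have rem: "norm (g (x n) y - (\<Sum>j\<le>k. taylor_coeff j (\<lambda>x. g x y) * x n ^ j)) \<le> 2 * B * (2 / r) ^ Suc k * norm (x n) ^ Suc k"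
      by (rule taylor_remainder_le[OF g[OF y] r B[OF _ y] xr])
    have "(g (x n) y - (\<Sum>j<k. taylor_coeff j (\<lambda>x. g x y) * x n ^ j)) / x n ^ k - taylor_coeff k (\<lambda>x. g x y)
       = (g (x n) y - (\<Sum>j\<le>k. taylor_coeff j (\<lambda>x. g x y) * x n ^ j)) / x n ^ k"
      using x0[of n] by (simp add: lessThan_Suc_atMost[symmetric] field_simps)
    then have "dist ((g (x n) y - (\<Sum>j<k. taylor_coeff j (\<lambda>x. g x y) * x n ^ j)) / x n ^ k) (taylor_coeff k (\<lambda>x. g x y))
      = norm (g (x n) y - (\<Sum>j\<le>k. taylor_coeff j (\<lambda>x. g x y) * x n ^ j)) / norm (x n) ^ k"
      by (simp only: dist_norm norm_divide norm_power)
    also have "\<dots> \<le> 2 * B * (2 / r) ^ Suc k * norm (x n) ^ Suc k / norm (x n) ^ k"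
      by (rule divide_right_mono[OF rem]) simp
    also have "\<dots> = 2 * B * (2 / r) ^ Suc k * norm (x n)" using x0[of n] by (simp del: power_Suc add: power_Suc[of "norm (x n)"])
    finally show ?thesis .
  qed
  have "(\<lambda>n. 2 * B * (2 / r) ^ Suc k * norm (x n)) \<longlonglongrightarrow> 2 * B * (2 / r) ^ Suc k * 0"
  proof (intro tendsto_mult tendsto_const)
    have "(\<lambda>n. (r / 4) * inverse (real (Suc n))) \<longlonglongrightarrow> (r / 4) * 0"
      by (intro tendsto_mult tendsto_const LIMSEQ_inverse_real_of_nat)
    then show "(\<lambda>n. norm (x n)) \<longlonglongrightarrow> 0" unfolding nx by (simp add: field_simps)
  qed
  then have lim: "(\<lambda>n. 2 * B * (2 / r) ^ Suc k * norm (x n)) \<longlonglongrightarrow> 0" by simp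
  show "uniform_limit S (\<lambda>n y. (g (x n) y - (\<Sum>j<k. taylor_coeff j (\<lambda>x. g x y) * x n ^ j)) / x n ^ k)
      (\<lambda>y. taylor_coeff k (\<lambda>x. g x y)) sequentially"
  proof (rule uniform_limitI)
    fix e :: real assume "e > 0"
    with lim have "\<forall>\<^sub>F n in sequentially. 2 * B * (2 / r) ^ Suc k * norm (x n) < e"
      by (rule order_tendstoD)
    then show "\<forall>\<^sub>F n in sequentially. \<forall>y\<in>S. dist ((g (x n) y - (\<Sum>j<k. taylor_coeff j (\<lambda>x. g x y) * x n ^ j)) / x n ^ k) (taylor_coeff k (\<lambda>x. g x y)) < e"
      by (rule eventually_mono) (blast intro: le_less_trans[OF le])
  qed
qed

lemma holomorphic_taylor_coeff:
  assumes g: "\<And>y. y \<in> S \<Longrightarrow> (\<lambda>x. g x y) holomorphic_on ball 0 r" and r: "r > 0"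
    and B: "\<And>x y. x \<in> ball 0 r \<Longrightarrow> y \<in> S \<Longrightarrow> norm (g x y) \<le> B"
    and S: "open S" and h: "\<And>x. x \<in> ball 0 r \<Longrightarrow> (\<lambda>y. g x y) holomorphic_on S"
  shows "(\<lambda>y. taylor_coeff k (\<lambda>x. g x y)) holomorphic_on S"
proof (induction k rule: less_induct)
  case (less k)
  note ul = taylor_coeff_uniform_limit[OF g r B]
  show ?case
  proof (rule holomorphic_uniform_sequence[OF S])
    show "(\<lambda>y. (g (of_real (r / (4 * real (Suc n)))) y - (\<Sum>j<k. taylor_coeff j (\<lambda>x. g x y) * of_real (r / (4 * real (Suc n))) ^ j)) / of_real (r / (4 * real (Suc n))) ^ k) holomorphic_on S" for n
      using r less.IH ul(1) by (intro holomorphic_intros h) (auto simp del: of_nat_Suc)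
    show "\<exists>d>0. cball y d \<subseteq> S \<and> uniform_limit (cball y d) (\<lambda>n y. (g (of_real (r / (4 * real (Suc n)))) y - (\<Sum>j<k. taylor_coeff j (\<lambda>x. g x y) * of_real (r / (4 * real (Suc n))) ^ j)) / of_real (r / (4 * real (Suc n))) ^ k)
        (\<lambda>y. taylor_coeff k (\<lambda>x. g x y)) sequentially" if "y \<in> S" for y
    proof -
      obtain d where "d > 0" "cball y d \<subseteq> S" using S \<open>y \<in> S\<close> open_contains_cball by blast
      then show ?thesis by (intro exI[of _ d] conjI uniform_limit_on_subset[OF ul(2)])
    qed
  qed
qed

lemma continuous_taylor_coeff:
  assumes g: "\<And>y. y \<in> S \<Longrightarrow> (\<lambda>x. g x y) holomorphic_on ball 0 r" and r: "r > 0"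
    and B: "\<And>x y. x \<in> ball 0 r \<Longrightarrow> y \<in> S \<Longrightarrow> norm (g x y) \<le> B"
    and h: "\<And>x. x \<in> ball 0 r \<Longrightarrow> continuous_on S (\<lambda>y. g x y)"
  shows "continuous_on S (\<lambda>y. taylor_coeff k (\<lambda>x. g x y))"
proof (induction k rule: less_induct)
  case (less k)
  note ul = taylor_coeff_uniform_limit[OF g r B]
  show ?case
  proof (rule uniform_limit_theorem[OF _ ul(2)])
    show "\<forall>\<^sub>F n in sequentially. continuous_on S (\<lambda>y. (g (of_real (r / (4 * real (Suc n)))) y - (\<Sum>j<k. taylor_coeff j (\<lambda>x. g x y) * of_real (r / (4 * real (Suc n))) ^ j)) / of_real (r / (4 * real (Suc n))) ^ k)"
      using r less.IH ul(1) by (intro always_eventually allI continuous_intros h) (auto simp del: of_nat_Suc)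
  qed auto
qed

text \<open>The one-variable expansion is iterated: first in x, then in y for each coefficient, then
  in z. The coefficients remain holomorphic and bounded by Cauchy's estimate. As r is at most 1, the
  powers of x and y multiplying the later remainders are at most 1 in size.\<close>

lemma taylor_expansion_3:
  fixes f :: "complex \<Rightarrow> complex \<Rightarrow> complex \<Rightarrow> complex"
  assumes r: "0 < r" "r \<le> 1"
    and h1: "\<And>y z. y \<in> ball 0 r \<Longrightarrow> z \<in> ball 0 r \<Longrightarrow> (\<lambda>x. f x y z) holomorphic_on ball 0 r"
    and h2: "\<And>x z. x \<in> ball 0 r \<Longrightarrow> z \<in> ball 0 r \<Longrightarrow> (\<lambda>y. f x y z) holomorphic_on ball 0 r"
    and h3: "\<And>x y. x \<in> ball 0 r \<Longrightarrow> y \<in> ball 0 r \<Longrightarrow> (\<lambda>z. f x y z) holomorphic_on ball 0 r"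
    and B: "\<And>x y z. x \<in> ball 0 r \<Longrightarrow> y \<in> ball 0 r \<Longrightarrow> z \<in> ball 0 r \<Longrightarrow> norm (f x y z) \<le> B"
  shows "\<exists>c C. \<forall>x y z. norm x \<le> r / 4 \<and> norm y \<le> r / 4 \<and> norm z \<le> r / 4 \<longrightarrow>
    norm (f x y z - (\<Sum>i\<le>n. \<Sum>j\<le>n. \<Sum>k\<le>n. c i j k * x ^ i * y ^ j * z ^ k)) \<le> C * (norm x ^ Suc n + norm y ^ Suc n + norm z ^ Suc n)"
proof -
  define a where "a i y z = taylor_coeff i (\<lambda>x. f x y z)" for i y z
  define b where "b i j z = taylor_coeff j (\<lambda>y. a i y z)" for i j z
  define c where "c i j k = taylor_coeff k (b i j)" for i j k
  define Ba where "Ba i = B * (2 / r) ^ i" for i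
  define Bb where "Bb i j = Ba i * (2 / r) ^ j" for i j
  have a1: "(\<lambda>y. a i y z) holomorphic_on ball 0 r" if "z \<in> ball 0 r" for i z
    unfolding a_def by (rule holomorphic_taylor_coeff[OF h1 r(1) B]) (use that h2 in auto)
  have a2: "(\<lambda>z. a i y z) holomorphic_on ball 0 r" if "y \<in> ball 0 r" for i y
    unfolding a_def by (rule holomorphic_taylor_coeff[OF h1 r(1) B]) (use that h3 in auto)
  have aB: "norm (a i y z) \<le> Ba i" if "y \<in> ball 0 r" "z \<in> ball 0 r" for i y z
    unfolding a_def Ba_def by (rule norm_taylor_coeff_le[OF h1 r(1) B]) (use that in auto)
  have b1: "(\<lambda>z. b i j z) holomorphic_on ball 0 r" for i j
    unfolding b_def by (rule holomorphic_taylor_coeff[OF a1 r(1) aB]) (use a2 in auto)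
  have bB: "norm (b i j z) \<le> Bb i j" if "z \<in> ball 0 r" for i j z
    unfolding b_def Bb_def by (rule norm_taylor_coeff_le[OF a1 r(1) aB]) (use that in auto)
  define D where "D = 2 * (2 / r) ^ Suc n"
  have D: "D \<ge> 0" using r by (simp add: D_def)
  have B0: "B \<ge> 0" using B[of 0 0 0] r norm_ge_zero[of "f 0 0 0"] by (simp del: norm_ge_zero)
  have Ba0: "Ba i \<ge> 0" and Bb0: "Bb i j \<ge> 0" for i j using B0 r by (simp_all add: Ba_def Bb_def)
  define C where "C = D * B + (\<Sum>i\<le>n. D * Ba i) + (\<Sum>i\<le>n. \<Sum>j\<le>n. D * Bb i j)"
  have parts: "D * B \<le> C" "(\<Sum>i\<le>n. D * Ba i) \<le> C" "(\<Sum>i\<le>n. \<Sum>j\<le>n. D * Bb i j) \<le> C"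
    unfolding C_def using D B0 Ba0 Bb0 by (simp_all add: sum_nonneg)
  have "norm (f x y z - (\<Sum>i\<le>n. \<Sum>j\<le>n. \<Sum>k\<le>n. c i j k * x ^ i * y ^ j * z ^ k)) \<le> C * (norm x ^ Suc n + norm y ^ Suc n + norm z ^ Suc n)"
    if n: "norm x \<le> r / 4" "norm y \<le> r / 4" "norm z \<le> r / 4" for x y z
  proof -
    have ball: "x \<in> ball 0 r" "y \<in> ball 0 r" "z \<in> ball 0 r" using n r by (auto simp: dist_norm)
    have le1: "norm (x ^ i) \<le> 1" "norm (y ^ i) \<le> 1" for i
      using n r by (auto simp: norm_power intro!: power_le_one)
    define E1 where "E1 = f x y z - (\<Sum>i\<le>n. a i y z * x ^ i)"
    define E2 where "E2 i = a i y z - (\<Sum>j\<le>n. b i j z * y ^ j)" for i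
    define E3 where "E3 i j = b i j z - (\<Sum>k\<le>n. c i j k * z ^ k)" for i j
    have e1: "norm E1 \<le> D * B * norm x ^ Suc n"
      unfolding E1_def a_def D_def using taylor_remainder_le[OF h1[OF ball(2,3)] r(1) B[OF _ ball(2,3)] n(1), of n] by (simp add: mult_ac)
    have e2: "norm (E2 i) \<le> D * Ba i * norm y ^ Suc n" for i
      unfolding E2_def b_def D_def using taylor_remainder_le[OF a1[OF ball(3)] r(1) aB[OF _ ball(3)] n(2), of i n] by (simp add: mult_ac)
    have e3: "norm (E3 i j) \<le> D * Bb i j * norm z ^ Suc n" for i j
      unfolding E3_def c_def D_def using taylor_remainder_le[OF b1 r(1) bB n(3), of i j n] by (simp add: mult_ac)
    have "f x y z - (\<Sum>i\<le>n. \<Sum>j\<le>n. \<Sum>k\<le>n. c i j k * x ^ i * y ^ j * z ^ k)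
       = E1 + (\<Sum>i\<le>n. x ^ i * E2 i) + (\<Sum>i\<le>n. \<Sum>j\<le>n. x ^ i * y ^ j * E3 i j)"
      unfolding E1_def E2_def E3_def
      by (simp add: right_diff_distrib sum_subtractf sum_distrib_left mult_ac)
    also have "norm \<dots> \<le> norm E1 + norm (\<Sum>i\<le>n. x ^ i * E2 i) + norm (\<Sum>i\<le>n. \<Sum>j\<le>n. x ^ i * y ^ j * E3 i j)"
      by (intro norm_triangle_le add_mono) auto
    also have "norm E1 \<le> C * norm x ^ Suc n"
      using e1 mult_right_mono[OF parts(1), of "norm x ^ Suc n"] by simp
    also have "norm (\<Sum>i\<le>n. x ^ i * E2 i) \<le> C * norm y ^ Suc n"
    proof -
      have "norm (\<Sum>i\<le>n. x ^ i * E2 i) \<le> (\<Sum>i\<le>n. D * Ba i * norm y ^ Suc n)"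
        using e2 mult_mono[OF le1(1) e2] D Ba0 by (intro sum_norm_le) (auto simp: norm_mult)
      also have "\<dots> \<le> C * norm y ^ Suc n"
        using mult_right_mono[OF parts(2), of "norm y ^ Suc n"] by (simp add: sum_distrib_right)
      finally show ?thesis .
    qed
    also have "norm (\<Sum>i\<le>n. \<Sum>j\<le>n. x ^ i * y ^ j * E3 i j) \<le> C * norm z ^ Suc n"
    proof -
      have "norm (x ^ i * y ^ j * E3 i j) \<le> D * Bb i j * norm z ^ Suc n" for i j
      proof -
        have "norm (x ^ i * y ^ j) \<le> 1" using mult_mono[OF le1(1)[of i] le1(2)[of j]] by (simp add: norm_mult)
        from mult_mono[OF this e3[of i j]] show ?thesis by (simp add: norm_mult)
      qed
      then have "norm (\<Sum>i\<le>n. \<Sum>j\<le>n. x ^ i * y ^ j * E3 i j) \<le> (\<Sum>i\<le>n. \<Sum>j\<le>n. D * Bb i j * norm z ^ Suc n)"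
        by (intro sum_norm_le) auto
      also have "\<dots> \<le> C * norm z ^ Suc n"
        using mult_right_mono[OF parts(3), of "norm z ^ Suc n"] by (simp add: sum_distrib_right)
      finally show ?thesis .
    qed
    finally show ?thesis by (simp add: distrib_left)
  qed
  then show ?thesis by blast
qed

section \<open>Complex differentiability by components and along lines\<close>

definition complex_derivative_exists :: "(complex^3 \<Rightarrow> complex) \<Rightarrow> complex^3 \<Rightarrow> bool" where
  "complex_derivative_exists f q \<longleftrightarrow> (\<exists>D. (f has_derivative D) (at q) \<and> (\<forall>c x. D (c *s x) = c * D x))"

lemma complex_differentiable_at_iff:
  "complex_differentiable_at F q \<longleftrightarrow> (\<forall>j. complex_derivative_exists (\<lambda>q. F q $ j) q)"
proof
  assume "complex_differentiable_at F q"
  then obtain D where D: "(F has_derivative D) (at q)" "\<And>c x. D (c *s x) = c *s D x"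
    by (auto simp: complex_differentiable_at_def)
  show "\<forall>j. complex_derivative_exists (\<lambda>q. F q $ j) q"
    unfolding complex_derivative_exists_def
    using bounded_linear.has_derivative[OF bounded_linear_vec_nth D(1)] D(2) by fastforce
next
  assume "\<forall>j. complex_derivative_exists (\<lambda>q. F q $ j) q"
  then obtain D where "\<And>j. ((\<lambda>q. F q $ j) has_derivative D j) (at q)" "\<And>j c x. D j (c *s x) = c * D j x"
    unfolding complex_derivative_exists_def by metis
  then show "complex_differentiable_at F q" by (rule complex_differentiable_at_vector)
qed

lemma complex_derivative_exists_const: "complex_derivative_exists (\<lambda>_. c) q"
  unfolding complex_derivative_exists_def by (intro exI[of _ "\<lambda>_. 0"]) auto

lemma complex_derivative_exists_nth: "complex_derivative_exists (\<lambda>q. q $ j) q"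
  unfolding complex_derivative_exists_def
  by (intro exI[of _ "\<lambda>v. v $ j"] conjI bounded_linear.has_derivative[OF bounded_linear_vec_nth] has_derivative_ident) simp

lemma complex_derivative_exists_add:
  assumes "complex_derivative_exists f q" "complex_derivative_exists g q"
  shows "complex_derivative_exists (\<lambda>q. f q + g q) q"
proof -
  obtain D E where "(f has_derivative D) (at q)" "\<And>c x. D (c *s x) = c * D x"
     "(g has_derivative E) (at q)" "\<And>c x. E (c *s x) = c * E x"
    using assms unfolding complex_derivative_exists_def by metis
  then show ?thesis
    unfolding complex_derivative_exists_def
    by (intro exI[of _ "\<lambda>x. D x + E x"]) (auto intro!: has_derivative_add simp: distrib_left)
qed

lemma complex_derivative_exists_mult:
  assumes "complex_derivative_exists f q" "complex_derivative_exists g q"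
  shows "complex_derivative_exists (\<lambda>q. f q * g q) q"
proof -
  obtain D E where d: "(f has_derivative D) (at q)" "\<And>c x. D (c *s x) = c * D x"
     "(g has_derivative E) (at q)" "\<And>c x. E (c *s x) = c * E x"
    using assms unfolding complex_derivative_exists_def by metis
  show ?thesis
    unfolding complex_derivative_exists_def
    by (intro exI[of _ "\<lambda>x. f q * E x + D x * g q"] conjI allI has_derivative_mult d(1,3)) (simp add: d(2,4) algebra_simps)
qed

lemma complex_derivative_exists_power:
  "complex_derivative_exists f q \<Longrightarrow> complex_derivative_exists (\<lambda>q. f q ^ n) q"
  by (induction n) (auto intro: complex_derivative_exists_mult complex_derivative_exists_const)

lemma complex_derivative_exists_sum:
  "(\<And>i. i \<in> I \<Longrightarrow> complex_derivative_exists (f i) q) \<Longrightarrow> complex_derivative_exists (\<lambda>q. \<Sum>i\<in>I. f i q) q"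
  by (induction I rule: infinite_finite_induct) (auto intro: complex_derivative_exists_add complex_derivative_exists_const)

lemma complex_derivative_exists_prod:
  "(\<And>i. i \<in> I \<Longrightarrow> complex_derivative_exists (f i) q) \<Longrightarrow> complex_derivative_exists (\<lambda>q. \<Prod>i\<in>I. f i q) q"
  by (induction I rule: infinite_finite_induct) (auto intro: complex_derivative_exists_mult complex_derivative_exists_const)

lemmas complex_derivative_exists_intros = complex_derivative_exists_const complex_derivative_exists_nth
  complex_derivative_exists_add complex_derivative_exists_mult complex_derivative_exists_power
  complex_derivative_exists_sum complex_derivative_exists_prod

lemma complex_derivative_exists_hpoly: "complex_derivative_exists (hpoly_eval F) q"
  unfolding hpoly_eval_def[abs_def] by (intro complex_derivative_exists_intros)

lemma complex_differentiable_compose: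
  assumes "complex_differentiable_at F (G q)" "complex_differentiable_at G q"
  shows "complex_differentiable_at (\<lambda>q. F (G q)) q"
proof -
  obtain D E where "(F has_derivative D) (at (G q))" "\<And>c x. D (c *s x) = c *s D x"
     "(G has_derivative E) (at q)" "\<And>c x. E (c *s x) = c *s E x"
    using assms unfolding complex_differentiable_at_def by metis
  then show ?thesis
    unfolding complex_differentiable_at_def
    by (intro exI[of _ "\<lambda>x. D (E x)"]) (auto intro: has_derivative_compose)
qed

lemma bounded_linear_vector_smult: "bounded_linear (\<lambda>t::complex. t *s (x :: complex^3))"
  unfolding linear_conv_bounded_linear[symmetric]
  by (rule linearI) (simp_all add: vec_eq_iff algebra_simps)

lemma field_differentiable_along_line:
  fixes F :: "complex^3 \<Rightarrow> complex^3"
  assumes "(F has_derivative D) (at (a + \<zeta> *s x))" "\<And>c x. D (c *s x) = c *s D x"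
  shows "((\<lambda>\<zeta>. F (a + \<zeta> *s x) $ j) has_field_derivative (D x $ j)) (at \<zeta>)"
proof -
  have "((\<lambda>\<zeta>. a + \<zeta> *s x) has_derivative (\<lambda>t. 0 + t *s x)) (at \<zeta>)"
    by (intro has_derivative_add has_derivative_const bounded_linear_imp_has_derivative bounded_linear_vector_smult)
  then have "((\<lambda>\<zeta>. a + \<zeta> *s x) has_derivative (\<lambda>t. t *s x)) (at \<zeta>)" by simp
  from bounded_linear.has_derivative[OF bounded_linear_vec_nth has_derivative_compose[OF this assms(1)], of j]
  show ?thesis by (simp add: has_field_derivative_def assms(2) mult_commute_abs)
qed

text \<open>Restriction to complex lines makes the one-variable theory available for maps of three
  variables.\<close>

lemma holomorphic_slice:
  fixes F :: "complex^3 \<Rightarrow> complex^3"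
  assumes "\<And>x. x \<in> S \<Longrightarrow> complex_differentiable_at F (a + x *s v)" "open S"
  shows "(\<lambda>x. F (a + x *s v) $ j) holomorphic_on S"
  unfolding holomorphic_on_open[OF assms(2)]
proof
  fix x assume "x \<in> S"
  then obtain D where "(F has_derivative D) (at (a + x *s v))" "\<And>c x. D (c *s x) = c *s D x"
    using assms(1) unfolding complex_differentiable_at_def by metis
  from field_differentiable_along_line[OF this]
  show "\<exists>f'. ((\<lambda>x. F (a + x *s v) $ j) has_field_derivative f') (at x)" by blast
qed

text \<open>An expression polynomial in s that is o(s^m) as s tends to 0 from the right has no terms
  up to order m. Several indices may share an exponent, so only the sum of their coefficients is
  determined.\<close>

lemma power_sum_coefficients_eq_0:
  fixes \<alpha> :: "'a \<Rightarrow> complex" and e :: "'a \<Rightarrow> nat"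
  assumes fin: "finite K" and lim: "((\<lambda>s::real. (\<Sum>x\<in>K. \<alpha> x * of_real s ^ e x) / of_real s ^ m) \<longlongrightarrow> 0) (at_right 0)"
    and k: "k \<le> m"
  shows "(\<Sum>x | x \<in> K \<and> e x = k. \<alpha> x) = 0"
  using k
proof (induction k rule: less_induct)
  case (less k)
  define L where "L = {x \<in> K. k \<le> e x}"
  have small: "(\<Sum>x | x \<in> K \<and> \<not> k \<le> e x. \<alpha> x * of_real s ^ e x) = 0" for s :: real
  proof -
    have "(\<Sum>x | x \<in> K \<and> \<not> k \<le> e x. \<alpha> x * of_real s ^ e x)
      = (\<Sum>i<k. \<Sum>x | x \<in> {x \<in> K. \<not> k \<le> e x} \<and> e x = i. \<alpha> x * of_real s ^ e x)"
      by (rule sum.group[symmetric]) (use fin in auto)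
    also have "\<dots> = (\<Sum>i<k. (\<Sum>x | x \<in> K \<and> e x = i. \<alpha> x) * of_real s ^ i)"
      unfolding sum_distrib_right by (intro sum.cong) auto
    also have "\<dots> = 0" using less by (intro sum.neutral) auto
    finally show ?thesis .
  qed
  have split: "(\<Sum>x\<in>K. \<alpha> x * of_real s ^ e x) = (\<Sum>x\<in>L. \<alpha> x * of_real s ^ e x)" for s :: real
  proof -
    have "K = L \<union> {x \<in> K. \<not> k \<le> e x}" by (auto simp: L_def)
    then have "(\<Sum>x\<in>K. \<alpha> x * of_real s ^ e x) = (\<Sum>x\<in>L. \<alpha> x * of_real s ^ e x) + (\<Sum>x\<in>{x \<in> K. \<not> k \<le> e x}. \<alpha> x * of_real s ^ e x)"
      using fin sum.union_disjoint[of L "{x \<in> K. \<not> k \<le> e x}" "\<lambda>x. \<alpha> x * of_real s ^ e x"] by (auto simp: L_def)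
    with small show ?thesis by simp
  qed
  have "((\<lambda>s::real. \<Sum>x\<in>L. \<alpha> x * of_real s ^ (e x - k)) \<longlongrightarrow> (\<Sum>x\<in>L. \<alpha> x * of_real 0 ^ (e x - k))) (at_right 0)"
    by (intro tendsto_intros)
  moreover have "((\<lambda>s::real. \<Sum>x\<in>L. \<alpha> x * of_real s ^ (e x - k)) \<longlongrightarrow> 0) (at_right 0)"
  proof -
    have "((\<lambda>s::real. (\<Sum>x\<in>K. \<alpha> x * of_real s ^ e x) / of_real s ^ m * of_real s ^ (m - k)) \<longlongrightarrow> 0 * of_real 0 ^ (m - k)) (at_right 0)"
      by (intro tendsto_intros lim)
    then have "((\<lambda>s::real. (\<Sum>x\<in>K. \<alpha> x * of_real s ^ e x) / of_real s ^ m * of_real s ^ (m - k)) \<longlongrightarrow> 0) (at_right 0)" by simp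
    moreover have "\<forall>\<^sub>F s::real in at_right 0. (\<Sum>x\<in>K. \<alpha> x * of_real s ^ e x) / of_real s ^ m * of_real s ^ (m - k)
       = (\<Sum>x\<in>L. \<alpha> x * of_real s ^ (e x - k))"
      using eventually_at_right_less
    proof eventually_elim
      case (elim s)
      have m: "(of_real s :: complex) ^ m = of_real s ^ (m - k) * of_real s ^ k" using less.prems by (simp flip: power_add)
      have "(\<Sum>x\<in>K. \<alpha> x * of_real s ^ e x) = (\<Sum>x\<in>L. \<alpha> x * of_real s ^ (e x - k)) * of_real s ^ k"
        unfolding split sum_distrib_right mult.assoc by (intro sum.cong) (auto simp: L_def simp flip: power_add)
      then show ?case unfolding m using elim by simp
    qed
    ultimately show ?thesis by (rule Lim_transform_eventually)
  qed
  ultimately have "(\<Sum>x\<in>L. \<alpha> x * of_real 0 ^ (e x - k)) = 0"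
    by (rule tendsto_unique[OF trivial_limit_at_right_real])
  also have "(\<Sum>x\<in>L. \<alpha> x * of_real 0 ^ (e x - k)) = (\<Sum>x\<in>L. if e x = k then \<alpha> x else 0)"
    by (intro sum.cong) (auto simp: L_def power_0_left)
  also have "\<dots> = (\<Sum>x | x \<in> K \<and> e x = k. \<alpha> x)"
    unfolding L_def using fin by (subst sum.inter_filter[symmetric]) (auto intro!: sum.cong)
  finally show ?case .
qed

section \<open>The tangent field of a balanced model and its transport\<close>

definition balanced_field :: "real \<times> real \<Rightarrow> complex^3 \<Rightarrow> complex^3" where
  "balanced_field \<Lambda> v = vector [of_real (fst \<Lambda>) * (v $ 1 * v $ 3), of_real (snd \<Lambda>) * (v $ 2 * v $ 3), (v $ 3)\<^sup>2]"

lemma euler_identity: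
  assumes "\<And>m. m \<in> Poly_Mapping.keys Q \<Longrightarrow> weighted_length \<Lambda> (fst m) = 1"
  shows "const_zpoly (of_real (fst \<Lambda>)) * var_z1 * pd1 Q + const_zpoly (of_real (snd \<Lambda>)) * var_z2 * pd2 Q = Q"
proof -
  define E where "E F = const_zpoly (of_real (fst \<Lambda>)) * var_z1 * pd1 F + const_zpoly (of_real (snd \<Lambda>)) * var_z2 * pd2 F" for F
  have E_add: "E (F + G) = E F + E G" for F G
    by (simp add: E_def derivation_add[OF derivation_pd1] derivation_add[OF derivation_pd2] algebra_simps)
  have E_lookup: "Poly_Mapping.lookup (E F) m = of_real (weighted_length \<Lambda> (fst m)) * Poly_Mapping.lookup F m" for F m
  proof (induction F rule: poly_mapping_additive_induct)
    case (single n c)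
    obtain a1 a2 b1 b2 where n: "n = ((a1, a2), b1, b2)" by (metis surj_pair)
    have "E (Poly_Mapping.single n c) = Poly_Mapping.single n (of_real (weighted_length \<Lambda> (fst n)) * c)"
      unfolding E_def n pd_single var_z1_def var_z2_def const_zpoly_mult_single mult_single
      by (cases a1; cases a2) (simp_all add: weighted_length_def algebra_simps flip: single_add)
    then show ?case by (auto simp: lookup_single when_def)
  next
    case (add F G)
    then show ?case by (simp only: E_add lookup_add distrib_left)
  qed
  have "E Q = Q"
  proof (rule poly_mapping_eqI)
    show "Poly_Mapping.lookup (E Q) m = Poly_Mapping.lookup Q m" for m
      using assms[of m] by (cases "Poly_Mapping.lookup Q m = 0") (simp_all add: E_lookup in_keys_iff)
  qed
  then show ?thesis by (simp only: E_def)
qed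

text \<open>By Euler's identity the field sends Q to w Q; as Q is real and Im w = Q on the model, Im
  (w^2) - 2 Re (w Q) = 0.\<close>

lemma balanced_field_tangent:
  assumes Q: "conj_zpoly Q = Q" and \<Lambda>: "\<And>m. m \<in> Poly_Mapping.keys Q \<Longrightarrow> weighted_length \<Lambda> (fst m) = 1"
    and v: "v \<in> model_hypersurface Q"
  shows "frechet_derivative (model_function Q) (at v) (balanced_field \<Lambda> v) = 0"
proof -
  let ?q = "zpoly_eval Q (v $ 1) (v $ 2)"
  have "?q = of_real (Re ?q)" using zpoly_eval_conj[of Q "v $ 1" "v $ 2"] by (simp add: Q complex_eq_iff)
  moreover have "Im (v $ 3) = Re ?q" using v by (simp add: model_hypersurface_def model_function_def)
  moreover have "zpoly_eval (pd1 Q) (v $ 1) (v $ 2) * balanced_field \<Lambda> v $ 1 + zpoly_eval (pd2 Q) (v $ 1) (v $ 2) * balanced_field \<Lambda> v $ 2 = v $ 3 * ?q"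
    using arg_cong[OF euler_identity[OF \<Lambda>], where f = "\<lambda>F. v $ 3 * zpoly_eval F (v $ 1) (v $ 2)"]
    by (simp add: balanced_field_def zpoly_eval_simps zpoly_eval_vars algebra_simps)
  ultimately show ?thesis
    unfolding frechet_derivative_at[OF has_derivative_model_function[OF Q], symmetric]
    by (simp add: balanced_field_def power2_eq_square) (metis Re_complex_of_real mult.commute mult_zero_right Im_complex_of_real diff_zero)
qed

text \<open>Every vector tangent to the graph \<open>v = Q\<close> is the velocity of a curve in the graph.\<close>

lemma tangent_transport:
  assumes P: "conj_zpoly P = P" and Q: "conj_zpoly Q = Q"
    and V: "open V" "v \<in> V" and v: "v \<in> model_hypersurface Q"
    and \<Psi>: "(\<Psi> has_derivative D) (at v)" "\<And>y. y \<in> V \<Longrightarrow> y \<in> model_hypersurface Q \<Longrightarrow> \<Psi> y \<in> model_hypersurface P"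
    and x: "frechet_derivative (model_function Q) (at v) x = 0"
  shows "frechet_derivative (model_function P) (at (\<Psi> v)) (D x) = 0"
proof -
  \<comment> \<open>The straight line with velocity x, moved in the Im w direction onto the graph.
    The correction has derivative 0 at t = 0 because x is tangent.\<close>
  define \<gamma> :: "real \<Rightarrow> complex^3" where
    "\<gamma> t = v + t *\<^sub>R x - (\<i> * of_real (model_function Q (v + t *\<^sub>R x))) *s axis 3 1" for t
  have lin: "((\<lambda>t. v + t *\<^sub>R x) has_derivative (\<lambda>t. t *\<^sub>R x)) (at 0)"
    by (auto intro!: derivative_eq_intros)
  have "(model_function Q has_derivative frechet_derivative (model_function Q) (at v)) (at (v + 0 *\<^sub>R x))"
    using has_derivative_model_function[OF Q] frechet_derivative_at by (simp add: frechet_derivative_works[symmetric] differentiable_def) blast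
  from has_derivative_compose[OF lin this]
  have "((\<lambda>t. model_function Q (v + t *\<^sub>R x)) has_derivative (\<lambda>t. frechet_derivative (model_function Q) (at v) (t *\<^sub>R x))) (at 0)" .
  moreover have "frechet_derivative (model_function Q) (at v) (t *\<^sub>R x) = 0" for t
  proof -
    have "linear (frechet_derivative (model_function Q) (at v))"
      by (rule linear_frechet_derivative) (use has_derivative_model_function[OF Q] differentiable_def in blast)
    then show ?thesis by (simp add: linear_scale x)
  qed
  ultimately have m0: "((\<lambda>t. model_function Q (v + t *\<^sub>R x)) has_derivative (\<lambda>t. 0)) (at 0)" by simp
  have bl: "bounded_linear (\<lambda>c. (\<i> * of_real c) *s axis 3 (1::complex) :: complex^3)"
    unfolding linear_conv_bounded_linear[symmetric]
    by (rule linearI; simp add: vec_eq_iff; simp add: scaleR_conv_of_real algebra_simps)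
  have "(\<gamma> has_derivative (\<lambda>t. t *\<^sub>R x - (\<i> * of_real 0) *s axis 3 1)) (at 0)"
    unfolding \<gamma>_def by (intro has_derivative_diff lin bounded_linear.has_derivative[OF bl m0])
  then have \<gamma>': "(\<gamma> has_derivative (\<lambda>t. t *\<^sub>R x)) (at 0)" by simp
  have \<gamma>0: "\<gamma> 0 = v" using v by (simp add: \<gamma>_def model_hypersurface_def)
  have \<gamma>Q: "\<gamma> t \<in> model_hypersurface Q" for t
    by (simp add: \<gamma>_def model_hypersurface_def model_function_def axis_def)
  have "\<forall>\<^sub>F t in nhds 0. \<gamma> t \<in> V"
  proof -
    have "(\<gamma> \<longlongrightarrow> \<gamma> 0) (at 0)"
      using has_derivative_continuous[OF \<gamma>'] by (simp only: continuous_within)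
    then have "(\<gamma> \<longlongrightarrow> \<gamma> 0) (nhds 0)" by (simp only: tendsto_at_iff_tendsto_nhds)
    from topological_tendstoD[OF this V(1)] show ?thesis using V(2) \<gamma>0 by simp
  qed
  then have ev: "\<forall>\<^sub>F t in nhds 0. model_function P (\<Psi> (\<gamma> t)) = 0"
    by eventually_elim (use \<gamma>Q \<Psi>(2) in \<open>auto simp: model_hypersurface_def\<close>)
  have P': "(model_function P has_derivative frechet_derivative (model_function P) (at (\<Psi> v))) (at (\<Psi> v))"
    using has_derivative_model_function[OF P] frechet_derivative_works differentiable_def by blast
  have "((\<lambda>t. model_function P (\<Psi> (\<gamma> t))) has_derivative (\<lambda>t. frechet_derivative (model_function P) (at (\<Psi> v)) (D (t *\<^sub>R x)))) (at 0)"
    by (rule has_derivative_compose[OF has_derivative_compose[OF \<gamma>', of \<Psi> D]]) (use \<gamma>0 \<Psi>(1) P' in simp_all)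
  moreover have "((\<lambda>t. model_function P (\<Psi> (\<gamma> t))) has_derivative (\<lambda>t. 0)) (at 0)"
  proof -
    obtain S where S: "open S" "(0::real) \<in> S" "\<And>t. t \<in> S \<Longrightarrow> model_function P (\<Psi> (\<gamma> t)) = 0"
      using ev by (auto simp: eventually_nhds)
    show ?thesis by (rule has_derivative_transform_within_open[of "\<lambda>_. 0" _ _ _ S]) (use S in auto)
  qed
  ultimately have "(\<lambda>t. frechet_derivative (model_function P) (at (\<Psi> v)) (D (t *\<^sub>R x))) = (\<lambda>t. 0)"
    by (rule has_derivative_unique)
  from fun_cong[OF this, of 1] show ?thesis by simp
qed

subsection \<open>Dimension\<close>

lemma abs_vf_germ_add: "holomorphic_near_0 F \<Longrightarrow> holomorphic_near_0 G \<Longrightarrow> abs_vf_germ F + abs_vf_germ G = abs_vf_germ (\<lambda>q. F q + G q)"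
  by (rule plus_vf_germ.abs_eq) (auto intro: germ_rel_refl)

lemma abs_vf_germ_scaleR: "holomorphic_near_0 F \<Longrightarrow> c *\<^sub>R abs_vf_germ F = abs_vf_germ (\<lambda>q. c *\<^sub>R F q)"
  by (rule scaleR_vf_germ.abs_eq) (auto intro: germ_rel_refl)

lemma abs_vf_germ_sum:
  assumes "\<And>i. i \<in> I \<Longrightarrow> holomorphic_near_0 (F i)"
  shows "holomorphic_near_0 (\<lambda>q. \<Sum>i\<in>I. F i q) \<and> (\<Sum>i\<in>I. abs_vf_germ (F i)) = abs_vf_germ (\<lambda>q. \<Sum>i\<in>I. F i q)"
  using assms
proof (induction I rule: infinite_finite_induct)
  case (insert i I)
  then have "holomorphic_near_0 (F i)" "holomorphic_near_0 (\<lambda>q. \<Sum>i\<in>I. F i q)" by auto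
  with insert show ?case by (auto simp: abs_vf_germ_add intro: holomorphic_near_0_add)
qed (auto simp: zero_vf_germ_def holomorphic_near_0_zero)

text \<open>Positive weights leave only finitely many monomial fields of a given weight, so the
  space has a finite basis. This matters because \<open>dim\<close> is a cardinality, and that of an
  infinite set is 0.\<close>

lemma dim_pos_graded_component:
  assumes \<mu>: "fst \<mu> > 0" "snd \<mu> > 0" and X: "X \<in> graded_component P \<mu> \<nu>" "X \<noteq> 0"
  shows "dim (graded_component P \<mu> \<nu>) > 0"
proof -
  define M where "M j = {m :: 3 \<Rightarrow> nat. (\<Sum>k\<in>UNIV. coordinate_weight \<mu> k * real (m k)) - coordinate_weight \<mu> j = \<nu>}" for j
  define G where "G j m c = (\<lambda>q::complex^3. axis j (c * (\<Prod>i\<in>UNIV. (q $ i) ^ m i)) :: complex^3)" for j m c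
  have hG: "holomorphic_near_0 (G j m c)" for j m c
    unfolding holomorphic_near_0_def complex_differentiable_at_iff
  proof (intro always_eventually allI)
    show "complex_derivative_exists (\<lambda>q. G j m c q $ i) q" for q i
      by (cases "i = j") (simp_all add: G_def axis_def, (intro complex_derivative_exists_intros)+)
  qed
  have fin: "finite (M j)" for j
  proof -
    define w where "w = min (fst \<mu>) (min (snd \<mu>) 1)"
    have w: "w > 0" "coordinate_weight \<mu> k \<ge> w" for k using \<mu> by (auto simp: w_def coordinate_weight_def)
    define N where "N = nat \<lceil>(\<nu> + coordinate_weight \<mu> j) / w\<rceil>"
    have "M j \<subseteq> PiE UNIV (\<lambda>_. {..N})"
    proof
      fix m assume m: "m \<in> M j"
      have "m k \<le> N" for k
      proof -
      from m have s: "(\<Sum>k\<in>UNIV. coordinate_weight \<mu> k * real (m k)) = \<nu> + coordinate_weight \<mu> j" by (simp add: M_def algebra_simps)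
      have "w * real (m k) \<le> coordinate_weight \<mu> k * real (m k)" using w(2) by (intro mult_right_mono) auto
      also have "\<dots> \<le> (\<Sum>k\<in>UNIV. coordinate_weight \<mu> k * real (m k))"
        using order_trans[OF less_imp_le[OF w(1)] w(2)] by (intro member_le_sum) simp_all
      finally have "real (m k) \<le> (\<nu> + coordinate_weight \<mu> j) / w" using w(1) s by (simp add: field_simps)
      then show ?thesis unfolding N_def by linarith
      qed
      then show "m \<in> PiE UNIV (\<lambda>_. {..N})" by (auto simp: PiE_UNIV_domain)
    qed
    then show ?thesis by (rule finite_subset) (simp add: finite_PiE)
  qed
  \<comment> \<open>The vector space is real, so each monomial field enters with the coefficients 1
    and \<i>.\<close>
  define B where "B = (\<Union>j. \<Union>m\<in>M j. {abs_vf_germ (G j m 1), abs_vf_germ (G j m \<i>)})"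
  have finB: "finite B" unfolding B_def using fin by auto
  have sub: "graded_component P \<mu> \<nu> \<subseteq> span B"
  proof
    fix Y assume Y: "Y \<in> graded_component P \<mu> \<nu>"
    obtain V where V: "holomorphic_near_0 V" "Y = abs_vf_germ V" by (rule vf_germ_cases)
    have "has_weight \<mu> \<nu> (abs_vf_germ V)" using Y V by (simp add: graded_component_def)
    then obtain F :: "3 \<Rightarrow> hpoly" where F: "\<forall>j. \<forall>m\<in>Poly_Mapping.keys (F j). (\<Sum>k\<in>UNIV. coordinate_weight \<mu> k * real (m k)) - coordinate_weight \<mu> j = \<nu>"
      and VF: "\<forall>\<^sub>F q in nhds 0. \<forall>j. V q $ j = hpoly_eval (F j) q"
      unfolding has_weight_abs[OF V(1)] by blast
    define T where "T j m = (\<lambda>q. G j m (Poly_Mapping.lookup (F j) m) q)" for j m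
    have T: "abs_vf_germ (T j m) \<in> span B" if "m \<in> Poly_Mapping.keys (F j)" for j m
    proof -
      let ?c = "Poly_Mapping.lookup (F j) m"
      have m: "m \<in> M j" using F that by (simp add: M_def)
      have "T j m = (\<lambda>q. Re ?c *\<^sub>R G j m 1 q + Im ?c *\<^sub>R G j m \<i> q)"
        by (rule ext) (auto simp: T_def G_def vec_eq_iff axis_def complex_eq_iff algebra_simps)
      then have "abs_vf_germ (T j m) = Re ?c *\<^sub>R abs_vf_germ (G j m 1) + Im ?c *\<^sub>R abs_vf_germ (G j m \<i>)"
        by (simp add: abs_vf_germ_scaleR hG abs_vf_germ_add holomorphic_near_0_scaleR)
      moreover have "abs_vf_germ (G j m 1) \<in> B" "abs_vf_germ (G j m \<i>) \<in> B" using m by (auto simp: B_def)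
      ultimately show ?thesis by (auto intro: span_add span_scale span_base)
    qed
    define S where "S q = (\<Sum>j\<in>UNIV. \<Sum>m\<in>Poly_Mapping.keys (F j). T j m q)" for q
    have hT: "holomorphic_near_0 (T j m)" for j m unfolding T_def by (rule hG)
    have h: "holomorphic_near_0 (\<lambda>q. \<Sum>m\<in>Poly_Mapping.keys (F j). T j m q)"
      and e: "(\<Sum>m\<in>Poly_Mapping.keys (F j). abs_vf_germ (T j m)) = abs_vf_germ (\<lambda>q. \<Sum>m\<in>Poly_Mapping.keys (F j). T j m q)" for j
      using abs_vf_germ_sum[of "Poly_Mapping.keys (F j)" "T j", OF hT] by (rule conjunct1, rule conjunct2)
    have "holomorphic_near_0 S \<and> (\<Sum>j\<in>UNIV. abs_vf_germ (\<lambda>q. \<Sum>m\<in>Poly_Mapping.keys (F j). T j m q)) = abs_vf_germ S"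
      unfolding S_def[abs_def] by (rule abs_vf_germ_sum[OF h])
    then have s2: "holomorphic_near_0 S" "(\<Sum>j\<in>UNIV. \<Sum>m\<in>Poly_Mapping.keys (F j). abs_vf_germ (T j m)) = abs_vf_germ S"
      by (simp_all only: e)
    have "S q $ i = hpoly_eval (F i) q" for q i
    proof -
      have "S q $ i = (\<Sum>j\<in>UNIV. \<Sum>m\<in>Poly_Mapping.keys (F j). T j m q $ i)" by (simp add: S_def)
      also have "\<dots> = (\<Sum>j\<in>UNIV. if j = i then hpoly_eval (F i) q else 0)"
        by (intro sum.cong) (auto simp: T_def G_def axis_def hpoly_eval_def)
      finally show ?thesis by simp
    qed
    then have "\<forall>\<^sub>F q in nhds 0. V q = S q" using VF by (auto simp: vec_eq_iff elim: eventually_mono)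
    then have "Y = abs_vf_germ S" unfolding V(2) abs_vf_germ_eq_iff[OF V(1) s2(1)] .
    also have "\<dots> \<in> span B" unfolding s2(2)[symmetric] by (intro span_sum T)
    finally show "Y \<in> span B" .
  qed
  obtain C where C: "C \<subseteq> graded_component P \<mu> \<nu>" "independent C" "graded_component P \<mu> \<nu> \<subseteq> span C" "card C = dim (graded_component P \<mu> \<nu>)"
    by (rule basis_exists)
  have "finite C" using independent_span_bound[OF finB C(2)] C(1) sub by blast
  moreover have "C \<noteq> {}" using C(3) X by auto
  ultimately show ?thesis using C(4) by (metis card_gt_0_iff)
qed

subsection \<open>Pulling back the vector field of a balanced model\<close>

lemma norm_vector_smult: "norm (c *s (x :: complex^3)) = cmod c * norm x"
  by (simp add: norm_vec_def norm_mult L2_set_right_distrib)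

text \<open>\<open>\<Phi>\<close> maps the germ of the model of \<open>P\<close> holomorphically to
  that of the balanced model of \<open>Q\<close>, with local inverse \<open>\<Psi>\<close>. It need
  not be polynomial or compatible with the weights.\<close>

locale model_equivalence =
  fixes P Q :: zpoly and \<Lambda> :: "real \<times> real" and \<Phi> \<Psi> :: "complex^3 \<Rightarrow> complex^3" and U V :: "(complex^3) set"
  assumes P: "conj_zpoly P = P" "no_pluriharmonic_terms P" and Q: "conj_zpoly Q = Q" "no_pluriharmonic_terms Q"
    and balanced_Q: "\<And>m. m \<in> Poly_Mapping.keys Q \<Longrightarrow> weighted_length \<Lambda> (fst m) = 1"
    and UV: "open U" "0 \<in> U" "open V" "0 \<in> V" "\<Phi> 0 = 0" "\<Psi> 0 = 0"
    and \<Phi>_hol: "\<And>q. q \<in> U \<Longrightarrow> complex_differentiable_at \<Phi> q"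
    and \<Psi>_hol: "\<And>v. v \<in> V \<Longrightarrow> complex_differentiable_at \<Psi> v"
    and inverse: "\<And>q. q \<in> U \<Longrightarrow> \<Phi> q \<in> V" "\<And>q. q \<in> U \<Longrightarrow> \<Psi> (\<Phi> q) = q"
    and \<Phi>_model: "\<And>q. q \<in> U \<Longrightarrow> q \<in> model_hypersurface P \<Longrightarrow> \<Phi> q \<in> model_hypersurface Q"
    and \<Psi>_model: "\<And>v. v \<in> V \<Longrightarrow> v \<in> model_hypersurface Q \<Longrightarrow> \<Psi> v \<in> model_hypersurface P"
begin

definition "D v = frechet_derivative \<Psi> (at v)"

lemma D: "v \<in> V \<Longrightarrow> (\<Psi> has_derivative D v) (at v)" and D_smult: "v \<in> V \<Longrightarrow> D v (c *s x) = c *s D v x"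
proof -
  assume "v \<in> V"
  then obtain E where E: "(\<Psi> has_derivative E) (at v)" "\<And>c x. E (c *s x) = c *s E x"
    using \<Psi>_hol[OF \<open>v \<in> V\<close>] unfolding complex_differentiable_at_def by blast
  then have "D v = E" unfolding D_def by (simp add: frechet_derivative_at[symmetric])
  with E show "(\<Psi> has_derivative D v) (at v)" "D v (c *s x) = c *s D v x" by simp_all
qed

text \<open>The pull-back by \<open>\<Phi>\<close> of the tangent field of the balanced
  model.\<close>

definition W :: "complex^3 \<Rightarrow> complex^3" where "W q = D (\<Phi> q) (balanced_field \<Lambda> (\<Phi> q))"

lemma W_tangent:
  assumes "q \<in> U" "q \<in> model_hypersurface P"
  shows "Re (vf_apply W (model_function P) q) = 0"
proof -
  have "frechet_derivative (model_function P) (at (\<Psi> (\<Phi> q))) (D (\<Phi> q) (balanced_field \<Lambda> (\<Phi> q))) = 0"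
    using assms
    by (intro tangent_transport[OF P(1) Q(1) UV(3) inverse(1) \<Phi>_model D[OF inverse(1)] \<Psi>_model] balanced_field_tangent[OF Q(1) balanced_Q] \<Phi>_model) auto
  then show ?thesis by (simp add: Re_vf_apply_model[OF P(1)] W_def inverse(2)[OF assms(1)])
qed

lemma zpoly_eval_pd_0:
  assumes "no_pluriharmonic_terms F"
  shows "zpoly_eval (pd1 F) 0 0 = 0" "zpoly_eval (pd2 F) 0 0 = 0"
proof -
  have "zpoly_eval (\<delta> F) 0 0 = 0" if \<delta>: "hol_derivation \<delta>" for \<delta>
    unfolding zpoly_eval_def
  proof (intro sum.neutral ballI)
    fix n assume "n \<in> Poly_Mapping.keys (\<delta> F)"
    then obtain m where m: "m \<in> Poly_Mapping.keys F" "snd n = snd m" using keys_hol_derivation[OF \<delta>] by metis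
    have "snd n \<noteq> (0, 0)" using assms m by (auto simp: no_pluriharmonic_terms_def case_prod_unfold)
    then show "(case n of (x, xa) \<Rightarrow> (case x of (a1, a2) \<Rightarrow> \<lambda>(b1, b2). Poly_Mapping.lookup (\<delta> F) ((a1, a2), b1, b2) * 0 ^ a1 * 0 ^ a2 * cnj 0 ^ b1 * cnj 0 ^ b2) xa) = 0"
      by (cases n) (auto simp: power_0_left split: if_splits)
  qed
  from this[OF hol_derivation_pd1] this[OF hol_derivation_pd2]
  show "zpoly_eval (pd1 F) 0 0 = 0" "zpoly_eval (pd2 F) 0 0 = 0" .
qed

text \<open>The tangent space of either model at 0 is Im w = 0. Its largest complex subspace w = 0
  is therefore preserved by the complex linear map \<open>D 0\<close>, so the w-component of the
  image depends on the w-component only.\<close>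

lemma D_0_third: "D 0 x $ 3 = x $ 3 * D 0 (axis 3 1) $ 3"
proof -
  have d0: "frechet_derivative (model_function F) (at 0) y = Im (y $ 3)" if "conj_zpoly F = F" "no_pluriharmonic_terms F" for F y
    unfolding frechet_derivative_at[OF has_derivative_model_function[OF that(1)], symmetric]
    by (simp add: zpoly_eval_pd_0[OF that(2)])
  have mem: "0 \<in> model_hypersurface Q"
    by (simp add: model_hypersurface_def model_function_def zpoly_eval_0_0[OF Q(2)])
  have Im0: "Im (D 0 y $ 3) = 0" if "Im (y $ 3) = 0" for y
    using tangent_transport[OF P(1) Q(1) UV(3,4) mem D[OF UV(4)] \<Psi>_model, of y] that
    by (simp add: d0[OF P] d0[OF Q] UV(6))
  have zero: "D 0 y $ 3 = 0" if "y $ 3 = 0" for y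
    using Im0[of y] Im0[of "\<i> *s y"] that by (simp add: D_smult[OF UV(4)] complex_eq_iff)
  have "linear (D 0)" using D[OF UV(4)] has_derivative_linear by blast
  then have "D 0 x = D 0 (x - x $ 3 *s axis 3 1) + x $ 3 *s D 0 (axis 3 1)"
    by (simp add: linear_diff D_smult[OF UV(4)])
  moreover have "D 0 (x - x $ 3 *s axis 3 1) $ 3 = 0" by (rule zero) (simp add: axis_def)
  ultimately show ?thesis by simp
qed

text \<open>The image of the direction d/dw under the differential of \<open>\<Phi>\<close> at 0.
  Its third component is nonzero by \<open>\<epsilon>_third\<close>.\<close>

definition "\<epsilon> = frechet_derivative \<Phi> (at 0) (axis 3 1)"

lemma \<Phi>_line: "((\<lambda>s::real. \<Phi> (axis 3 (of_real s)) $ j / of_real s) \<longlongrightarrow> \<epsilon> $ j) (at_right 0)"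
  and \<epsilon>_third: "\<epsilon> $ 3 * D 0 (axis 3 1) $ 3 = 1"
proof -
  obtain E where E: "(\<Phi> has_derivative E) (at 0)" "\<And>c x. E (c *s x) = c *s E x"
    using \<Phi>_hol[OF UV(2)] by (auto simp: complex_differentiable_at_def)
  have \<epsilon>: "\<epsilon> = E (axis 3 1)" unfolding \<epsilon>_def by (simp add: frechet_derivative_at[OF E(1), symmetric])
  have "((\<lambda>\<zeta>. \<Phi> (0 + \<zeta> *s axis 3 1) $ j) has_field_derivative E (axis 3 1) $ j) (at 0)"
    by (rule field_differentiable_along_line) (use E in simp_all)
  then have "((\<lambda>\<zeta>. \<Phi> (axis 3 \<zeta>) $ j / \<zeta>) \<longlongrightarrow> \<epsilon> $ j) (at 0)"
  proof -
    have "\<zeta> *s axis 3 1 = (axis 3 \<zeta> :: complex^3)" for \<zeta> by (simp add: vec_eq_iff axis_def)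
    then show ?thesis
      using \<open>((\<lambda>\<zeta>. \<Phi> (0 + \<zeta> *s axis 3 1) $ j) has_field_derivative E (axis 3 1) $ j) (at 0)\<close>
      by (simp add: has_field_derivative_iff UV(5) \<epsilon> axis_def flip: zero_vec_def)
  qed
  moreover have "filterlim complex_of_real (at 0) (at_right 0)"
    by (rule filterlim_atI) (auto intro!: tendsto_eq_intros simp: eventually_at_filter)
  ultimately show "((\<lambda>s::real. \<Phi> (axis 3 (of_real s)) $ j / of_real s) \<longlongrightarrow> \<epsilon> $ j) (at_right 0)"
    by (rule filterlim_compose)
  have "((\<lambda>q. \<Psi> (\<Phi> q)) has_derivative (\<lambda>x. D 0 (E x))) (at 0)"
    using has_derivative_compose[OF E(1), of \<Psi> "D 0"] D[OF UV(4)] UV(5) by simp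
  moreover have "((\<lambda>q. \<Psi> (\<Phi> q)) has_derivative (\<lambda>x. x)) (at 0)"
    by (rule has_derivative_transform_within_open[of "\<lambda>x. x" _ _ _ U]) (use UV inverse(2) in auto)
  ultimately have "(\<lambda>x. D 0 (E x)) = (\<lambda>x. x)" by (rule has_derivative_unique)
  from fun_cong[OF this, of "axis 3 1"] have "D 0 \<epsilon> = axis 3 1" by (simp add: \<epsilon>)
  then show "\<epsilon> $ 3 * D 0 (axis 3 1) $ 3 = 1"
    using D_0_third[of \<epsilon>] by (simp add: axis_def)
qed

text \<open>Writing the differential as a Taylor coefficient along a line lets the parameter lemmas
  prove regularity of \<open>D\<close> and \<open>W\<close>.\<close>

lemma taylor_coeff_D:
  assumes "v \<in> V"
  shows "taylor_coeff 1 (\<lambda>\<zeta>. \<Psi> (v + \<zeta> *s x) $ j) = D v x $ j"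
proof -
  have "((\<lambda>\<zeta>. \<Psi> (v + \<zeta> *s x) $ j) has_field_derivative D v x $ j) (at 0)"
    by (rule field_differentiable_along_line) (use D[OF assms] D_smult[OF assms] in simp_all)
  then show ?thesis by (simp add: taylor_coeff_def DERIV_imp_deriv)
qed

lemma bounded_near_0: "\<exists>\<rho>>0. ball 0 \<rho> \<subseteq> V \<and> (\<forall>v\<in>ball 0 \<rho>. \<forall>j. cmod (\<Psi> v $ j) \<le> 1)"
proof -
  obtain \<rho>1 where \<rho>1: "\<rho>1 > 0" "ball 0 \<rho>1 \<subseteq> V" using UV open_contains_ball by blast
  have "isCont \<Psi> 0" using D[OF UV(4)] has_derivative_continuous by blast
  then obtain \<rho>2 where \<rho>2: "\<rho>2 > 0" "\<And>v. dist v 0 < \<rho>2 \<Longrightarrow> dist (\<Psi> v) 0 < 1"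
    unfolding continuous_at_eps_delta UV(6) by (metis zero_less_one UV(6))
  have "cmod (\<Psi> v $ j) \<le> 1" if "v \<in> ball 0 (min \<rho>1 \<rho>2)" for v j
  proof -
    have "cmod (\<Psi> v $ j) \<le> norm (\<Psi> v)" by (rule Finite_Cartesian_Product.norm_nth_le)
    also have "\<dots> \<le> 1" using \<rho>2(2)[of v] that by (simp add: dist_commute)
    finally show ?thesis .
  qed
  then show ?thesis using \<rho>1 \<rho>2 by (intro exI[of _ "min \<rho>1 \<rho>2"]) auto
qed

lemma continuous_D: "\<exists>\<rho>>0. ball 0 \<rho> \<subseteq> V \<and> (\<forall>M>0. \<forall>j. continuous_on (ball 0 \<rho> \<times> ball 0 M) (\<lambda>(v, x). D v x $ j))"
proof -
  obtain \<rho> where \<rho>: "\<rho> > 0" "ball 0 \<rho> \<subseteq> V" "\<And>v j. v \<in> ball 0 \<rho> \<Longrightarrow> cmod (\<Psi> v $ j) \<le> 1"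
    using bounded_near_0 by blast
  show ?thesis
  proof (intro exI[of _ "\<rho> / 2"] conjI allI impI)
    fix M :: real and j :: 3 assume M: "M > 0"
    define r where "r = \<rho> / (2 * M)"
    have r: "r > 0" using \<rho> M by (simp add: r_def)
    have mem: "v + \<zeta> *s x \<in> ball 0 \<rho>" if "v \<in> ball 0 (\<rho> / 2)" "x \<in> ball 0 M" "\<zeta> \<in> ball 0 r" for v x :: "complex^3" and \<zeta>
    proof -
      have "cmod \<zeta> * norm x \<le> r * M" using that r by (intro mult_mono) auto
      then have "norm (v + \<zeta> *s x) < \<rho> / 2 + r * M"
        using that norm_triangle_ineq[of v "\<zeta> *s x"] by (simp add: norm_vector_smult)
      then show ?thesis using M by (simp add: r_def)
    qed
    have "continuous_on (ball 0 (\<rho> / 2) \<times> ball 0 M) (\<lambda>y. taylor_coeff 1 (\<lambda>\<zeta>. \<Psi> (fst y + \<zeta> *s snd y) $ j))"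
    proof (rule continuous_taylor_coeff[OF _ r, where B = 1])
      show "(\<lambda>\<zeta>. \<Psi> (fst y + \<zeta> *s snd y) $ j) holomorphic_on ball 0 r" if "y \<in> ball 0 (\<rho> / 2) \<times> ball 0 M" for y
        by (rule holomorphic_slice, rule \<Psi>_hol, rule subsetD[OF \<rho>(2)], rule mem) (use that in auto)
      show "cmod (\<Psi> (fst y + \<zeta> *s snd y) $ j) \<le> 1" if "\<zeta> \<in> ball 0 r" "y \<in> ball 0 (\<rho> / 2) \<times> ball 0 M" for y \<zeta>
        using that mem \<rho>(3) by auto
      show "continuous_on (ball 0 (\<rho> / 2) \<times> ball 0 M) (\<lambda>y. \<Psi> (fst y + \<zeta> *s snd y) $ j)" if "\<zeta> \<in> ball 0 r" for \<zeta>
      proof -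
        have "continuous_on (ball 0 \<rho>) \<Psi>"
          using \<rho>(2) D has_derivative_continuous by (intro continuous_at_imp_continuous_on ballI) blast
        then have "continuous_on (ball 0 \<rho>) (\<lambda>v. \<Psi> v $ j)" by (rule continuous_on_component)
        moreover have "continuous_on (ball 0 (\<rho> / 2) \<times> ball 0 M) (\<lambda>y. fst y + \<zeta> *s snd y :: complex^3)"
          unfolding vector_scalar_mult_def by (intro continuous_intros)
        ultimately show ?thesis
          by (rule continuous_on_compose2) (use that mem in auto)
      qed
    qed
    then show "continuous_on (ball 0 (\<rho> / 2) \<times> ball 0 M) (\<lambda>(v, x). D v x $ j)"
    proof (rule continuous_on_eq)
      fix y :: "(complex^3) \<times> (complex^3)" assume "y \<in> ball 0 (\<rho> / 2) \<times> ball 0 M"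
      then have "fst y \<in> V" using \<rho> by (auto simp: subset_iff)
      then show "taylor_coeff 1 (\<lambda>\<zeta>. \<Psi> (fst y + \<zeta> *s snd y) $ j) = (case y of (v, x) \<Rightarrow> D v x $ j)"
        by (simp only: taylor_coeff_D case_prod_unfold)
    qed
  qed (use \<rho> in \<open>auto simp: subset_iff\<close>)
qed

text \<open>The balanced field is homogeneous of degree 2, so dividing by s^2 replaces the point by
  \<open>\<Phi> (axis 3 s) / s\<close>, which tends to \<epsilon>. In the limit the third component
  is \<epsilon>_3^2 times that of \<open>D 0 (axis 3 1)\<close>, the inverse of
  \<epsilon>_3.\<close>

lemma W_third_limit: "((\<lambda>s::real. W (axis 3 (of_real s)) $ 3 / (of_real s)\<^sup>2) \<longlongrightarrow> \<epsilon> $ 3) (at_right 0)"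
proof -
  obtain \<rho> where \<rho>: "\<rho> > 0" "\<And>M j. M > 0 \<Longrightarrow> continuous_on (ball 0 \<rho> \<times> ball 0 M) (\<lambda>(v, x). D v x $ j)" "ball 0 \<rho> \<subseteq> V"
    using continuous_D by blast
  define x0 where "x0 = balanced_field \<Lambda> \<epsilon>"
  define y :: "real \<Rightarrow> complex^3" where "y s = (1 / of_real s) *s \<Phi> (axis 3 (of_real s))" for s
  have y: "(y \<longlongrightarrow> \<epsilon>) (at_right 0)"
    by (rule vec_tendstoI) (use \<Phi>_line in \<open>simp add: y_def\<close>)
  have x: "((\<lambda>s. balanced_field \<Lambda> (y s)) \<longlongrightarrow> x0) (at_right 0)"
    unfolding x0_def
  proof (rule vec_tendstoI)
    fix i :: 3
    show "((\<lambda>s. balanced_field \<Lambda> (y s) $ i) \<longlongrightarrow> balanced_field \<Lambda> \<epsilon> $ i) (at_right 0)"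
      using exhaust_3[of i]
      by (elim disjE; simp add: balanced_field_def; intro tendsto_intros tendsto_vec_nth[OF y])
  qed
  have ax: "((\<lambda>s::real. axis 3 (of_real s) :: complex^3) \<longlongrightarrow> 0) (at_right 0)"
  proof (rule vec_tendstoI)
    show "((\<lambda>s::real. (axis 3 (of_real s) :: complex^3) $ i) \<longlongrightarrow> 0 $ i) (at_right 0)" for i
      by (cases "i = 3") (auto simp: axis_def intro!: tendsto_eq_intros)
  qed
  have "isCont \<Phi> 0" using \<Phi>_hol[OF UV(2)] has_derivative_continuous by (auto simp: complex_differentiable_at_def)
  from isCont_tendsto_compose[OF this ax] have \<Phi>: "((\<lambda>s::real. \<Phi> (axis 3 (of_real s))) \<longlongrightarrow> 0) (at_right 0)" by (simp add: UV(5))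
  define M where "M = norm x0 + 1"
  have M: "M > 0" by (simp add: M_def add_nonneg_pos)
  have pair: "((\<lambda>s. (\<Phi> (axis 3 (of_real s)), balanced_field \<Lambda> (y s))) \<longlongrightarrow> (0, x0)) (at_right 0)"
    by (intro tendsto_Pair \<Phi> x)
  have in0: "(0, x0) \<in> ball 0 \<rho> \<times> ball 0 M" using \<rho>(1) by (simp add: M_def)
  have ev: "\<forall>\<^sub>F s in at_right 0. (\<Phi> (axis 3 (of_real s)), balanced_field \<Lambda> (y s)) \<in> ball 0 \<rho> \<times> ball 0 M"
    by (rule topological_tendstoD[OF pair _ in0]) (intro open_Times open_ball)
  from continuous_on_tendsto_compose[OF \<rho>(2)[OF M] pair in0 ev, of 3]
  have "((\<lambda>s. D (\<Phi> (axis 3 (of_real s))) (balanced_field \<Lambda> (y s)) $ 3) \<longlongrightarrow> D 0 x0 $ 3) (at_right 0)" by simp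
  moreover have "D 0 x0 $ 3 = \<epsilon> $ 3"
    using D_0_third[of x0] \<epsilon>_third by (simp add: x0_def balanced_field_def power2_eq_square)
  ultimately have "((\<lambda>s. D (\<Phi> (axis 3 (of_real s))) (balanced_field \<Lambda> (y s)) $ 3) \<longlongrightarrow> \<epsilon> $ 3) (at_right 0)" by (simp only:)
  moreover have "\<forall>\<^sub>F s in at_right 0. D (\<Phi> (axis 3 (of_real s))) (balanced_field \<Lambda> (y s)) $ 3 = W (axis 3 (of_real s)) $ 3 / (of_real s)\<^sup>2"
    using ev eventually_at_right_less
  proof eventually_elim
    case (elim s)
    have "balanced_field \<Lambda> (c *s v) = c\<^sup>2 *s balanced_field \<Lambda> v" for c v
      by (simp add: balanced_field_def vec_eq_iff forall_3 power2_eq_square mult_ac)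
    moreover have "\<Phi> (axis 3 (of_real s)) \<in> V" using elim(1) \<rho>(3) by auto
    ultimately show ?case
      by (simp add: W_def y_def D_smult power_divide)
  qed
  ultimately show ?thesis by (rule Lim_transform_eventually)
qed

text \<open>\<open>W\<close> is the first Taylor coefficient in \<zeta> of \<Psi> (\<Phi> q +
  \<zeta> X (\<Phi> q)), X being the balanced field. This expression is bounded and holomorphic in q
  along lines, hence so is the coefficient, and \<open>taylor_expansion_3\<close> applies to each
  component.\<close>

lemma W_taylor:
  "\<exists>r>0. \<exists>c C. \<forall>j z1 z2 w. cmod z1 \<le> r \<and> cmod z2 \<le> r \<and> cmod w \<le> r \<longrightarrow>
     vector [z1, z2, w] \<in> U \<and>
     cmod (W (vector [z1, z2, w]) $ j - (\<Sum>i\<le>n. \<Sum>k\<le>n. \<Sum>l\<le>n. c j i k l * z1 ^ i * z2 ^ k * w ^ l))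
       \<le> C j * (cmod z1 ^ Suc n + cmod z2 ^ Suc n + cmod w ^ Suc n)"
proof -
  obtain \<rho> where \<rho>: "\<rho> > 0" "ball 0 \<rho> \<subseteq> V" "\<And>v j. v \<in> ball 0 \<rho> \<Longrightarrow> cmod (\<Psi> v $ j) \<le> 1"
    using bounded_near_0 by blast
  have "isCont \<Phi> 0" using \<Phi>_hol[OF UV(2)] has_derivative_continuous by (auto simp: complex_differentiable_at_def)
  then have "(\<Phi> \<longlongrightarrow> \<Phi> 0) (at 0)" by (simp only: continuous_within)
  then have "(\<Phi> \<longlongrightarrow> \<Phi> 0) (nhds 0)" by (simp only: tendsto_at_iff_tendsto_nhds)
  then have \<Phi>t: "(\<Phi> \<longlongrightarrow> 0) (nhds 0)" by (simp only: UV(5))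
  have "((\<lambda>q. balanced_field \<Lambda> (\<Phi> q)) \<longlongrightarrow> 0) (nhds 0)"
  proof (rule vec_tendstoI)
    fix i :: 3
    show "((\<lambda>q. balanced_field \<Lambda> (\<Phi> q) $ i) \<longlongrightarrow> 0 $ i) (nhds 0)"
      using exhaust_3[of i]
      by (elim disjE; simp add: balanced_field_def) (rule tendsto_eq_intros tendsto_vec_nth[OF \<Phi>t] refl | simp)+
  qed
  from tendstoD[OF this, of "\<rho> / 2"] have "\<forall>\<^sub>F q in nhds 0. dist (balanced_field \<Lambda> (\<Phi> q)) 0 < \<rho> / 2" using \<rho>(1) by simp
  moreover have "\<forall>\<^sub>F q in nhds 0. dist (\<Phi> q) 0 < \<rho> / 2" using tendstoD[OF \<Phi>t, of "\<rho> / 2"] \<rho>(1) by simp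
  moreover have "\<forall>\<^sub>F q in nhds 0. q \<in> U" using UV by (simp add: eventually_nhds_in_open)
  ultimately have "\<forall>\<^sub>F q in nhds 0. q \<in> U \<and> norm (\<Phi> q) < \<rho> / 2 \<and> norm (balanced_field \<Lambda> (\<Phi> q)) < \<rho> / 2"
    by eventually_elim simp
  from nhds_0_vec3_projection[OF this] obtain r0 where r0: "r0 > 0"
    "\<And>z1 z2 w. cmod z1 < r0 \<Longrightarrow> cmod z2 < r0 \<Longrightarrow> cmod w < r0 \<Longrightarrow> vector [z1, z2, w] \<in> U \<and>
      norm (\<Phi> (vector [z1, z2, w])) < \<rho> / 2 \<and> norm (balanced_field \<Lambda> (\<Phi> (vector [z1, z2, w]))) < \<rho> / 2" by blast
  define r where "r = min r0 1"
  have r: "0 < r" "r \<le> 1" using r0 by (auto simp: r_def)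
  define N where "N = {q :: complex^3. cmod (q $ 1) < r \<and> cmod (q $ 2) < r \<and> cmod (q $ 3) < r}"
  have N: "q \<in> U" "norm (\<Phi> q) < \<rho> / 2" "norm (balanced_field \<Lambda> (\<Phi> q)) < \<rho> / 2" if "q \<in> N" for q
  proof -
    have "q = vector [q $ 1, q $ 2, q $ 3]" by (simp add: vec_eq_iff forall_3)
    then show "q \<in> U" "norm (\<Phi> q) < \<rho> / 2" "norm (balanced_field \<Lambda> (\<Phi> q)) < \<rho> / 2"
      using r0(2)[of "q $ 1" "q $ 2" "q $ 3"] that by (auto simp: N_def r_def)
  qed
  define g where "g j \<zeta> q = \<Psi> (\<Phi> q + \<zeta> *s balanced_field \<Lambda> (\<Phi> q)) $ j" for j \<zeta> q
  have mem: "\<Phi> q + \<zeta> *s balanced_field \<Lambda> (\<Phi> q) \<in> ball 0 \<rho>" if "q \<in> N" "\<zeta> \<in> ball 0 1" for q \<zeta>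
  proof -
    have "cmod \<zeta> * norm (balanced_field \<Lambda> (\<Phi> q)) \<le> 1 * (\<rho> / 2)" using that N(3)[OF that(1)] by (intro mult_mono) auto
    then show ?thesis using N(2)[OF that(1)] norm_triangle_ineq[of "\<Phi> q" "\<zeta> *s balanced_field \<Lambda> (\<Phi> q)"] by (simp add: norm_vector_smult)
  qed
  have g1: "(\<lambda>\<zeta>. g j \<zeta> q) holomorphic_on ball 0 1" if "q \<in> N" for j q
    unfolding g_def by (rule holomorphic_slice[where F = \<Psi>], rule \<Psi>_hol, rule subsetD[OF \<rho>(2)], rule mem) (use that in auto)
  have g2: "cmod (g j \<zeta> q) \<le> 1" if "\<zeta> \<in> ball 0 1" "q \<in> N" for j \<zeta> q
    unfolding g_def using that mem \<rho>(3) by blast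
  have cd: "complex_differentiable_at (\<lambda>q. \<Psi> (\<Phi> q + \<zeta> *s balanced_field \<Lambda> (\<Phi> q))) q" if "q \<in> N" "\<zeta> \<in> ball 0 1" for q \<zeta>
  proof (rule complex_differentiable_compose[of \<Psi> "\<lambda>q. \<Phi> q + \<zeta> *s balanced_field \<Lambda> (\<Phi> q)"])
    show "complex_differentiable_at \<Psi> (\<Phi> q + \<zeta> *s balanced_field \<Lambda> (\<Phi> q))"
      using mem[OF that] \<rho>(2) \<Psi>_hol by blast
    have \<Phi>j: "complex_derivative_exists (\<lambda>q. \<Phi> q $ j) q" for j
      using \<Phi>_hol[OF N(1)[OF that(1)]] by (simp add: complex_differentiable_at_iff)
    have "complex_derivative_exists (\<lambda>q. (\<Phi> q + \<zeta> *s balanced_field \<Lambda> (\<Phi> q)) $ j) q" for j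
      using exhaust_3[of j] by (auto simp: balanced_field_def intro!: complex_derivative_exists_intros \<Phi>j)
    then show "complex_differentiable_at (\<lambda>q. \<Phi> q + \<zeta> *s balanced_field \<Lambda> (\<Phi> q)) q"
      by (simp add: complex_differentiable_at_iff)
  qed
  have W: "W q $ j = taylor_coeff 1 (\<lambda>\<zeta>. g j \<zeta> q)" if "q \<in> N" for j q
    unfolding g_def W_def using taylor_coeff_D[OF inverse(1)[OF N(1)[OF that]]] by simp
  have line: "(\<lambda>t. W (a + t *s v) $ j) holomorphic_on ball 0 r" if a: "\<And>t. t \<in> ball 0 r \<Longrightarrow> a + t *s v \<in> N" for a v j
  proof -
    have "(\<lambda>t. taylor_coeff 1 (\<lambda>\<zeta>. g j \<zeta> (a + t *s v))) holomorphic_on ball 0 r"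
    proof (rule holomorphic_taylor_coeff[where r = 1 and B = 1])
      show "(\<lambda>t. g j \<zeta> (a + t *s v)) holomorphic_on ball 0 r" if "\<zeta> \<in> ball 0 1" for \<zeta>
        unfolding g_def by (rule holomorphic_slice[where F = "\<lambda>q. \<Psi> (\<Phi> q + \<zeta> *s balanced_field \<Lambda> (\<Phi> q))"]) (use a cd that in auto)
    qed (use a g1 g2 in auto)
    then show ?thesis by (rule holomorphic_transform) (use a W in auto)
  qed
  have v1: "vector [x, y, z] = vector [0, y, z] + x *s (axis 1 1 :: complex^3)" and v2: "vector [x, y, z] = vector [x, 0, z] + y *s (axis 2 1 :: complex^3)"
    and v3: "vector [x, y, z] = vector [x, y, 0] + z *s (axis 3 1 :: complex^3)" for x y z :: complex
    by (simp_all add: vec_eq_iff forall_3 axis_def)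
  have vN: "vector [x, y, z] \<in> N" if "x \<in> ball 0 r" "y \<in> ball 0 r" "z \<in> ball 0 r" for x y z
    using that by (simp add: N_def)
  define T where "T j c C \<longleftrightarrow> (\<forall>x y z. norm x \<le> r / 4 \<and> norm y \<le> r / 4 \<and> norm z \<le> r / 4 \<longrightarrow>
    norm (W (vector [x, y, z]) $ j - (\<Sum>i\<le>n. \<Sum>k\<le>n. \<Sum>l\<le>n. c i k l * x ^ i * y ^ k * z ^ l)) \<le> C * (norm x ^ Suc n + norm y ^ Suc n + norm z ^ Suc n))" for j c C
  have T: "\<exists>c C. T j c C" for j
    unfolding T_def
  proof (rule taylor_expansion_3[OF r, where B = 2])
    show "(\<lambda>x. W (vector [x, y, z]) $ j) holomorphic_on ball 0 r" if "y \<in> ball 0 r" "z \<in> ball 0 r" for y z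
      by (rule line[of "vector [0, y, z]" "axis 1 1" j, folded v1]) (rule vN, use that in simp_all)
    show "(\<lambda>y. W (vector [x, y, z]) $ j) holomorphic_on ball 0 r" if "x \<in> ball 0 r" "z \<in> ball 0 r" for x z
      by (rule line[of "vector [x, 0, z]" "axis 2 1" j, folded v2]) (rule vN, use that in simp_all)
    show "(\<lambda>z. W (vector [x, y, z]) $ j) holomorphic_on ball 0 r" if "x \<in> ball 0 r" "y \<in> ball 0 r" for x y
      by (rule line[of "vector [x, y, 0]" "axis 3 1" j, folded v3]) (rule vN, use that in simp_all)
    show "cmod (W (vector [x, y, z]) $ j) \<le> 2" if "x \<in> ball 0 r" "y \<in> ball 0 r" "z \<in> ball 0 r" for x y z
      unfolding W[OF vN[OF that]] using norm_taylor_coeff_le[OF g1[OF vN[OF that]] _ g2[OF _ vN[OF that]], of 1 j] by simp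
  qed
  obtain c C where cC: "\<And>j. T j (c j) (C j)"
    using choice[of "\<lambda>j cC. T j (fst cC) (snd cC)"] T by (metis fst_conv snd_conv)
  show ?thesis
  proof (intro exI[of _ "r / 4"] conjI exI[of _ c] exI[of _ C] allI impI)
    fix j z1 z2 w assume z: "cmod z1 \<le> r / 4 \<and> cmod z2 \<le> r / 4 \<and> cmod w \<le> r / 4"
    then have "vector [z1, z2, w] \<in> N" using r by (intro vN) auto
    with N(1) show "vector [z1, z2, w] \<in> U" by blast
    show "cmod (W (vector [z1, z2, w]) $ j - (\<Sum>i\<le>n. \<Sum>k\<le>n. \<Sum>l\<le>n. c j i k l * z1 ^ i * z2 ^ k * w ^ l))
       \<le> C j * (cmod z1 ^ Suc n + cmod z2 ^ Suc n + cmod w ^ Suc n)"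
      using cC[of j] z unfolding T_def by blast
  qed (use r in simp)
qed

end

subsection \<open>Extracting the component of weight 1\<close>

lemma additive_hpoly_eval: "Modules.additive (\<lambda>F. hpoly_eval F q)"
proof -
  have "hpoly_eval F q = lin_ext (\<lambda>m c. c * (\<Prod>j\<in>UNIV. (q $ j) ^ m j)) F" for F
    by (simp add: hpoly_eval_def lin_ext_def)
  then show ?thesis
    by (simp only:) (rule additive_lin_ext, simp add: algebra_simps)
qed

lemma hpoly_eval_single: "hpoly_eval (Poly_Mapping.single m c) q = c * (\<Prod>j\<in>UNIV. (q $ j) ^ m j)"
  by (simp add: hpoly_eval_def)

lemma zpoly_eval_scale:
  fixes p1 p2 k :: nat and s :: real
  assumes "\<And>m. m \<in> Poly_Mapping.keys F \<Longrightarrow> p1 * (fst (fst m) + fst (snd m)) + p2 * (snd (fst m) + snd (snd m)) = k"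
  shows "zpoly_eval F (of_real s ^ p1 * z1) (of_real s ^ p2 * z2) = of_real s ^ k * zpoly_eval F z1 z2"
  unfolding zpoly_eval_lin_ext lin_ext_def sum_distrib_left
proof (intro sum.cong refl)
  fix m assume "m \<in> Poly_Mapping.keys F"
  from assms[OF this] have "(of_real s :: complex) ^ k =
      (of_real s ^ p1) ^ fst (fst m) * (of_real s ^ p2) ^ snd (fst m) * (of_real s ^ p1) ^ fst (snd m) * (of_real s ^ p2) ^ snd (snd m)"
    by (simp add: algebra_simps flip: power_mult power_add)
  then show "Poly_Mapping.lookup F m * (of_real s ^ p1 * z1) ^ fst (fst m) * (of_real s ^ p2 * z2) ^ snd (fst m) *
      cnj (of_real s ^ p1 * z1) ^ fst (snd m) * cnj (of_real s ^ p2 * z2) ^ snd (snd m) =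
    of_real s ^ k * (Poly_Mapping.lookup F m * z1 ^ fst (fst m) * z2 ^ snd (fst m) * cnj z1 ^ fst (snd m) * cnj z2 ^ snd (snd m))"
    by (simp only: power_mult_distrib complex_cnj_mult complex_cnj_power complex_cnj_complex_of_real mult_ac)
qed

text \<open>The weights are multiplied by a common denominator \<open>N\<close>, so that w has
  weight \<open>N\<close> and dilations involve only integral powers of a real parameter.\<close>

locale integer_weights =
  fixes P :: zpoly and p1 p2 N :: nat
  assumes conj_P: "conj_zpoly P = P"
    and keys_P: "\<And>m. m \<in> Poly_Mapping.keys P \<Longrightarrow> p1 * (fst (fst m) + fst (snd m)) + p2 * (snd (fst m) + snd (snd m)) = N"
    and p: "1 \<le> p1" "p1 \<le> N" "1 \<le> p2" "p2 \<le> N"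
begin

definition weight :: "3 \<Rightarrow> nat" where "weight j = (if j = 1 then p1 else if j = 2 then p2 else N)"

definition dilation :: "real \<Rightarrow> complex^3 \<Rightarrow> complex^3" where
  "dilation s q = vector [of_real s ^ p1 * q $ 1, of_real s ^ p2 * q $ 2, of_real s ^ N * q $ 3]"

lemma dilation_component: "dilation s q $ i = of_real s ^ weight i * q $ i"
  using exhaust_3[of i] by (auto simp: dilation_def weight_def)

lemma dilation_model: "q \<in> model_hypersurface P \<Longrightarrow> dilation s q \<in> model_hypersurface P"
proof -
  have e: "complex_of_real s ^ N = of_real (s ^ N)" by simp
  show "q \<in> model_hypersurface P \<Longrightarrow> dilation s q \<in> model_hypersurface P"
    by (simp add: model_hypersurface_def model_function_def dilation_def zpoly_eval_scale[OF keys_P] e del: of_real_power)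
qed

lemma wirtinger_dilation:
  "wirtinger j (model_function P) (dilation s q) = of_real s ^ (N - weight j) * wirtinger j (model_function P) q"
proof -
  have 1: "p1 * (fst (fst m) + fst (snd m)) + p2 * (snd (fst m) + snd (snd m)) = N - p1" if "m \<in> Poly_Mapping.keys (pd1 P)" for m
  proof -
    obtain a1 a2 b where m: "m = ((a1, a2), b)" by (metis surj_pair)
    then have "((Suc a1, a2), b) \<in> Poly_Mapping.keys P"
      using that by (simp add: in_keys_iff lookup_pd1 del: of_nat_Suc)
    from keys_P[OF this] show ?thesis by (simp add: m algebra_simps)
  qed
  have 2: "p1 * (fst (fst m) + fst (snd m)) + p2 * (snd (fst m) + snd (snd m)) = N - p2" if "m \<in> Poly_Mapping.keys (pd2 P)" for m
  proof -
    obtain a1 a2 b where m: "m = ((a1, a2), b)" by (metis surj_pair)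
    then have "((a1, Suc a2), b) \<in> Poly_Mapping.keys P"
      using that by (simp add: in_keys_iff lookup_pd2 del: of_nat_Suc)
    from keys_P[OF this] show ?thesis by (simp add: m algebra_simps)
  qed
  show ?thesis
    using exhaust_3[of j] zpoly_eval_scale[OF 1] zpoly_eval_scale[OF 2]
    by (auto simp: weight_def wirtinger_model[OF conj_P] dilation_def)
qed

text \<open>This is N times the weight of the field z1^a z2^b w^d d/dzj, shifted by N to remain a
  natural number. Weight 1 corresponds to exponent 2 N.\<close>

definition exponent :: "3 \<Rightarrow> nat \<times> nat \<times> nat \<Rightarrow> nat" where
  "exponent j x = (case x of (a, b, d) \<Rightarrow> p1 * a + p2 * b + N * d + (N - weight j))"

definition monomial :: "complex^3 \<Rightarrow> nat \<times> nat \<times> nat \<Rightarrow> complex" where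
  "monomial q x = (case x of (a, b, d) \<Rightarrow> (q $ 1) ^ a * (q $ 2) ^ b * (q $ 3) ^ d)"

lemma monomial_dilation: "monomial (dilation s q) x * of_real s ^ (N - weight j) = of_real s ^ exponent j x * monomial q x"
  by (cases x) (simp add: monomial_def dilation_def exponent_def power_mult_distrib power_add mult_ac flip: power_mult)

text \<open>Only the dilations of a single point of the hypersurface are needed to see that the
  weighted homogeneous parts of a tangent field are tangent.\<close>

lemma tangent_part:
  assumes r: "r > 0" and rem: "\<And>j q. (\<And>i. cmod (q $ i) \<le> r) \<Longrightarrow>
      cmod (W q $ j - (\<Sum>x\<in>B. c j x * monomial q x)) \<le> C j * (\<Sum>i\<in>UNIV. cmod (q $ i) ^ Suc n)"
    and tangent: "\<And>q. (\<And>i. cmod (q $ i) \<le> r) \<Longrightarrow> q \<in> model_hypersurface P \<Longrightarrow> Re (vf_apply W (model_function P) q) = 0"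
    and B: "finite B" and k: "k \<le> n" and q: "q \<in> model_hypersurface P"
  shows "Re (\<Sum>j\<in>UNIV. (\<Sum>x | x \<in> B \<and> exponent j x = k. c j x * monomial q x) * wirtinger j (model_function P) q) = 0"
proof -
  define h where "h j = wirtinger j (model_function P) q" for j
  define R where "R j s = W (dilation s q) $ j - (\<Sum>x\<in>B. c j x * monomial (dilation s q) x)" for j s
  define K where "K = (\<Sum>i\<in>UNIV. cmod (q $ i) ^ Suc n)"
  have small: "\<forall>\<^sub>F s in at_right 0. s < 1 \<and> (\<forall>i. cmod (dilation s q $ i) \<le> r)"
  proof -
    have "((\<lambda>s::real. cmod (dilation s q $ i)) \<longlongrightarrow> 0) (at_right 0)" for i
    proof -
      have "((\<lambda>s::real. cmod (of_real s ^ weight i * q $ i)) \<longlongrightarrow> cmod (of_real 0 ^ weight i * q $ i)) (at_right 0)"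
        by (intro tendsto_intros)
      moreover have "weight i > 0" using p by (simp add: weight_def)
      ultimately show ?thesis by (simp add: dilation_component power_0_left)
    qed
    then have "\<forall>\<^sub>F s in at_right 0. \<forall>i. cmod (dilation s q $ i) < r"
      using r by (intro eventually_all_finite order_tendstoD(2))
    moreover have "\<forall>\<^sub>F s in at_right (0::real). s < 1" by (intro order_tendstoD(2)[OF tendsto_ident_at]) simp
    ultimately show ?thesis by eventually_elim (auto intro: less_imp_le)
  qed
  have R: "\<forall>\<^sub>F s in at_right 0. cmod (R j s) \<le> \<bar>C j\<bar> * K * s ^ Suc n" for j
    using small eventually_at_right_less
  proof eventually_elim
    case (elim s)
    then have s: "0 < s" "s < 1" by simp_all
    have "cmod (R j s) \<le> C j * (\<Sum>i\<in>UNIV. cmod (dilation s q $ i) ^ Suc n)"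
      unfolding R_def using elim by (intro rem) simp
    also have "\<dots> \<le> \<bar>C j\<bar> * (\<Sum>i\<in>UNIV. cmod (dilation s q $ i) ^ Suc n)"
      by (intro mult_right_mono sum_nonneg) auto
    also have "(\<Sum>i\<in>UNIV. cmod (dilation s q $ i) ^ Suc n) \<le> (\<Sum>i\<in>UNIV. (s * cmod (q $ i)) ^ Suc n)"
    proof (intro sum_mono power_mono)
      fix i
      \<comment> \<open>All integral weights are at least 1 and s < 1, so a dilation shrinks each
        coordinate at least by s.\<close>
      have "s ^ weight i \<le> s ^ 1" using s p by (intro power_decreasing) (auto simp: weight_def)
      then show "cmod (dilation s q $ i) \<le> s * cmod (q $ i)"
        using s by (simp add: dilation_component norm_mult norm_power mult_right_mono)
    qed simp
    also have "\<bar>C j\<bar> * (\<Sum>i\<in>UNIV. (s * cmod (q $ i)) ^ Suc n) = \<bar>C j\<bar> * K * s ^ Suc n"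
      by (simp only: K_def power_mult_distrib sum_distrib_left[symmetric] mult_ac)
    finally show ?case by (simp add: mult_left_mono)
  qed
  have R_all: "\<forall>\<^sub>F s in at_right 0. \<forall>j. cmod (R j s) \<le> \<bar>C j\<bar> * K * s ^ Suc n"
    by (intro eventually_all_finite R)
  \<comment> \<open>At the dilated point the real part of the polynomial terms is minus that of the
    Taylor remainder, which is of order s^(n+1). Division by s^k with k at most n leaves order
    s.\<close>
  have main: "\<forall>\<^sub>F s in at_right 0. cmod ((\<Sum>y\<in>UNIV \<times> B. of_real (Re (c (fst y) (snd y) * monomial q (snd y) * h (fst y))) * of_real s ^ exponent (fst y) (snd y)) / of_real s ^ k)
     \<le> (\<Sum>j\<in>UNIV. \<bar>C j\<bar> * K * cmod (h j)) * s"
    using small eventually_at_right_less R_all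
  proof eventually_elim
    case (elim s)
    then have s: "0 < s" "s < 1" by simp_all
    let ?T = "\<Sum>j\<in>UNIV. R j s * (of_real s ^ (N - weight j) * h j)"
    have "vf_apply W (model_function P) (dilation s q)
      = (\<Sum>j\<in>UNIV. (R j s + (\<Sum>x\<in>B. c j x * monomial (dilation s q) x)) * (of_real s ^ (N - weight j) * h j))"
      by (simp add: vf_apply_def R_def wirtinger_dilation h_def)
    also have "\<dots> = ?T + (\<Sum>j\<in>UNIV. \<Sum>x\<in>B. c j x * monomial (dilation s q) x * (of_real s ^ (N - weight j) * h j))"
      by (simp only: distrib_right sum.distrib sum_distrib_right)
    also have "(\<Sum>j\<in>UNIV. \<Sum>x\<in>B. c j x * monomial (dilation s q) x * (of_real s ^ (N - weight j) * h j))
      = (\<Sum>j\<in>UNIV. \<Sum>x\<in>B. c j x * monomial q x * h j * of_real s ^ exponent j x)"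
    proof (intro sum.cong refl)
      show "c j x * monomial (dilation s q) x * (of_real s ^ (N - weight j) * h j) = c j x * monomial q x * h j * of_real s ^ exponent j x" for j x
        using arg_cong[OF monomial_dilation[of s q x j], of "\<lambda>y. c j x * h j * y"] by (simp only: mult_ac)
    qed
    also have "\<dots> = (\<Sum>y\<in>UNIV \<times> B. c (fst y) (snd y) * monomial q (snd y) * h (fst y) * of_real s ^ exponent (fst y) (snd y))"
      by (simp add: sum.cartesian_product case_prod_unfold)
    finally have "Re (?T + (\<Sum>y\<in>UNIV \<times> B. c (fst y) (snd y) * monomial q (snd y) * h (fst y) * of_real s ^ exponent (fst y) (snd y))) = 0"
      using tangent[OF _ dilation_model[OF q], of s] elim(1) by simp
    then have "Re (\<Sum>y\<in>UNIV \<times> B. c (fst y) (snd y) * monomial q (snd y) * h (fst y) * of_real s ^ exponent (fst y) (snd y)) = - Re ?T"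
      by simp
    \<comment> \<open>As s is real, taking the real part acts on the coefficients alone, so the
      comparison of coefficients applies to the real parts.\<close>
    moreover have "(\<Sum>y\<in>UNIV \<times> B. of_real (Re (c (fst y) (snd y) * monomial q (snd y) * h (fst y))) * of_real s ^ exponent (fst y) (snd y))
      = complex_of_real (Re (\<Sum>y\<in>UNIV \<times> B. c (fst y) (snd y) * monomial q (snd y) * h (fst y) * of_real s ^ exponent (fst y) (snd y)))"
    proof -
      have "Re (z * of_real s ^ m) = Re z * s ^ m" for z m
        by (simp flip: of_real_power)
      then show ?thesis by (simp only: Re_sum of_real_sum of_real_mult of_real_power)
    qed
    ultimately have "cmod (\<Sum>y\<in>UNIV \<times> B. of_real (Re (c (fst y) (snd y) * monomial q (snd y) * h (fst y))) * of_real s ^ exponent (fst y) (snd y)) = \<bar>Re ?T\<bar>"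
      by (simp only: norm_of_real abs_minus_cancel)
    also have "\<dots> \<le> cmod ?T" by (rule abs_Re_le_cmod)
    also have "\<dots> \<le> (\<Sum>j\<in>UNIV. \<bar>C j\<bar> * K * cmod (h j) * s ^ Suc n)"
    proof (rule order_trans[OF norm_sum], rule sum_mono)
      fix j
      have "s ^ (N - weight j) \<le> 1" using s by (simp add: power_le_one)
      then have "cmod (R j s) * (s ^ (N - weight j) * cmod (h j)) \<le> (\<bar>C j\<bar> * K * s ^ Suc n) * (1 * cmod (h j))"
        using elim(3) s by (intro mult_mono) (auto simp: K_def intro!: mult_nonneg_nonneg sum_nonneg)
      then show "cmod (R j s * (of_real s ^ (N - weight j) * h j)) \<le> \<bar>C j\<bar> * K * cmod (h j) * s ^ Suc n"
        using s by (simp add: norm_mult norm_power mult_ac)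
    qed
    also have "\<dots> = (\<Sum>j\<in>UNIV. \<bar>C j\<bar> * K * cmod (h j)) * s ^ Suc n" by (simp only: sum_distrib_right)
    also have "\<dots> \<le> (\<Sum>j\<in>UNIV. \<bar>C j\<bar> * K * cmod (h j)) * (s * s ^ k)"
    proof (rule mult_left_mono)
      show "s ^ Suc n \<le> s * s ^ k" using s k power_decreasing[of "Suc k" "Suc n" s] by simp
    qed (auto simp: K_def intro!: sum_nonneg mult_nonneg_nonneg)
    finally show ?case using s by (simp add: norm_divide norm_power pos_divide_le_eq mult.assoc)
  qed
  have "((\<lambda>s::real. (\<Sum>y\<in>UNIV \<times> B. of_real (Re (c (fst y) (snd y) * monomial q (snd y) * h (fst y))) * of_real s ^ exponent (fst y) (snd y)) / of_real s ^ k) \<longlongrightarrow> (0::complex)) (at_right 0)"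
  proof (rule Lim_null_comparison[OF main])
    have "((\<lambda>s::real. (\<Sum>j\<in>UNIV. \<bar>C j\<bar> * K * cmod (h j)) * s) \<longlongrightarrow> (\<Sum>j\<in>UNIV. \<bar>C j\<bar> * K * cmod (h j)) * 0) (at_right 0)"
      by (intro tendsto_intros)
    then show "((\<lambda>s::real. (\<Sum>j\<in>UNIV. \<bar>C j\<bar> * K * cmod (h j)) * s) \<longlongrightarrow> 0) (at_right 0)" by simp
  qed
  from power_sum_coefficients_eq_0[OF _ this order_refl]
  have "(\<Sum>y | y \<in> UNIV \<times> B \<and> exponent (fst y) (snd y) = k. complex_of_real (Re (c (fst y) (snd y) * monomial q (snd y) * h (fst y)))) = 0"
    using B by simp
  then have "Re (\<Sum>y | y \<in> UNIV \<times> B \<and> exponent (fst y) (snd y) = k. c (fst y) (snd y) * monomial q (snd y) * h (fst y)) = 0"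
    by (simp only: of_real_sum[symmetric] of_real_eq_0_iff Re_sum)
  also have "{y. y \<in> UNIV \<times> B \<and> exponent (fst y) (snd y) = k} = (SIGMA j:UNIV. {x. x \<in> B \<and> exponent j x = k})" by auto
  also have "(\<Sum>y\<in>(SIGMA j:UNIV. {x. x \<in> B \<and> exponent j x = k}). c (fst y) (snd y) * monomial q (snd y) * h (fst y)) =
    (\<Sum>j\<in>UNIV. \<Sum>x | x \<in> B \<and> exponent j x = k. c j x * monomial q x * h j)"
    using B by (subst sum.Sigma) (auto simp: case_prod_unfold)
  finally show ?thesis by (simp add: h_def sum_distrib_right)
qed

end

lemma integer_weights_exist:
  assumes "x \<in> \<rat>" "y \<in> \<rat>" "0 < x" "0 < y"
  obtains p1 p2 N :: nat where "N > 0" "p1 > 0" "p2 > 0" "x = real p1 / real N" "y = real p2 / real N"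
proof -
  obtain a b where ab: "b \<noteq> 0" "\<bar>x\<bar> = real a / real b" using Rats_abs_nat_div_natE[OF assms(1)] by metis
  obtain c d where cd: "d \<noteq> 0" "\<bar>y\<bar> = real c / real d" using Rats_abs_nat_div_natE[OF assms(2)] by metis
  show thesis
  proof (rule that[of "b * d" "a * d" "c * b"])
    show "b * d > 0" using ab cd by simp
    show "a * d > 0" "c * b > 0" using ab cd assms by (cases a; cases c; simp)+
  qed (use ab cd assms in \<open>simp_all add: field_simps\<close>)
qed

section \<open>The part of weight 1 of the pulled back field\<close>

context model_equivalence
begin

text \<open>The Taylor terms of \<open>W\<close> with exponent 2 N form a polynomial field of weight
  1, tangent by \<open>tangent_part\<close>. It is not zero because the coefficient of w^2 d/dw is
  \<epsilon>_3.\<close>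

lemma weight_1_component_nonzero:
  assumes "weighted_homogeneous \<mu> P" "fst \<mu> \<in> \<rat>" "snd \<mu> \<in> \<rat>" "0 < fst \<mu>" "0 < snd \<mu>" "fst \<mu> \<le> 1" "snd \<mu> \<le> 1"
  shows "\<exists>X \<in> graded_component P \<mu> 1. X \<noteq> 0"
proof -
  obtain p1 p2 N :: nat where N: "N > 0" "p1 > 0" "p2 > 0" and \<mu>: "fst \<mu> = real p1 / real N" "snd \<mu> = real p2 / real N"
    by (rule integer_weights_exist[OF assms(2-5)])
  interpret integer_weights P p1 p2 N
  proof
    fix m assume "m \<in> Poly_Mapping.keys P"
    then have "weighted_length \<mu> (fst m) + weighted_length \<mu> (snd m) = 1"
      using assms(1) by (auto simp: weighted_homogeneous_def case_prod_unfold)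
    then have "real (p1 * (fst (fst m) + fst (snd m)) + p2 * (snd (fst m) + snd (snd m))) = real N"
      using N(1) by (simp add: weighted_length_def \<mu> divide_simps) (simp add: algebra_simps)
    then show "p1 * (fst (fst m) + fst (snd m)) + p2 * (snd (fst m) + snd (snd m)) = N"
      by (simp only: of_nat_eq_iff)
  qed (use P(1) N assms(6,7) in \<open>simp_all add: \<mu> field_simps\<close>)
  \<comment> \<open>The same number serves as truncation order of the Taylor expansion and as the
    exponent of the fields of weight 1.\<close>
  define n where "n = 2 * N"
  obtain r c C where r: "r > 0" and taylor: "\<And>j z1 z2 w. cmod z1 \<le> r \<Longrightarrow> cmod z2 \<le> r \<Longrightarrow> cmod w \<le> r \<Longrightarrow>
     vector [z1, z2, w] \<in> U \<and>
     cmod (W (vector [z1, z2, w]) $ j - (\<Sum>i\<le>n. \<Sum>k\<le>n. \<Sum>l\<le>n. c j i k l * z1 ^ i * z2 ^ k * w ^ l))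
       \<le> C j * (cmod z1 ^ Suc n + cmod z2 ^ Suc n + cmod w ^ Suc n)"
    using W_taylor[of n] by blast
  define B where "B = {..n} \<times> {..n} \<times> {..n}"
  define d where "d j x = (case x of (i, k, l) \<Rightarrow> c j i k l)" for j and x :: "nat \<times> nat \<times> nat"
  have vec: "vector [q $ 1, q $ 2, q $ 3] = q" for q :: "complex^3" by (simp add: vec_eq_iff forall_3)
  have poly: "(\<Sum>i\<le>n. \<Sum>k\<le>n. \<Sum>l\<le>n. c j i k l * (q $ 1) ^ i * (q $ 2) ^ k * (q $ 3) ^ l) = (\<Sum>x\<in>B. d j x * monomial q x)" for j q
    by (simp add: B_def sum.cartesian_product case_prod_unfold d_def monomial_def mult.assoc)
  have rem: "q \<in> U \<and> cmod (W q $ j - (\<Sum>x\<in>B. d j x * monomial q x)) \<le> C j * (\<Sum>i\<in>UNIV. cmod (q $ i) ^ Suc n)"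
    if "\<And>i. cmod (q $ i) \<le> r" for j q
    using taylor[of "q $ 1" "q $ 2" "q $ 3" j, OF that that that] unfolding vec poly sum_3 .
  define L where "L j = {x. x \<in> B \<and> exponent j x = n}" for j
  define idx where "idx x = (\<lambda>i::3. case x of (a, b, l) \<Rightarrow> if i = 1 then a else if i = 2 then b else l)" for x :: "nat \<times> nat \<times> nat"
  define F where "F j = (\<Sum>x\<in>L j. Poly_Mapping.single (idx x) (d j x))" for j
  define X where "X q = (\<chi> j. hpoly_eval (F j) q)" for q
  have idx: "(\<Prod>i\<in>UNIV. (q $ i) ^ idx x i) = monomial q x" for q x
    unfolding UNIV_3 by (cases x) (simp add: idx_def monomial_def)
  have eval: "hpoly_eval (F j) q = (\<Sum>x\<in>L j. d j x * monomial q x)" for j q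
    unfolding F_def additive.sum[OF additive_hpoly_eval]
    by (simp only: hpoly_eval_single idx)
  have hol: "holomorphic_near_0 X"
    by (simp add: holomorphic_near_0_def complex_differentiable_at_iff X_def complex_derivative_exists_hpoly)
  have tangent: "Re (vf_apply X (model_function P) q) = 0" if "q \<in> model_hypersurface P" for q
  proof -
    have "finite B" by (simp add: B_def)
    from tangent_part[OF r conjunct2[OF rem] W_tangent[OF conjunct1[OF rem]] this order_refl that]
    have "Re (\<Sum>j\<in>UNIV. (\<Sum>x | x \<in> B \<and> exponent j x = n. d j x * monomial q x) * wirtinger j (model_function P) q) = 0" .
    then show ?thesis by (simp add: vf_apply_def X_def eval L_def)
  qed
  have weight: "(\<Sum>k\<in>UNIV. coordinate_weight \<mu> k * real (m k)) - coordinate_weight \<mu> j = 1" if "m \<in> Poly_Mapping.keys (F j)" for m j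
  proof -
    have "m \<in> (\<Union>x\<in>L j. Poly_Mapping.keys (Poly_Mapping.single (idx x) (d j x)))"
      using that unfolding F_def by (rule subsetD[OF keys_sum])
    then obtain x where x: "x \<in> L j" "m = idx x" by (auto split: if_splits)
    obtain a b l where abl: "x = (a, b, l)" by (metis surj_pair)
    have "p1 * a + p2 * b + N * l + (N - weight j) = 2 * N" using x(1) by (simp add: L_def exponent_def abl n_def)
    moreover have wj: "weight j \<le> N" using p by (simp add: weight_def)
    ultimately have "p1 * a + p2 * b + N * l = N + weight j" by simp
    then have "real (p1 * a + p2 * b + N * l) = real (N + weight j)" by (simp only:)
    moreover have "coordinate_weight \<mu> j = real (weight j) / real N"
      using N by (simp add: coordinate_weight_def weight_def \<mu>)
    ultimately show ?thesis using N(1)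
      by (simp add: sum_3 x(2) abl idx_def coordinate_weight_def[of _ 1] coordinate_weight_def[of _ 2] coordinate_weight_def[of _ 3] \<mu> field_simps)
  qed
  have "has_weight \<mu> 1 (abs_vf_germ X)"
    unfolding has_weight_abs[OF hol] using weight by (intro exI[of _ F]) (simp add: X_def)
  moreover have "real_tangent P (abs_vf_germ X)" using tangent by (simp add: real_tangent_abs[OF hol])
  ultimately have "abs_vf_germ X \<in> graded_component P \<mu> 1" by (simp add: graded_component_def aut_def)
  moreover have "abs_vf_germ X \<noteq> 0"
  proof
    have axis_vec: "vector [0, 0, \<zeta>] = (axis 3 \<zeta> :: complex^3)" for \<zeta> by (simp add: vec_eq_iff forall_3 axis_def)
    have c2: "c 3 0 0 2 = \<epsilon> $ 3"
    proof -
      let ?T = "\<lambda>s::real. \<Sum>l\<le>n. c 3 0 0 l * of_real s ^ l"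
      have n2: "2 \<le> n" using N(1) by (simp add: n_def)
      have sum: "(\<Sum>i\<le>n. \<Sum>k\<le>n. \<Sum>l\<le>n. c 3 i k l * 0 ^ i * 0 ^ k * of_real s ^ l) = ?T s" for s
      proof -
        have "(\<Sum>l\<le>n. c 3 i k l * 0 ^ i * 0 ^ k * of_real s ^ l) = (if i = 0 then if k = 0 then ?T s else 0 else 0)" for i k
          by (cases "i = 0"; cases "k = 0"; simp add: power_0_left)
        moreover have "(\<Sum>k\<le>n. if i = 0 then if k = 0 then ?T s else 0 else 0) = (if i = 0 then ?T s else 0)" for i :: nat by simp
        ultimately have "(\<Sum>i\<le>n. \<Sum>k\<le>n. \<Sum>l\<le>n. c 3 i k l * 0 ^ i * 0 ^ k * of_real s ^ l) = (\<Sum>i\<le>n. if i = 0 then ?T s else 0)"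
          by (simp only:)
        then show ?thesis by simp
      qed
      have "\<forall>\<^sub>F s::real in at_right 0. s < min r 1" using r by (intro order_tendstoD(2)[OF tendsto_ident_at]) simp
      then have "\<forall>\<^sub>F s in at_right 0. cmod (W (axis 3 (of_real s)) $ 3 / (of_real s)\<^sup>2 - ?T s / (of_real s)\<^sup>2) \<le> \<bar>C 3\<bar> * s"
        using eventually_at_right_less
      proof eventually_elim
        case (elim s)
        have "cmod (W (axis 3 (of_real s)) $ 3 - ?T s) \<le> C 3 * s ^ Suc n"
          using taylor[of 0 0 "of_real s" 3] elim r unfolding sum axis_vec by simp
        also have "\<dots> \<le> \<bar>C 3\<bar> * s ^ Suc n" using elim by (intro mult_right_mono) auto
        also have "\<dots> \<le> \<bar>C 3\<bar> * s ^ 3" using elim n2 by (intro mult_left_mono power_decreasing) auto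
        also have "\<dots> = \<bar>C 3\<bar> * s * s\<^sup>2" by (simp add: power2_eq_square power3_eq_cube)
        finally show ?case using elim
          by (simp add: norm_divide norm_power pos_divide_le_eq flip: diff_divide_distrib)
      qed
      then have "((\<lambda>s. W (axis 3 (of_real s)) $ 3 / (of_real s)\<^sup>2 - ?T s / (of_real s)\<^sup>2) \<longlongrightarrow> 0) (at_right 0)"
      proof (rule Lim_null_comparison)
        have "((\<lambda>s. \<bar>C 3\<bar> * s) \<longlongrightarrow> \<bar>C 3\<bar> * 0) (at_right 0)" by (intro tendsto_intros)
        then show "((\<lambda>s. \<bar>C 3\<bar> * s) \<longlongrightarrow> 0) (at_right 0)" by simp
      qed
      from tendsto_diff[OF W_third_limit this] have lim: "((\<lambda>s. ?T s / (of_real s)\<^sup>2) \<longlongrightarrow> \<epsilon> $ 3) (at_right 0)" by simp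
      \<comment> \<open>Subtracting \<epsilon>_3 s^2 makes the polynomial o(s^2), so its coefficient
        at s^2 is 0.\<close>
      have "((\<lambda>s::real. (\<Sum>l\<le>n. (c 3 0 0 l - (if l = 2 then \<epsilon> $ 3 else 0)) * of_real s ^ l) / of_real s ^ 2) \<longlongrightarrow> 0) (at_right 0)"
      proof (rule Lim_transform_eventually)
        show "((\<lambda>s. ?T s / (of_real s)\<^sup>2 - \<epsilon> $ 3) \<longlongrightarrow> 0) (at_right 0)" using tendsto_diff[OF lim tendsto_const[of "\<epsilon> $ 3"]] by simp
        show "\<forall>\<^sub>F s in at_right 0. ?T s / (of_real s)\<^sup>2 - \<epsilon> $ 3
          = (\<Sum>l\<le>n. (c 3 0 0 l - (if l = 2 then \<epsilon> $ 3 else 0)) * of_real s ^ l) / of_real s ^ 2"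
          using eventually_at_right_less
        proof eventually_elim
          case (elim s)
          have "(\<Sum>l\<le>n. (c 3 0 0 l - (if l = 2 then \<epsilon> $ 3 else 0)) * of_real s ^ l) = ?T s - (\<Sum>l\<le>n. if l = 2 then \<epsilon> $ 3 * of_real s ^ 2 else 0)"
            unfolding sum_subtractf[symmetric] by (intro sum.cong refl) (auto simp: algebra_simps)
          also have "\<dots> = ?T s - \<epsilon> $ 3 * of_real s ^ 2" using n2 by simp
          finally show ?case using elim by (simp add: diff_divide_distrib)
        qed
      qed
      from power_sum_coefficients_eq_0[OF finite_atMost this order_refl]
      have "(\<Sum>l | l \<in> {..n} \<and> l = 2. c 3 0 0 l - (if l = 2 then \<epsilon> $ 3 else 0)) = 0" .
      also have "{l. l \<in> {..n} \<and> l = 2} = {2}" using n2 by auto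
      finally show ?thesis by simp
    qed
    \<comment> \<open>On the w-axis only pure powers of w survive, and exponent 2 N in the d/dw
      component singles out w^2.\<close>
    have third: "X (axis 3 \<zeta>) $ 3 = c 3 0 0 2 * \<zeta>\<^sup>2" for \<zeta>
    proof -
      have "X (axis 3 \<zeta>) $ 3 = (\<Sum>x\<in>L 3. if x = (0, 0, 2) then c 3 0 0 2 * \<zeta>\<^sup>2 else 0)"
        unfolding X_def vec_lambda_beta eval
      proof (intro sum.cong refl)
        fix x assume "x \<in> L 3"
        then show "d 3 x * monomial (axis 3 \<zeta>) x = (if x = (0, 0, 2) then c 3 0 0 2 * \<zeta>\<^sup>2 else 0)"
          using N(1) by (cases x) (auto simp: L_def exponent_def weight_def n_def d_def monomial_def axis_def power_0_left)
      qed
      also have "\<dots> = c 3 0 0 2 * \<zeta>\<^sup>2"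
        using N(1) by (simp add: L_def B_def exponent_def weight_def n_def)
      finally show ?thesis .
    qed
    assume "abs_vf_germ X = 0"
    then have "\<forall>\<^sub>F q in nhds 0. X q = 0" by (simp add: abs_vf_germ_eq_0_iff[OF hol])
    from nhds_0_vec3_projection[OF this] obtain \<rho> where \<rho>: "\<rho> > 0"
      "\<And>z1 z2 w. cmod z1 < \<rho> \<Longrightarrow> cmod z2 < \<rho> \<Longrightarrow> cmod w < \<rho> \<Longrightarrow> X (vector [z1, z2, w]) = 0" by blast
    have "X (axis 3 (of_real (\<rho> / 2))) = 0" using \<rho>(2)[of 0 0 "of_real (\<rho> / 2)"] \<rho>(1) by (simp add: axis_vec)
    with third[of "of_real (\<rho> / 2)"] have "c 3 0 0 2 = 0" using \<rho>(1) by simp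
    with c2 \<epsilon>_third show False by simp
  qed
  ultimately show ?thesis by blast
qed

end

theorem theorem1p7:
  fixes P :: zpoly and \<mu> :: "real \<times> real"
  assumes "finite_multitype (model_hypersurface P) 0 \<mu>"
    and "real_valued P"
    and "weighted_homogeneous \<mu> P"
    and "no_pluriharmonic_terms P"
    and "holomorphically_nondegenerate P"
  shows "dim (graded_component P \<mu> 1) > 0 \<longleftrightarrow>
    (\<exists>\<Phi> U. multitype_coordinates (model_hypersurface P) 0 \<Phi> U \<and>
       balanced_in_coordinates (model_hypersurface P) 0 \<Phi> U)"
proof
  assume "dim (graded_component P \<mu> 1) > 0"
  then show "\<exists>\<Phi> U. multitype_coordinates (model_hypersurface P) 0 \<Phi> U \<and>
       balanced_in_coordinates (model_hypersurface P) 0 \<Phi> U"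
    by (rule balanced_coordinates_of_dim[OF assms])
next
  have \<mu>: "fst \<mu> \<in> \<rat>" "snd \<mu> \<in> \<rat>" "0 < fst \<mu>" "0 < snd \<mu>" "fst \<mu> \<le> 1" "snd \<mu> \<le> 1"
    using assms(1) by (auto simp: finite_multitype_def multitype_weight_def is_weight_def)
  assume "\<exists>\<Phi> U. multitype_coordinates (model_hypersurface P) 0 \<Phi> U \<and>
       balanced_in_coordinates (model_hypersurface P) 0 \<Phi> U"
  then obtain \<Phi> U Q where \<Phi>: "local_coordinates \<Phi> U 0"
    and Q: "real_valued Q" "no_pluriharmonic_terms Q" "balanced Q"
    and image: "\<Phi> ` (model_hypersurface P \<inter> U) = model_hypersurface Q \<inter> \<Phi> ` U"
    unfolding multitype_coordinates_def balanced_in_coordinates_def adapted_coordinates_def leading_polynomial_def by blast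
  obtain \<Lambda> where \<Lambda>: "\<And>m. m \<in> Poly_Mapping.keys Q \<Longrightarrow> weighted_length \<Lambda> (fst m) = 1"
    using Q(3) unfolding balanced_def case_prod_unfold by blast
  have inj: "inj_on \<Phi> U" and U: "0 \<in> U" "\<Phi> 0 = 0"
    and hol: "holomorphic_map_on \<Phi> U" "holomorphic_map_on (inv_into U \<Phi>) (\<Phi> ` U)"
    using \<Phi> by (simp_all add: local_coordinates_def)
  interpret model_equivalence P Q \<Lambda> \<Phi> "inv_into U \<Phi>" U "\<Phi> ` U"
  proof
    show "inv_into U \<Phi> v \<in> model_hypersurface P" if v: "v \<in> \<Phi> ` U" "v \<in> model_hypersurface Q" for v
    proof -
      have "v \<in> \<Phi> ` (model_hypersurface P \<inter> U)" using image v by blast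
      then show ?thesis using inj by auto
    qed
    show "0 \<in> \<Phi> ` U" "inv_into U \<Phi> 0 = 0" using U inv_into_f_f[OF inj U(1)] by (force, simp)
  qed (use assms Q \<Lambda> U hol image inj in \<open>auto simp: real_valued_iff holomorphic_map_on_def\<close>)
  obtain X where "X \<in> graded_component P \<mu> 1" "X \<noteq> 0"
    using weight_1_component_nonzero[OF assms(3) \<mu>] by blast
  then show "dim (graded_component P \<mu> 1) > 0" by (rule dim_pos_graded_component[OF \<mu>(3,4)])
qed

end
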